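(* Let $\alpha_1,\alpha_2\in\mathbb{R}$, $0<q_1,q_2\le\infty$ and $0<p_1,p_2<\infty$. If $$2(\alpha_1+d)<(d+1)\Big(\alpha_2-\frac1{p_2}+1\Big)+\frac{d}{p_1},$$ then there exists a sequence of functions $\{f^{(j)}\}_{j\ge0}$ such that $\|f^{(j)}\|_{\mathbf{F}^{\alpha_2,q_2}_{p_2}(AB)}\approx1$ (i.e. bounded above and below by positive constants independent of $j$), but $\|f^{(j)}\|_{\mathbf{F}^{\alpha_1,q_1}_{p_1}}\to0$ as $j\to\infty$.
   Context: Let $d\ge2$. Frequency vectors $\xi\in\hat{\mathbb{R}}^d$ are row vectors, and $\hat g(\xi)=\int_{\mathbb{R}^d}g(x)e^{-2\pi i\xi x}dx$. $\mathcal{S}$, $\mathcal{S}'$ are the Schwartz class and tempered distributions on $\mathbb{R}^d$. Classical (dyadic isotropic) inhomogeneous Triebel–Lizorkin space. Let $\varphi,\Phi\in\mathcal{S}$ with $\operatorname{supp}\hat\varphi\subseteq\{\frac12\le|\xi|\le2\}$, $\operatorname{supp}\hat\Phi\subseteq\{|\xi|\le2\}$, $|\hat\varphi(\xi)|\ge c>0$ for $\frac35\le|\xi|\le\frac53$, $|\hat\Phi(\xi)|\ge c>0$ for $|\xi|\le\frac53$; $\varphi_{2^\nu I}(x)=2^{d\nu}\varphi(2^\nu x)$. $\mathbf{F}^{\alpha,q}_p$ is the set of $f\in\mathcal{S}'$ with $\|f\|_{\mathbf{F}^{\alpha,q}_p}=\|\Phi*f\|_{L^p}+\big\|\big(\sum_{\nu=0}^\infty(2^{\nu\alpha}|\varphi_{2^\nu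 I}*f|)^q\big)^{1/q}\big\|_{L^p}<\infty$. Shearlets. Fix $\hat\psi_1,\hat\psi_2\in C^\infty(\mathbb{R})$ with $\operatorname{supp}\hat\psi_1\subset[-\frac12,-\frac1{16}]\cup[\frac1{16},\frac12]$, $\operatorname{supp}\hat\psi_2\subset[-1,1]$, $\sum_{j\ge0}|\hat\psi_1(2^{-2j}\omega)|^2=1$ for $|\omega|\ge\frac18$, and $|\hat\psi_2(\omega-1)|^2+|\hat\psi_2(\omega)|^2+|\hat\psi_2(\omega+1)|^2=1$ for $|\omega|\le1$. For $\mathfrak d=1,\dots,d$ let $\hat\psi^{(\mathfrak d)}(\xi)=\hat\psi_1(\xi_{\mathfrak d})\prod_{i\ne\mathfrak d}\hat\psi_2(\xi_i/\xi_{\mathfrak d})$. Let $A_{(\mathfrak d)}$ be the diagonal $d\times d$ matrix with entry $4$ in position $\mathfrak d$ and $2$ elsewhere. For $\ell\in\mathbb{Z}^{d-1}$ let $B^{[\ell]}_{(\mathfrak d)}$ be the identity matrix with the off-diagonal entries of row $\mathfrak d$ replaced, in order, by $\ell_1,\dots,\ell_{d-1}$; its inverse is $B^{[-\ell]}_{(\mathfrak d)}$. Write $|[\ell]|\preceq2^j$ if $|\ell_i|\le2^j$ for all $i$. For an invertible matrix $M$, $\psi_M(x)=|\det M|^{-1}\psi(M^{-1}x)$, and $\tilde\psi(x)=\overline{\psi(-x)}$. Let $\hat\Psi\in C_c^\infty(\hat{\mathbb{R}}^d)$ with $\operatorname{supp}\hat\Psi\subset[-\frac14,\frac14]^d$ and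 $|\hat\Psi|=1$ on $\mathcal R=[-\frac18,\frac18]^d$ be such that for all $\xi$ $$|\hat\Psi(\xi)|^2\chi_{\mathcal R}(\xi)+\sum_{\mathfrak d=1}^d\sum_{j\ge0}\sum_{|[\ell]|\preceq2^j}|\hat\psi^{(\mathfrak d)}(\xi A^{-j}_{(\mathfrak d)}B^{[-\ell]}_{(\mathfrak d)})|^2\chi_{\mathcal D^{(\mathfrak d)}}(\xi)=1,$$ where $\mathcal D^{(\mathfrak d)}=\{\xi:|\xi_{\mathfrak d}|\ge\frac18,\ |\xi_i/\xi_{\mathfrak d}|\le1\ (i\ne\mathfrak d)\}$. Put $|Q_j|=2^{-(d+1)j}$. Shear anisotropic inhomogeneous Triebel–Lizorkin space. $\mathbf{F}^{\alpha,q}_p(AB)$ is the set of $f\in\mathcal{S}'$ with $$\|f\|_{\mathbf{F}^{\alpha,q}_p(AB)}=\|f*\Psi\|_{L^p}+\Big\|\Big(\sum_{\mathfrak d=1}^d\sum_{j\ge0}\sum_{|[\ell]|\preceq2^j}\big[|Q_j|^{-\alpha}|\tilde\psi^{(\mathfrak d)}_{A^{-j}_{(\mathfrak d)}B^{[-\ell]}_{(\mathfrak d)}}*f|\big]^q\Big)^{1/q}\Big\|_{L^p}<\infty$$ (supremum when $q=\infty$).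
   Formalization: The partition identity for Ψ̂ and the shearlets is required for almost every ξ rather than for all ξ: as written it cannot hold, since where two cones overlap (e.g. ξ=(1,1,0,…,0)) the sum is at least 2. *)

theory Defs
  imports "HOL-Analysis.Analysis"
begin

subsection \<open>Smooth functions, the Schwartz class, tempered distributions\<close>

primrec iter_partial :: "'a::euclidean_space list \<Rightarrow> ('a \<Rightarrow> complex) \<Rightarrow> 'a \<Rightarrow> complex" where
  "iter_partial [] f = f"
| "iter_partial (b # bs) f = (\<lambda>x. frechet_derivative (iter_partial bs f) (at x) b)"

definition smooth :: "('a::euclidean_space \<Rightarrow> complex) \<Rightarrow> bool" where
  "smooth f \<longleftrightarrow> (\<forall>bs \<in> lists Basis. \<forall>x. iter_partial bs f differentiable (at x))"

definition supp :: "('a::topological_space \<Rightarrow> complex) \<Rightarrow> 'a set" where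
  "supp f = closure {x. f x \<noteq> 0}"

definition weighted_partial ::
  "nat \<Rightarrow> 'a::euclidean_space list \<Rightarrow> ('a \<Rightarrow> complex) \<Rightarrow> 'a \<Rightarrow> complex" where
  "weighted_partial k bs f x = (1 + norm x) ^ k *\<^sub>R iter_partial bs f x"

definition schwartz :: "('a::euclidean_space \<Rightarrow> complex) set" where
  "schwartz = {f. smooth f \<and>
     (\<forall>k. \<forall>bs \<in> lists Basis. bounded (range (weighted_partial k bs f)))}"

definition schwartz_tendsto ::
  "(nat \<Rightarrow> 'a::euclidean_space \<Rightarrow> complex) \<Rightarrow> ('a \<Rightarrow> complex) \<Rightarrow> bool" where
  "schwartz_tendsto u g \<longleftrightarrow> (\<forall>k. \<forall>bs \<in> lists Basis.
     uniform_limit UNIV (\<lambda>n. weighted_partial k bs (u n)) (weighted_partial k bs g) sequentially)"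

text \<open>A distribution is a functional on functions of which only the restriction to
  \<^const>\<open>schwartz\<close> matters. The Schwartz class is metrizable, so that continuity is
  sequential continuity.\<close>

definition tempered_distribution :: "(('a::euclidean_space \<Rightarrow> complex) \<Rightarrow> complex) \<Rightarrow> bool" where
  "tempered_distribution T \<longleftrightarrow>
     (\<forall>f \<in> schwartz. \<forall>g \<in> schwartz. T (\<lambda>x. f x + g x) = T f + T g) \<and>
     (\<forall>f \<in> schwartz. \<forall>c. T (\<lambda>x. c * f x) = c * T f) \<and>
     (\<forall>u g. (\<forall>n. u n \<in> schwartz) \<longrightarrow> g \<in> schwartz \<longrightarrow> schwartz_tendsto u g \<longrightarrow>
        (\<lambda>n. T (u n)) \<longlonglongrightarrow> T g)"

definition dist_of :: "('a::euclidean_space \<Rightarrow> complex) \<Rightarrow> ('a \<Rightarrow> complex) \<Rightarrow> complex" where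
  "dist_of f = (\<lambda>g. LINT x|lborel. f x * g x)"

text \<open>The integrability clause excludes functions for which the integral in
  \<^const>\<open>dist_of\<close> does not exist and is 0 by convention.\<close>

definition tempered_function :: "('a::euclidean_space \<Rightarrow> complex) \<Rightarrow> bool" where
  "tempered_function f \<longleftrightarrow>
     (\<forall>g \<in> schwartz. integrable lborel (\<lambda>x. f x * g x)) \<and> tempered_distribution (dist_of f)"

definition conv_dist ::
  "('a::euclidean_space \<Rightarrow> complex) \<Rightarrow> (('a \<Rightarrow> complex) \<Rightarrow> complex) \<Rightarrow> 'a \<Rightarrow> complex" where
  "conv_dist g T x = T (\<lambda>y. g (x - y))"

definition fourier :: "(real^'d \<Rightarrow> complex) \<Rightarrow> real^'d \<Rightarrow> complex" where
  "fourier g \<xi> = (LINT x|lborel. g x * cis (- (2 * pi * (\<xi> \<bullet> x))))"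

definition inv_fourier :: "(real^'d \<Rightarrow> complex) \<Rightarrow> real^'d \<Rightarrow> complex" where
  "inv_fourier h x = (LINT \<xi>|lborel. h \<xi> * cis (2 * pi * (\<xi> \<bullet> x)))"


subsection \<open>Extended-valued quasi-norms\<close>

text \<open>Power of an extended nonnegative number; used for positive exponents only.\<close>

definition epow :: "ennreal \<Rightarrow> real \<Rightarrow> ennreal" where
  "epow a r = (if a = \<infinity> then \<infinity> else ennreal (enn2real a powr r))"

definition Lp_norm :: "real \<Rightarrow> ('a::euclidean_space \<Rightarrow> ennreal) \<Rightarrow> ennreal" where
  "Lp_norm p F = epow (\<integral>\<^sup>+ x. epow (F x) p \<partial>lborel) (1 / p)"

definition lq_norm :: "ennreal \<Rightarrow> 'i set \<Rightarrow> ('i \<Rightarrow> ennreal) \<Rightarrow> ennreal" where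
  "lq_norm q I a =
     (if q = \<infinity> then (SUP i\<in>I. a i)
      else epow (infsum (\<lambda>i. epow (a i) (enn2real q)) I) (1 / enn2real q))"


subsection \<open>Classical inhomogeneous Triebel--Lizorkin spaces\<close>

definition isotropic_system :: "(real^'d \<Rightarrow> complex) \<Rightarrow> (real^'d \<Rightarrow> complex) \<Rightarrow> bool" where
  "isotropic_system \<phi> \<Phi> \<longleftrightarrow> \<phi> \<in> schwartz \<and> \<Phi> \<in> schwartz \<and>
     supp (fourier \<phi>) \<subseteq> {\<xi>. 1/2 \<le> norm \<xi> \<and> norm \<xi> \<le> 2} \<and>
     supp (fourier \<Phi>) \<subseteq> {\<xi>. norm \<xi> \<le> 2} \<and>
     (\<exists>c>0. \<forall>\<xi>. 3/5 \<le> norm \<xi> \<and> norm \<xi> \<le> 5/3 \<longrightarrow> c \<le> cmod (fourier \<phi> \<xi>)) \<and>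
     (\<exists>c>0. \<forall>\<xi>. norm \<xi> \<le> 5/3 \<longrightarrow> c \<le> cmod (fourier \<Phi> \<xi>))"

definition iso_dilate :: "nat \<Rightarrow> (real^'d \<Rightarrow> complex) \<Rightarrow> real^'d \<Rightarrow> complex" where
  "iso_dilate \<nu> \<phi> x = 2 ^ (CARD('d) * \<nu>) * \<phi> (2 ^ \<nu> *\<^sub>R x)"

definition TL_norm ::
  "(real^'d \<Rightarrow> complex) \<Rightarrow> (real^'d \<Rightarrow> complex) \<Rightarrow> real \<Rightarrow> ennreal \<Rightarrow> real \<Rightarrow>
   ((real^'d \<Rightarrow> complex) \<Rightarrow> complex) \<Rightarrow> ennreal" where
  "TL_norm \<phi> \<Phi> \<alpha> q p T =
     Lp_norm p (\<lambda>x. ennreal (cmod (conv_dist \<Phi> T x))) +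
     Lp_norm p (\<lambda>x. lq_norm q (UNIV :: nat set)
       (\<lambda>\<nu>. ennreal (2 powr (real \<nu> * \<alpha>) * cmod (conv_dist (iso_dilate \<nu> \<phi>) T x))))"

definition TL_space ::
  "(real^'d \<Rightarrow> complex) \<Rightarrow> (real^'d \<Rightarrow> complex) \<Rightarrow> real \<Rightarrow> ennreal \<Rightarrow> real \<Rightarrow>
   ((real^'d \<Rightarrow> complex) \<Rightarrow> complex) set" where
  "TL_space \<phi> \<Phi> \<alpha> q p = {T. tempered_distribution T \<and> TL_norm \<phi> \<Phi> \<alpha> q p T < \<infinity>}"


subsection \<open>Shearlets\<close>

text \<open>The shearlet generators are given on the Fourier side: the arguments \<open>h1\<close>, \<open>h2\<close>, \<open>H\<close>
  below stand for \<open>\<psi>\<^sub>1\<close>, \<open>\<psi>\<^sub>2\<close>, \<open>\<Psi>\<close> with a hat.\<close>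

definition shear_generators :: "(real \<Rightarrow> complex) \<Rightarrow> (real \<Rightarrow> complex) \<Rightarrow> bool" where
  "shear_generators h1 h2 \<longleftrightarrow> smooth h1 \<and> smooth h2 \<and>
     supp h1 \<subseteq> {-1/2..-1/16} \<union> {1/16..1/2} \<and>
     supp h2 \<subseteq> {-1..1} \<and>
     (\<forall>\<omega>. \<bar>\<omega>\<bar> \<ge> 1/8 \<longrightarrow> (\<lambda>j. (cmod (h1 (\<omega> / 2 ^ (2 * j))))\<^sup>2) sums 1) \<and>
     (\<forall>\<omega>. \<bar>\<omega>\<bar> \<le> 1 \<longrightarrow>
        (cmod (h2 (\<omega> - 1)))\<^sup>2 + (cmod (h2 \<omega>))\<^sup>2 + (cmod (h2 (\<omega> + 1)))\<^sup>2 = 1)"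

definition psi_hat ::
  "(real \<Rightarrow> complex) \<Rightarrow> (real \<Rightarrow> complex) \<Rightarrow> 'd::finite \<Rightarrow> real^'d \<Rightarrow> complex" where
  "psi_hat h1 h2 \<delta> \<xi> = h1 (\<xi> $ \<delta>) * (\<Prod>i\<in>UNIV - {\<delta>}. h2 (\<xi> $ i / \<xi> $ \<delta>))"

definition dil :: "'d::finite \<Rightarrow> real^'d^'d" where
  "dil \<delta> = (\<chi> i k. if i = k then (if i = \<delta> then 4 else 2) else 0)"

definition matrix_pow :: "real^'d^'d \<Rightarrow> nat \<Rightarrow> real^'d^'d" where
  "matrix_pow M n = (((**) M) ^^ n) (mat 1)"

text \<open>A vector of \<open>d - 1\<close> integers is encoded by the integers that fill the off-diagonal
  positions of row \<open>\<delta>\<close>, with a dummy component 0 at \<open>\<delta>\<close>.\<close>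

definition shear :: "'d::finite \<Rightarrow> int^'d \<Rightarrow> real^'d^'d" where
  "shear \<delta> l = (\<chi> i k. if i = k then 1 else if i = \<delta> then real_of_int (l $ k) else 0)"

definition shear_params :: "'d::finite \<Rightarrow> nat \<Rightarrow> (int^'d) set" where
  "shear_params \<delta> j = {l. l $ \<delta> = 0 \<and> (\<forall>i. \<bar>l $ i\<bar> \<le> 2 ^ j)}"

definition dil_shear :: "'d::finite \<Rightarrow> nat \<Rightarrow> int^'d \<Rightarrow> real^'d^'d" where
  "dil_shear \<delta> j l = matrix_pow (matrix_inv (dil \<delta>)) j ** shear \<delta> (- l)"

definition mat_dilate :: "real^'d^'d \<Rightarrow> (real^'d \<Rightarrow> complex) \<Rightarrow> real^'d \<Rightarrow> complex" where
  "mat_dilate M g x = of_real (inverse \<bar>det M\<bar>) * g (matrix_inv M *v x)"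

definition tilde :: "(real^'d \<Rightarrow> complex) \<Rightarrow> real^'d \<Rightarrow> complex" where
  "tilde g x = cnj (g (- x))"

definition low_cube :: "(real^'d) set" where
  "low_cube = {\<xi>. \<forall>i. \<bar>\<xi> $ i\<bar> \<le> 1/8}"

definition freq_cone :: "'d::finite \<Rightarrow> (real^'d) set" where
  "freq_cone \<delta> = {\<xi>. \<bar>\<xi> $ \<delta>\<bar> \<ge> 1/8 \<and> (\<forall>i. i \<noteq> \<delta> \<longrightarrow> \<bar>\<xi> $ i / \<xi> $ \<delta>\<bar> \<le> 1)}"

text \<open>The partition of unity can hold almost everywhere only: the closed sets
  \<^const>\<open>low_cube\<close> and \<^const>\<open>freq_cone\<close> overlap in null sets, e.g. where
  \<open>\<bar>\<xi>\<^sub>1\<bar> = \<bar>\<xi>\<^sub>2\<bar>\<close> is the largest component, and there the sum exceeds 1. Required at every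
  point, the condition would be unsatisfiable.\<close>

definition shear_low_pass ::
  "(real \<Rightarrow> complex) \<Rightarrow> (real \<Rightarrow> complex) \<Rightarrow> (real^'d \<Rightarrow> complex) \<Rightarrow> bool" where
  "shear_low_pass h1 h2 H \<longleftrightarrow> smooth H \<and>
     supp H \<subseteq> {\<xi>. \<forall>i. \<bar>\<xi> $ i\<bar> \<le> 1/4} \<and>
     (\<forall>\<xi>\<in>low_cube. cmod (H \<xi>) = 1) \<and>
     (AE \<xi> in lborel.
        ennreal ((cmod (H \<xi>))\<^sup>2) * indicator low_cube \<xi> +
        (\<Sum>\<delta>\<in>UNIV. \<Sum>j. \<Sum>l\<in>shear_params \<delta> j.
           ennreal ((cmod (psi_hat h1 h2 \<delta> (\<xi> v* dil_shear \<delta> j l)))\<^sup>2)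
             * indicator (freq_cone \<delta>) \<xi>) = 1)"

definition vol_Q :: "'d::finite itself \<Rightarrow> nat \<Rightarrow> real" where
  "vol_Q _ j = 2 powr (- (real (CARD('d) + 1) * real j))"

definition shear_TL_norm ::
  "(real \<Rightarrow> complex) \<Rightarrow> (real \<Rightarrow> complex) \<Rightarrow> (real^'d \<Rightarrow> complex) \<Rightarrow>
   real \<Rightarrow> ennreal \<Rightarrow> real \<Rightarrow> ((real^'d \<Rightarrow> complex) \<Rightarrow> complex) \<Rightarrow> ennreal" where
  "shear_TL_norm h1 h2 H \<alpha> q p T =
     Lp_norm p (\<lambda>x. ennreal (cmod (conv_dist (inv_fourier H) T x))) +
     Lp_norm p (\<lambda>x. lq_norm q (SIGMA \<delta>:UNIV. SIGMA j:UNIV. shear_params \<delta> j)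
       (\<lambda>(\<delta>, j, l). ennreal (vol_Q TYPE('d) j powr (- \<alpha>) *
          cmod (conv_dist
            (mat_dilate (dil_shear \<delta> j l) (tilde (inv_fourier (psi_hat h1 h2 \<delta>)))) T x))))"

definition shear_TL_space ::
  "(real \<Rightarrow> complex) \<Rightarrow> (real \<Rightarrow> complex) \<Rightarrow> (real^'d \<Rightarrow> complex) \<Rightarrow>
   real \<Rightarrow> ennreal \<Rightarrow> real \<Rightarrow> ((real^'d \<Rightarrow> complex) \<Rightarrow> complex) set" where
  "shear_TL_space h1 h2 H \<alpha> q p =
     {T. tempered_distribution T \<and> shear_TL_norm h1 h2 H \<alpha> q p T < \<infinity>}"

end

theory Submission
  imports Defs
begin

text \<open>Only one side of each norm needs a rate. Dividing by the exact shear norm makes it equal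
  to 1, so from above it only has to be finite, and it is because \<open>dilate J\<close> meets only
  terms with \<open>j < J + 3\<close>. For exponents below 1 the norms are mere quasi-norms; the
  argument therefore uses no triangle inequality, only homogeneity, monotonicity and a count of
  nonzero terms. The exponents arise as follows. The factor 2^(J (d + 1)) is both the Jacobian of
  the dilation and \<open>1 / vol_Q\<close>, whence (d + 1) (\<alpha>2 - 1/p2). On the isotropic
  side the frequencies have size 4^J, which costs 2 J \<alpha>1, while in space only the weakest
  stretch 2^J is kept, in all d directions, whence - J d/p1. This gives up the stronger stretch in
  direction \<delta>, but the hypothesis says exactly that the isotropic rate is below the shear
  rate plus 1 - d. To find frequency supports, a convolution is always computed with one factor
  written as \<open>inv_fourier\<close> of a known symbol and the other entering through
  \<open>fourier\<close>.\<close>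

text \<open>The functions are dilates \<open>f\<^sub>J(x) = f(4\<^sup>J x\<^sub>\<delta>, 2\<^sup>J x')\<close> of one Schwartz-like function \<open>f\<close>
  whose Fourier transform lives where \<open>\<psi>\<close> does, divided by their shear norms. The shear norm is
  at least that of the single term \<open>(\<delta>, J, 0)\<close>, which is an exact dilate of the convolution of
  \<open>f\<close> with the reflected conjugate of \<open>\<psi>\<close>, a nonzero function; hence it is at least a multiple of
  \<open>2\<^bsup>J (d + 1) (\<alpha>\<^sub>2 - 1 / p\<^sub>2)\<^esup>\<close>. The isotropic pieces of \<open>f\<^sub>J\<close> vanish unless \<open>\<nu> = 2 J + O(1)\<close>,
  and those that remain are \<open>O((1 + 2\<^sup>J \<bar>x\<bar>)\<^sup>-\<^sup>N)\<close>, so that the isotropic norm is at most a multiple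
  of \<open>2\<^bsup>J (2 \<alpha>\<^sub>1 - d / p\<^sub>1)\<^esup>\<close>. The hypothesis on the exponents makes the quotient tend to \<open>0\<close>.\<close>

section \<open>Change of variables\<close>

lemma matrix_inv_mult:
  fixes A :: "real^'d^'d"
  assumes "invertible A"
  shows "A ** matrix_inv A = mat 1" "matrix_inv A ** A = mat 1"
  using someI_ex[of "\<lambda>A'. A ** A' = mat 1 \<and> A' ** A = mat 1"] assms
  by (auto simp: invertible_def matrix_inv_def)

lemma invertible_inverse_mult:
  fixes A :: "real^'d^'d"
  assumes "invertible A"
  shows "matrix_inv A *v (A *v x) = x" "(y v* matrix_inv A) v* A = y"
  using matrix_inv_mult[OF assms]
  by (simp_all add: matrix_vector_mul_assoc vector_matrix_mul_assoc)

lemma borel_measurable_matrix_vector [measurable]: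
  fixes A :: "real^'d^'d"
  shows "(\<lambda>x. A *v x) \<in> borel_measurable borel"
  by (intro borel_measurable_continuous_onI linear_continuous_on linear_conv_bounded_linear[THEN iffD1]) simp

text \<open>Only diagonal changes of variables occur under integrals: \<open>dil_shear\<close> is
  diagonal for \<open>l = 0\<close>, and for the other shears the control of one frequency component
  is enough.\<close>

definition diag_mat :: "('d::finite \<Rightarrow> real) \<Rightarrow> real^'d^'d" where
  "diag_mat c = (\<chi> i k. if i = k then c i else 0)"

lemma diag_mat_mult_vector [simp]: "(diag_mat c *v x) $ i = c i * x $ i"
  by (simp add: diag_mat_def matrix_vector_mult_def if_distrib[of "\<lambda>y. y * _"] cong: if_cong)

lemma transpose_diag_mat [simp]: "transpose (diag_mat c) = diag_mat c"
  by (simp add: diag_mat_def transpose_def vec_eq_iff)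

lemma vector_mult_diag_mat: "x v* diag_mat c = diag_mat c *v x"
  by (metis transpose_diag_mat transpose_matrix_vector)

lemma det_diag_mat: "det (diag_mat c) = (\<Prod>i\<in>UNIV. c i)"
  by (subst det_diagonal) (simp_all add: diag_mat_def)

lemma diag_mat_mult: "diag_mat c ** diag_mat e = diag_mat (\<lambda>i. c i * e i)"
  by (simp add: diag_mat_def matrix_matrix_mult_def vec_eq_iff if_distrib[of "\<lambda>y. y * _"] cong: if_cong)

lemma diag_mat_1: "diag_mat (\<lambda>_. 1) = mat 1"
  by (simp add: diag_mat_def mat_def vec_eq_iff)

lemma lborel_diag_image:
  fixes c :: "'d::finite \<Rightarrow> real"
  assumes "\<And>i. c i \<noteq> 0"
  shows "lborel = density (distr lborel borel (\<lambda>x. diag_mat c *v x)) (\<lambda>_. ennreal \<bar>det (diag_mat c)\<bar>)"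
proof -
  \<comment> \<open>\<open>lborel_affine_euclidean\<close> indexes scale factors by basis vectors;
    \<open>c'\<close> transports \<open>c\<close> along the injection of indices into unit
    vectors.\<close>
  define c' :: "real^'d \<Rightarrow> real" where "c' b = (THE r. \<exists>i. b = axis i 1 \<and> r = c i)" for b
  have c': "c' (axis i 1) = c i" for i
    unfolding c'_def by (rule the_equality) (auto simp: axis_eq_axis)
  have B: "(Basis :: (real^'d) set) = range (\<lambda>i. axis i 1)" by (auto simp: Basis_vec_def)
  have inj: "inj (\<lambda>i::'d. axis i (1::real))" by (auto simp: inj_def axis_eq_axis)
  have T: "0 + (\<Sum>b\<in>Basis. (c' b * (x \<bullet> b)) *\<^sub>R b) = diag_mat c *v x" for x :: "real^'d"
  proof -
    have "0 + (\<Sum>b\<in>Basis. (c' b * (x \<bullet> b)) *\<^sub>R b) = (\<Sum>i\<in>UNIV. (c i * x $ i) *\<^sub>R axis i 1)"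
      unfolding B by (subst sum.reindex[OF inj]) (simp add: c' inner_axis)
    then show ?thesis
      by (simp add: vec_eq_iff axis_def if_distrib[of "\<lambda>y. _ * y"] cong: if_cong)
  qed
  have P: "(\<Prod>b\<in>Basis. \<bar>c' b\<bar>) = \<bar>det (diag_mat c)\<bar>"
    by (simp add: B prod.reindex[OF inj] c' det_diag_mat abs_prod)
  have "lborel = density (distr lborel borel (\<lambda>x. 0 + (\<Sum>b\<in>Basis. (c' b * (x \<bullet> b)) *\<^sub>R b))) (\<lambda>_. \<Prod>b\<in>Basis. \<bar>c' b\<bar>)"
    by (rule lborel_affine_euclidean) (use assms c' in \<open>auto simp: B\<close>)
  then show ?thesis by (simp only: T P)
qed

lemma nn_integral_diag_substitution:
  assumes "\<And>i. c i \<noteq> 0" and [measurable]: "g \<in> borel_measurable borel"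
  shows "(\<integral>\<^sup>+x. g x \<partial>lborel) = ennreal \<bar>det (diag_mat c)\<bar> * (\<integral>\<^sup>+x. g (diag_mat c *v x) \<partial>lborel)"
  by (subst lborel_diag_image[OF assms(1)])
    (simp add: nn_integral_density nn_integral_distr nn_integral_cmult)

lemma integral_diag_substitution:
  fixes g :: "real^'d \<Rightarrow> complex"
  assumes "\<And>i. c i \<noteq> 0" and [measurable]: "g \<in> borel_measurable borel"
  shows "(LINT x|lborel. g x) = of_real \<bar>det (diag_mat c)\<bar> * (LINT x|lborel. g (diag_mat c *v x))"
proof -
  have "(LINT x|lborel. g x) = (LINT x|distr lborel borel (\<lambda>x. diag_mat c *v x). \<bar>det (diag_mat c)\<bar> *\<^sub>R g x)"
    by (subst lborel_diag_image[OF assms(1)], subst integral_density) simp_all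
  also have "\<dots> = (LINT x|lborel. \<bar>det (diag_mat c)\<bar> *\<^sub>R g (diag_mat c *v x))"
    by (subst integral_distr) simp_all
  finally show ?thesis by (simp add: scaleR_conv_of_real)
qed

lemma integrable_diag_substitution:
  fixes g :: "real^'d \<Rightarrow> complex"
  assumes "\<And>i. c i \<noteq> 0" and g: "integrable lborel g"
  shows "integrable lborel (\<lambda>x. g (diag_mat c *v x))"
proof -
  have [measurable]: "g \<in> borel_measurable borel" using g by simp
  have d: "ennreal \<bar>det (diag_mat c)\<bar> \<noteq> 0" using assms(1) by (simp add: det_diag_mat)
  have "(\<integral>\<^sup>+x. ennreal (norm (g x)) \<partial>lborel) < \<infinity>" using g by (simp add: integrable_iff_bounded)
  also have "(\<integral>\<^sup>+x. ennreal (norm (g x)) \<partial>lborel) = ennreal \<bar>det (diag_mat c)\<bar> * (\<integral>\<^sup>+x. ennreal (norm (g (diag_mat c *v x))) \<partial>lborel)"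
    by (rule nn_integral_diag_substitution[OF assms(1)]) simp
  finally show ?thesis
    using d by (auto simp: integrable_iff_bounded ennreal_mult_less_top)
qed

section \<open>Reflections, translations and scalings of Lebesgue measure\<close>

lemma lborel_reflect:
  fixes x :: "'a::euclidean_space"
  shows "distr lborel borel (\<lambda>y. x - y) = lborel"
proof -
  have "lborel = density (distr lborel borel (\<lambda>y. x + (- 1) *\<^sub>R y)) (\<lambda>_. \<bar>- 1 :: real\<bar> ^ DIM('a))"
    by (rule lborel_affine) simp
  then show ?thesis by (simp add: density_1)
qed

text \<open>True without measurability: a reflection is an involution, so both integrands are
  measurable or neither is, and in the second case both integrals are 0. This makes
  \<open>conv_commute\<close> unconditional.\<close>

lemma integral_reflect:
  fixes g :: "'a::euclidean_space \<Rightarrow> 'b::{banach, second_countable_topology}"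
  shows "(LINT y|lborel. g (x - y)) = (LINT y|lborel. g y)"
proof (cases "g \<in> borel_measurable borel")
  case True
  then have "(LINT y|distr lborel borel (\<lambda>y. x - y). g y) = (LINT y|lborel. g (x - y))"
    by (subst integral_distr) simp_all
  then show ?thesis by (simp add: lborel_reflect)
next
  case False
  have "\<not> (\<lambda>y. g (x - y)) \<in> borel_measurable borel"
  proof
    assume "(\<lambda>y. g (x - y)) \<in> borel_measurable borel"
    then have "(\<lambda>y. g (x - y)) \<circ> (\<lambda>y. x - y) \<in> borel_measurable borel"
      by (rule measurable_comp[rotated]) simp
    with False show False by (simp add: o_def)
  qed
  with False show ?thesis
    by (metis borel_measurable_integrable measurable_lborel2 not_integrable_integral_eq measurable_lborel1)
qed

lemma integrable_reflect:
  fixes g :: "'a::euclidean_space \<Rightarrow> 'b::{banach, second_countable_topology}"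
  assumes "integrable lborel g"
  shows "integrable lborel (\<lambda>y. g (x - y))"
proof -
  have "integrable (distr lborel borel (\<lambda>y. x - y)) g" using assms by (simp add: lborel_reflect)
  then show ?thesis by (subst (asm) integrable_distr_eq) (use assms in simp_all)
qed

text \<open>A translation is a composition of two reflections.\<close>

lemma integral_translate:
  fixes g :: "'a::euclidean_space \<Rightarrow> 'b::{banach, second_countable_topology}"
  shows "(LINT y|lborel. g (y + x)) = (LINT y|lborel. g y)"
  using integral_reflect[of "\<lambda>y. g (x - y)" 0] integral_reflect[of g x] by (simp add: add.commute)

lemma nn_integral_scale:
  fixes g :: "'a::euclidean_space \<Rightarrow> ennreal"
  assumes "c > 0" and [measurable]: "g \<in> borel_measurable borel"
  shows "(\<integral>\<^sup>+y. g (c *\<^sub>R y) \<partial>lborel) = ennreal (1 / c ^ DIM('a)) * (\<integral>\<^sup>+y. g y \<partial>lborel)"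
proof -
  have "(\<integral>\<^sup>+y. g y \<partial>lborel) = ennreal (c ^ DIM('a)) * (\<integral>\<^sup>+y. g (c *\<^sub>R y) \<partial>lborel)"
    by (subst lborel_affine[of c 0])
      (use assms(1) in \<open>simp_all add: nn_integral_density nn_integral_distr nn_integral_cmult\<close>)
  then have "ennreal (1 / c ^ DIM('a)) * (\<integral>\<^sup>+y. g y \<partial>lborel) =
      ennreal (1 / c ^ DIM('a)) * ennreal (c ^ DIM('a)) * (\<integral>\<^sup>+y. g (c *\<^sub>R y) \<partial>lborel)"
    by (simp add: mult.assoc)
  also have "ennreal (1 / c ^ DIM('a)) * ennreal (c ^ DIM('a)) = 1"
    using assms(1) by (simp add: ennreal_mult[symmetric] del: ennreal_1)
  finally show ?thesis by simp
qed

section \<open>Rapidly decreasing functions\<close>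

text \<open>No derivatives are asked for. Decay alone gives integrability and
  \<open>tempered_function\<close>, and it passes through convolutions and linear substitutions by
  size estimates, so that no Schwartz seminorm of a convolution is ever estimated.\<close>

definition rapid :: "('a::euclidean_space \<Rightarrow> complex) \<Rightarrow> bool" where
  "rapid g \<longleftrightarrow> g \<in> borel_measurable borel \<and> (\<forall>N. \<exists>C. \<forall>x. (1 + norm x) ^ N * cmod (g x) \<le> C)"

lemma rapid_measurable [measurable_dest]: "rapid g \<Longrightarrow> g \<in> borel_measurable borel"
  by (simp add: rapid_def)

lemma rapidE:
  assumes "rapid g"
  obtains C where "C > 0" "\<And>x. (1 + norm x) ^ N * cmod (g x) \<le> C"
proof -
  from assms obtain C where "\<And>x. (1 + norm x) ^ N * cmod (g x) \<le> C"
    unfolding rapid_def by blast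
  then show ?thesis by (intro that[of "max C 1"]) (auto simp: le_max_iff_disj)
qed

text \<open>A point whose norm has integer part n lies in the ball of radius n + 1, and there the
  integrand is at most 1/(n+1)^(DIM+2). The ball volume eats DIM powers, which leaves the convergent
  series of 1/(n+1)^2.\<close>

lemma nn_integral_decay_finite:
  "(\<integral>\<^sup>+x. ennreal (1 / (1 + norm (x::'a::euclidean_space)) ^ (DIM('a) + 2)) \<partial>lborel) < \<infinity>"
proof -
  let ?D = "DIM('a)"
  let ?c = "unit_ball_vol (real ?D)"
  let ?t = "\<lambda>n x. ennreal (1 / real (Suc n) ^ (?D + 2)) * indicator (cball 0 (real (Suc n))) (x::'a)"
  have "ennreal (1 / (1 + norm x) ^ (?D + 2)) \<le> (\<Sum>n. ?t n x)" for x :: 'a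
  proof -
    define n where "n = nat \<lfloor>norm x\<rfloor>"
    have n: "real n \<le> norm x" "norm x \<le> real (Suc n)"
      unfolding n_def by (simp_all add: of_nat_nat) linarith
    have "ennreal (1 / (1 + norm x) ^ (?D + 2)) \<le> ennreal (1 / real (Suc n) ^ (?D + 2))"
      using n by (intro ennreal_leI divide_left_mono power_mono mult_pos_pos zero_less_power) (auto intro: add_pos_nonneg)
    also have "\<dots> = ?t n x" using n by simp
    also have "\<dots> \<le> (\<Sum>n. ?t n x)"
      using sum_le_suminf[OF summableI finite.emptyI[THEN finite.insertI], where f = "\<lambda>n. ?t n x" and a1 = n]
      by (simp only: sum.insert finite.emptyI sum.empty add_0_right empty_iff simp_thms) simp
    finally show ?thesis .
  qed
  then have "(\<integral>\<^sup>+x. ennreal (1 / (1 + norm (x::'a)) ^ (?D + 2)) \<partial>lborel) \<le> (\<integral>\<^sup>+x. (\<Sum>n. ?t n x) \<partial>lborel)"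
    by (intro nn_integral_mono)
  also have "\<dots> = (\<Sum>n. \<integral>\<^sup>+x. ?t n x \<partial>lborel)"
    by (rule nn_integral_suminf) (intro borel_measurable_times_ennreal borel_measurable_const borel_measurable_indicator, simp)
  also have "\<dots> = (\<Sum>n. ennreal (?c * (1 / real (Suc n) ^ 2)))"
    by (intro suminf_cong)
      (simp add: nn_integral_cmult_indicator emeasure_cball ennreal_mult[symmetric] power_add power2_eq_square del: of_nat_Suc)
  also have "\<dots> < \<infinity>"
  proof -
    have "summable (\<lambda>n. ?c * (1 / real (Suc n) ^ 2))"
      using inverse_power_summable[of 2, where 'a = real]
      by (intro summable_mult) (subst summable_Suc_iff[of "\<lambda>n. 1 / real n ^ 2"], simp add: divide_inverse)
    then show ?thesis by (subst suminf_ennreal2) auto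
  qed
  finally show ?thesis .
qed

lemma rapid_integrable_weighted:
  fixes g :: "'a::euclidean_space \<Rightarrow> complex"
  assumes g: "rapid g"
  shows "integrable lborel (\<lambda>x. (1 + norm x) ^ N * cmod (g x))"
proof (rule integrableI_bounded)
  note [measurable] = rapid_measurable[OF g]
  show "(\<lambda>x. (1 + norm x) ^ N * cmod (g x)) \<in> borel_measurable lborel" by measurable
  \<comment> \<open>The surplus of DIM + 2 orders of decay pays for integrability.\<close>
  obtain C where C: "C > 0" "\<And>x. (1 + norm x) ^ (N + (DIM('a) + 2)) * cmod (g x) \<le> C"
    using rapidE[OF g] by metis
  have pw: "(1 + norm x) ^ N * cmod (g x) \<le> C * (1 / (1 + norm x) ^ (DIM('a) + 2))" for x
  proof -
    have "0 < (1 + norm x) ^ (DIM('a) + 2)" by (intro zero_less_power add_pos_nonneg) auto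
    then show ?thesis using C(2)[of x] by (simp add: power_add field_simps)
  qed
  have "(\<integral>\<^sup>+x. ennreal (norm ((1 + norm x) ^ N * cmod (g x))) \<partial>lborel) \<le>
      (\<integral>\<^sup>+x. ennreal C * ennreal (1 / (1 + norm (x::'a)) ^ (DIM('a) + 2)) \<partial>lborel)"
  proof (rule nn_integral_mono)
    fix x :: 'a
    show "ennreal (norm ((1 + norm x) ^ N * cmod (g x))) \<le> ennreal C * ennreal (1 / (1 + norm x) ^ (DIM('a) + 2))"
      using C(1) pw[of x]
      by (subst ennreal_mult[symmetric]) (auto simp: abs_mult intro!: ennreal_leI)
  qed
  also have "\<dots> = ennreal C * (\<integral>\<^sup>+x. ennreal (1 / (1 + norm (x::'a)) ^ (DIM('a) + 2)) \<partial>lborel)"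
    by (intro nn_integral_cmult) simp
  also have "\<dots> < \<infinity>"
    using nn_integral_decay_finite[where 'a='a] by (auto simp: ennreal_mult_less_top)
  finally show "(\<integral>\<^sup>+x. ennreal (norm ((1 + norm x) ^ N * cmod (g x))) \<partial>lborel) < \<infinity>" .
qed

lemma rapid_integrable:
  fixes g :: "'a::euclidean_space \<Rightarrow> complex"
  assumes "rapid g"
  shows "integrable lborel g"
  using rapid_integrable_weighted[OF assms, of 0] rapid_measurable[OF assms]
  by (simp add: integrable_norm_iff)

lemma iter_partial_continuous:
  assumes "smooth f" "bs \<in> lists Basis"
  shows "continuous_on UNIV (iter_partial bs f)"
  using assms by (auto simp: smooth_def continuous_on_eq_continuous_at intro: differentiable_imp_continuous_within)

lemma smooth_continuous: "smooth f \<Longrightarrow> continuous_on UNIV f"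
  using iter_partial_continuous[of f "[]"] by simp

lemma schwartz_rapid:
  assumes "g \<in> schwartz"
  shows "rapid g"
  unfolding rapid_def
proof (intro conjI allI)
  show "g \<in> borel_measurable borel"
    using assms by (intro borel_measurable_continuous_onI smooth_continuous) (simp add: schwartz_def)
  fix N
  have "bounded (range (weighted_partial N [] g))" using assms by (auto simp: schwartz_def)
  then obtain C where C: "\<And>x. norm (weighted_partial N [] g x) \<le> C" by (auto simp: bounded_iff)
  have "(1 + norm x) ^ N * cmod (g x) \<le> C" for x
    using C[of x] by (simp add: weighted_partial_def)
  then show "\<exists>C. \<forall>x. (1 + norm x) ^ N * cmod (g x) \<le> C" by blast
qed

text \<open>Peetre's inequality, at scale \<open>c\<close>: the triangle inequality plus a
  nonnegative cross term.\<close>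

lemma one_plus_norm_submult:
  fixes x y :: "'a::real_normed_vector"
  assumes "c \<ge> 0"
  shows "(1 + c * norm x) ^ N \<le> (1 + c * norm y) ^ N * (1 + c * norm (x - y)) ^ N"
proof -
  have "c * norm x \<le> c * norm y + c * norm (x - y)"
    using norm_triangle_sub[of x y] assms by (metis distrib_left mult_left_mono)
  moreover have "0 \<le> c * norm y * (c * norm (x - y))" using assms by simp
  ultimately have "1 + c * norm x \<le> (1 + c * norm y) * (1 + c * norm (x - y))"
    by (simp add: distrib_left distrib_right)
  then have "(1 + c * norm x) ^ N \<le> ((1 + c * norm y) * (1 + c * norm (x - y))) ^ N"
    using assms by (intro power_mono) auto
  then show ?thesis by (simp add: power_mult_distrib)
qed

section \<open>Convolutions and stability of rapid decay\<close>

lemma conv_dist_of: "conv_dist g (dist_of f) x = (LINT y|lborel. f y * g (x - y))"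
  by (simp add: conv_dist_def dist_of_def)

lemma conv_commute:
  "conv_dist g (dist_of f) x = (LINT y|lborel. g y * f (x - y))"
  using integral_reflect[of "\<lambda>y. f y * g (x - y)" x] by (simp add: conv_dist_of mult.commute)

text \<open>Peetre's inequality moves the weight under the integral, one factor to each function.
  The scale \<open>c\<close> will be 2^J, with \<open>A\<close> and \<open>B\<close> independent of
  J.\<close>

lemma conv_decay:
  fixes f g :: "'a::euclidean_space \<Rightarrow> complex"
  assumes c: "c \<ge> 0" and f: "\<And>y. (1 + c * norm y) ^ N * cmod (f y) \<le> A"
    and int: "integrable lborel (\<lambda>z. (1 + c * norm z) ^ N * cmod (g z))"
    and B: "(LINT z|lborel. (1 + c * norm z) ^ N * cmod (g z)) \<le> B"
  shows "(1 + c * norm x) ^ N * cmod (conv_dist g (dist_of f) x) \<le> A * B"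
proof (cases "integrable lborel (\<lambda>y. g y * f (x - y))")
  case True
  have "A \<ge> 0"
    using f[of 0] by (meson dual_order.trans mult_nonneg_nonneg norm_ge_zero zero_le_power add_nonneg_nonneg zero_le_one c)
  have "(1 + c * norm x) ^ N * cmod (conv_dist g (dist_of f) x) =
      cmod (LINT y|lborel. of_real ((1 + c * norm x) ^ N) * (g y * f (x - y)))"
    using c by (simp add: conv_commute norm_mult norm_power del: of_real_power of_real_add)
  also have "\<dots> \<le> (LINT y|lborel. A * ((1 + c * norm y) ^ N * cmod (g y)))"
  proof (rule order_trans[OF integral_norm_bound], rule integral_mono)
    show "integrable lborel (\<lambda>y. norm (of_real ((1 + c * norm x) ^ N) * (g y * f (x - y))))"
      using True by (intro integrable_norm integrable_mult_right)
    show "integrable lborel (\<lambda>y. A * ((1 + c * norm y) ^ N * cmod (g y)))" using int by simp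
    fix y
    have "norm (of_real ((1 + c * norm x) ^ N) * (g y * f (x - y))) = (1 + c * norm x) ^ N * (cmod (g y) * cmod (f (x - y)))"
      using c by (simp add: norm_mult norm_power del: of_real_power of_real_add)
    also have "\<dots> \<le> ((1 + c * norm y) ^ N * (1 + c * norm (x - y)) ^ N) * (cmod (g y) * cmod (f (x - y)))"
      by (intro mult_right_mono one_plus_norm_submult c) auto
    also have "\<dots> = ((1 + c * norm (x - y)) ^ N * cmod (f (x - y))) * ((1 + c * norm y) ^ N * cmod (g y))"
      by (simp add: mult_ac)
    also have "\<dots> \<le> A * ((1 + c * norm y) ^ N * cmod (g y))"
      using c by (intro mult_right_mono f) auto
    finally show "norm (of_real ((1 + c * norm x) ^ N) * (g y * f (x - y))) \<le> A * ((1 + c * norm y) ^ N * cmod (g y))" .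
  qed
  also have "\<dots> \<le> A * B" using B \<open>A \<ge> 0\<close> by (simp add: mult_left_mono)
  finally show ?thesis .
next
  \<comment> \<open>\<open>f\<close> carries no measurability assumption. If the integrand is not
    integrable, the convolution is 0 by convention and only the signs of \<open>A\<close> and
    \<open>B\<close> matter.\<close>
  case False
  have "A \<ge> 0"
    using f[of 0] by (meson dual_order.trans mult_nonneg_nonneg norm_ge_zero zero_le_power add_nonneg_nonneg zero_le_one c)
  moreover have "0 \<le> B"
    using c by (intro order_trans[OF _ B] integral_nonneg) auto
  ultimately show ?thesis using False by (simp add: conv_commute not_integrable_integral_eq)
qed

lemma conv_measurable [measurable]:
  fixes f g :: "'a::euclidean_space \<Rightarrow> complex"
  assumes [measurable]: "g \<in> borel_measurable borel" "f \<in> borel_measurable borel"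
  shows "conv_dist g (dist_of f) \<in> borel_measurable borel"
proof -
  have "(\<lambda>x. LINT y|lborel. f y * g (x - y)) \<in> borel_measurable borel" by measurable
  then show ?thesis by (simp add: conv_dist_of[abs_def])
qed

lemma rapid_conv:
  assumes f: "rapid f" and g: "rapid g"
  shows "rapid (conv_dist g (dist_of f))"
  unfolding rapid_def
proof (intro conjI allI)
  show "conv_dist g (dist_of f) \<in> borel_measurable borel"
    using f g by (intro conv_measurable rapid_measurable)
  fix N
  obtain A where "\<And>y. (1 + norm y) ^ N * cmod (f y) \<le> A" using rapidE[OF f] by metis
  then show "\<exists>C. \<forall>x. (1 + norm x) ^ N * cmod (conv_dist g (dist_of f) x) \<le> C"
    using conv_decay[of 1 N f A g] rapid_integrable_weighted[OF g, of N] by auto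
qed

text \<open>Decay in \<open>L x\<close> is decay in \<open>x\<close> once \<open>norm (L x)\<close>
  controls \<open>norm x\<close>. This serves reflections, scalar multiples and invertible matrices
  alike.\<close>

lemma rapid_linear_below:
  fixes g :: "'b::euclidean_space \<Rightarrow> complex" and L :: "'a::euclidean_space \<Rightarrow> 'b"
  assumes g: "rapid g" and c: "c > 0" "\<And>x. c * norm x \<le> norm (L x)"
    and L [measurable]: "L \<in> borel_measurable borel"
  shows "rapid (\<lambda>x. a * g (L x))"
  unfolding rapid_def
proof (intro conjI allI)
  note [measurable] = rapid_measurable[OF g]
  show "(\<lambda>x. a * g (L x)) \<in> borel_measurable borel" by measurable
  fix N
  obtain C where C: "C > 0" "\<And>y. (1 + norm y) ^ N * cmod (g y) \<le> C" using rapidE[OF g] by metis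
  have "(1 + norm x) ^ N * cmod (a * g (L x)) \<le> (max 1 (1 / c)) ^ N * cmod a * C" for x
  proof -
    have "1 + norm x \<le> max 1 (1 / c) * (1 + norm (L x))"
    proof -
      have "norm x \<le> 1 / c * norm (L x)" using c by (simp add: field_simps)
      also have "\<dots> \<le> max 1 (1 / c) * norm (L x)" by (intro mult_right_mono) auto
      finally show ?thesis by (simp add: distrib_left)
    qed
    then have "(1 + norm x) ^ N \<le> (max 1 (1 / c)) ^ N * (1 + norm (L x)) ^ N"
      by (metis add_nonneg_nonneg norm_ge_zero power_mono power_mult_distrib zero_le_one)
    then have "(1 + norm x) ^ N * cmod (a * g (L x)) \<le> (max 1 (1 / c)) ^ N * (1 + norm (L x)) ^ N * (cmod a * cmod (g (L x)))"
      by (simp add: norm_mult mult_right_mono)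
    also have "\<dots> = (max 1 (1 / c)) ^ N * cmod a * ((1 + norm (L x)) ^ N * cmod (g (L x)))"
      by (simp add: mult_ac)
    also have "\<dots> \<le> (max 1 (1 / c)) ^ N * cmod a * C"
      using C by (intro mult_left_mono) auto
    finally show ?thesis .
  qed
  then show "\<exists>C. \<forall>x. (1 + norm x) ^ N * cmod (a * g (L x)) \<le> C" by blast
qed

lemma invertible_norm_below:
  fixes A :: "real^'d^'d"
  assumes "invertible A"
  obtains c where "c > 0" "\<And>x. c * norm x \<le> norm (A *v x)"
proof -
  have "bounded_linear (\<lambda>x. matrix_inv A *v x)"
    by (simp add: linear_conv_bounded_linear[symmetric])
  then obtain K where K: "K > 0" "\<And>x. norm (matrix_inv A *v x) \<le> norm x * K"
    using bounded_linear.pos_bounded by blast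
  show ?thesis
  proof (rule that[of "1 / K"])
    fix x show "1 / K * norm x \<le> norm (A *v x)"
      using K(2)[of "A *v x"] K(1) invertible_inverse_mult(1)[OF assms, of x] by (simp add: field_simps)
  qed (use K in simp)
qed

lemma invertible_matrix_inv: "invertible (A :: real^'d^'d) \<Longrightarrow> invertible (matrix_inv A)"
  using matrix_inv_mult[of A] by (auto simp: invertible_def)

lemma rapid_matrix:
  fixes A :: "real^'d^'d"
  assumes "rapid g" "invertible A"
  shows "rapid (\<lambda>x. a * g (A *v x))"
proof -
  obtain c where "c > 0" "\<And>x. c * norm x \<le> norm (A *v x)"
    using invertible_norm_below[OF assms(2)] by metis
  then show ?thesis by (rule rapid_linear_below[OF assms(1)]) simp
qed

lemma rapid_mat_dilate:
  assumes "rapid g" "invertible M"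
  shows "rapid (mat_dilate M g)"
  unfolding mat_dilate_def[abs_def] using assms by (intro rapid_matrix invertible_matrix_inv)

lemma rapid_tilde:
  assumes "rapid g"
  shows "rapid (tilde g)"
proof -
  have "rapid (\<lambda>x. 1 * g (- x))" by (rule rapid_linear_below[OF assms, of 1]) simp_all
  then have g: "(\<lambda>x. g (- x)) \<in> borel_measurable borel" "\<forall>N. \<exists>C. \<forall>x. (1 + norm x) ^ N * cmod (g (- x)) \<le> C"
    by (simp_all add: rapid_def)
  from g(1) have "(\<lambda>x. cnj (g (- x))) \<in> borel_measurable borel"
    by (rule borel_measurable_continuous_on[rotated]) (intro continuous_intros)
  then show ?thesis using g(2) by (simp add: rapid_def tilde_def[abs_def])
qed

lemma rapid_cmult: "rapid g \<Longrightarrow> rapid (\<lambda>x. a * g x)"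
  by (rule rapid_linear_below[of g 1 "\<lambda>x. x" a]) simp_all

text \<open>Of Schwartz convergence only uniform convergence is used: from some \<open>n0\<close>
  on, the test functions are bounded by \<open>C + 1\<close>, so \<open>(C + 1) * cmod (f x)\<close>
  dominates the products.\<close>

lemma rapid_tempered_function:
  fixes f :: "'a::euclidean_space \<Rightarrow> complex"
  assumes f: "rapid f"
  shows "tempered_function f"
proof -
  have int: "integrable lborel (\<lambda>x. f x * g x)" if g: "g \<in> schwartz" for g :: "'a \<Rightarrow> complex"
  proof -
    obtain C where "\<And>x. (1 + norm x) ^ 0 * cmod (g x) \<le> C" using rapidE[OF schwartz_rapid[OF g]] by metis
    then show ?thesis
      using rapid_measurable[OF f] rapid_measurable[OF schwartz_rapid[OF g]]
      by (intro Bochner_Integration.integrable_bound[OF integrable_mult_right[OF integrable_norm[OF rapid_integrable[OF f]], of C]])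
        (auto intro!: AE_I2 order_trans[OF mult_right_mono abs_ge_self] simp: norm_mult mult.commute[of "cmod (f _)"])
  qed
  show ?thesis
    unfolding tempered_function_def tempered_distribution_def
  proof (intro conjI ballI allI impI)
    fix g h :: "'a \<Rightarrow> complex" assume "g \<in> schwartz" "h \<in> schwartz"
    then show "dist_of f (\<lambda>x. g x + h x) = dist_of f g + dist_of f h"
      using int by (simp add: dist_of_def distrib_left)
  next
    fix g :: "'a \<Rightarrow> complex" and c assume "g \<in> schwartz"
    show "dist_of f (\<lambda>x. c * g x) = c * dist_of f g"
      by (simp add: dist_of_def mult.left_commute[of _ c])
  next
    fix u and g :: "'a \<Rightarrow> complex" assume u: "\<forall>n. u n \<in> schwartz" and g: "g \<in> schwartz" and lim: "schwartz_tendsto u g"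
    have "uniform_limit UNIV (\<lambda>n. weighted_partial 0 [] (u n)) (weighted_partial 0 [] g) sequentially"
      using lim by (auto simp: schwartz_tendsto_def)
    then have unif: "uniform_limit UNIV u g sequentially" by (simp add: weighted_partial_def[abs_def])
    obtain C where C: "C > 0" "\<And>x. (1 + norm x) ^ 0 * cmod (g x) \<le> C"
      using rapidE[OF schwartz_rapid[OF g]] by metis
    have "\<forall>\<^sub>F n in sequentially. \<forall>x. dist (u n x) (g x) < 1"
      using unif by (auto simp: uniform_limit_iff)
    then obtain n0 where n0: "\<And>n x. n \<ge> n0 \<Longrightarrow> dist (u n x) (g x) < 1"
      by (auto simp: eventually_sequentially)
    have bnd: "cmod (u n x) \<le> C + 1" if "n \<ge> n0" for n x
      using n0[OF that, of x] C(2)[of x] norm_triangle_sub[of "u n x" "g x"] by (simp add: dist_norm)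
    have "(\<lambda>n. dist_of f (u (n + n0))) \<longlonglongrightarrow> dist_of f g"
      unfolding dist_of_def
    proof (rule integral_dominated_convergence[where w = "\<lambda>x. (C + 1) * cmod (f x)"])
      show "(\<lambda>x. f x * g x) \<in> borel_measurable lborel"
        using int[OF g] by simp
      show "(\<lambda>x. f x * u (n + n0) x) \<in> borel_measurable lborel" for n
        using int u by simp
      show "integrable lborel (\<lambda>x. (C + 1) * cmod (f x))"
        using rapid_integrable[OF f] by simp
      show "AE x in lborel. (\<lambda>n. f x * u (n + n0) x) \<longlonglongrightarrow> f x * g x"
      proof (rule AE_I2, rule tendsto_mult_left)
        fix x
        have "(\<lambda>n. u n x) \<longlonglongrightarrow> g x" by (rule tendsto_uniform_limitI[OF unif]) simp
        then show "(\<lambda>n. u (n + n0) x) \<longlonglongrightarrow> g x" by (rule LIMSEQ_ignore_initial_segment)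
      qed
      show "AE x in lborel. norm (f x * u (n + n0) x) \<le> (C + 1) * cmod (f x)" for n
        using bnd[of "n + n0"] by (intro AE_I2) (simp add: norm_mult mult.commute[of "cmod (f _)"] mult_right_mono)
    qed
    then show "(\<lambda>n. dist_of f (u n)) \<longlonglongrightarrow> dist_of f g" by (rule LIMSEQ_offset)
  qed (fact int)
qed

section \<open>Fourier transforms\<close>

lemma cis_continuous [continuous_intros]:
  "continuous_on S f \<Longrightarrow> continuous_on S (\<lambda>x. cis (f x))"
  using continuous_on_compose2[of UNIV cis S f] by (auto simp: cis_conv_exp intro!: continuous_intros)

lemma cis_measurable [measurable (raw)]:
  "f \<in> borel_measurable M \<Longrightarrow> (\<lambda>x. cis (f x)) \<in> borel_measurable M"
  by (rule borel_measurable_continuous_on[of cis]) (auto intro!: continuous_intros)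

text \<open>The hypothesis of Fubini's theorem in \<open>conv_inv_fourier_matrix\<close>, where
  \<open>w\<close> is a character of modulus 1.\<close>

lemma integrable_product_kernel:
  fixes k :: "'a::euclidean_space \<Rightarrow> complex" and u :: "'b::euclidean_space \<Rightarrow> complex"
  assumes k: "integrable lborel k" and u: "integrable lborel u"
    and [measurable]: "(\<lambda>p. w (fst p) (snd p)) \<in> borel_measurable (lborel \<Otimes>\<^sub>M lborel)"
    and w: "\<And>\<xi> y. cmod (w \<xi> y) \<le> 1"
  shows "integrable (lborel \<Otimes>\<^sub>M lborel) (\<lambda>(\<xi>, y). k \<xi> * u y * w \<xi> y)"
proof -
  have [measurable]: "k \<in> borel_measurable borel" "u \<in> borel_measurable borel" using k u by simp_all
  have "integrable (lborel \<Otimes>\<^sub>M lborel) (\<lambda>p. k (fst p) * u (snd p))"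
  proof (rule lborel_pair.Fubini_integrable)
    show "(\<lambda>p. k (fst p) * u (snd p)) \<in> borel_measurable (lborel \<Otimes>\<^sub>M lborel)" by measurable
    show "integrable lborel (\<lambda>\<xi>. LINT y|lborel. norm (k (fst (\<xi>, y)) * u (snd (\<xi>, y))))"
      using k by (simp add: norm_mult)
    show "AE \<xi> in lborel. integrable lborel (\<lambda>y. k (fst (\<xi>, y)) * u (snd (\<xi>, y)))"
      using u by simp
  qed
  then have "integrable (lborel \<Otimes>\<^sub>M lborel) (\<lambda>p. k (fst p) * u (snd p) * w (fst p) (snd p))"
  proof (rule Bochner_Integration.integrable_bound)
    show "AE p in lborel \<Otimes>\<^sub>M lborel. norm (k (fst p) * u (snd p) * w (fst p) (snd p)) \<le> norm (k (fst p) * u (snd p))"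
      by (rule AE_I2) (use w in \<open>auto simp: norm_mult intro: mult_left_le\<close>)
  qed measurable
  moreover have "(\<lambda>p. k (fst p) * u (snd p) * w (fst p) (snd p)) = (\<lambda>(\<xi>, y). k \<xi> * u y * w \<xi> y)"
    by auto
  ultimately show ?thesis by simp
qed

lemma cmod_inv_fourier_le:
  assumes "integrable lborel k"
  shows "cmod (inv_fourier k x) \<le> (LINT \<xi>|lborel. cmod (k \<xi>))"
  unfolding inv_fourier_def using integral_norm_bound[of lborel "\<lambda>\<xi>. k \<xi> * cis (2 * pi * (\<xi> \<bullet> x))"]
  by (simp add: norm_mult)

lemma fourier_eq_inv_fourier: "fourier u \<xi> = inv_fourier u (- \<xi>)"
  by (simp add: fourier_def inv_fourier_def inner_commute)

lemma continuous_inv_fourier: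
  fixes k :: "real^'d \<Rightarrow> complex"
  assumes k: "integrable lborel k"
  shows "continuous_on UNIV (inv_fourier k)"
  unfolding continuous_on_sequentially
proof (intro allI ballI impI)
  have [measurable]: "k \<in> borel_measurable borel" using k by simp
  fix X :: "nat \<Rightarrow> real^'d" and a assume "(\<forall>n. X n \<in> UNIV) \<and> X \<longlonglongrightarrow> a"
  then have X: "X \<longlonglongrightarrow> a" by simp
  have "(\<lambda>n. inv_fourier k (X n)) \<longlonglongrightarrow> inv_fourier k a"
    unfolding inv_fourier_def
  proof (rule integral_dominated_convergence[where w = "\<lambda>\<xi>. cmod (k \<xi>)"])
    show "AE \<xi> in lborel. (\<lambda>n. k \<xi> * cis (2 * pi * (\<xi> \<bullet> X n))) \<longlonglongrightarrow> k \<xi> * cis (2 * pi * (\<xi> \<bullet> a))"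
    proof (rule AE_I2)
      fix \<xi> :: "real^'d"
      have "continuous_on UNIV (\<lambda>x. k \<xi> * cis (2 * pi * (\<xi> \<bullet> x)))" by (intro continuous_intros)
      then show "(\<lambda>n. k \<xi> * cis (2 * pi * (\<xi> \<bullet> X n))) \<longlonglongrightarrow> k \<xi> * cis (2 * pi * (\<xi> \<bullet> a))"
        using X by (auto simp: continuous_on_sequentially o_def)
    qed
  qed (use k in \<open>simp_all add: norm_mult\<close>)
  then show "(inv_fourier k \<circ> X) \<longlonglongrightarrow> inv_fourier k a" by (simp add: o_def)
qed

lemma continuous_fourier:
  assumes "integrable lborel u"
  shows "continuous_on UNIV (fourier u)"
  unfolding fourier_eq_inv_fourier[abs_def]
  by (rule continuous_on_compose2[OF continuous_inv_fourier[OF assms]]) (auto intro!: continuous_intros)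

text \<open>Fubini's theorem, with \<open>A\<close> moved to the row vector \<xi> in the inner
  product. Keeping \<open>A\<close> inside the kernel spares a change of variables by a sheared
  matrix.\<close>

lemma conv_inv_fourier_matrix:
  fixes A :: "real^'d^'d"
  assumes k: "integrable lborel k" and u: "integrable lborel u"
  shows "conv_dist (\<lambda>x. inv_fourier k (A *v x)) (dist_of u) x =
    (LINT \<xi>|lborel. k \<xi> * fourier u (\<xi> v* A) * cis (2 * pi * (\<xi> \<bullet> (A *v x))))"
proof -
  let ?w = "\<lambda>\<xi> y. cis (2 * pi * (\<xi> \<bullet> (A *v (x - y))))"
  have "conv_dist (\<lambda>x. inv_fourier k (A *v x)) (dist_of u) x = (LINT y|lborel. LINT \<xi>|lborel. k \<xi> * u y * ?w \<xi> y)"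
    by (simp add: conv_dist_of inv_fourier_def integral_mult_right_zero[symmetric] mult_ac del: integral_mult_right_zero integral_mult_right)
  also have "\<dots> = (LINT \<xi>|lborel. LINT y|lborel. k \<xi> * u y * ?w \<xi> y)"
    by (rule lborel_pair.Fubini_integral, rule integrable_product_kernel[OF k u]) simp_all
  also have "\<dots> = (LINT \<xi>|lborel. k \<xi> * fourier u (\<xi> v* A) * cis (2 * pi * (\<xi> \<bullet> (A *v x))))"
  proof (rule Bochner_Integration.integral_cong)
    fix \<xi>
    have "k \<xi> * u y * ?w \<xi> y = (k \<xi> * cis (2 * pi * (\<xi> \<bullet> (A *v x)))) * (u y * cis (- (2 * pi * ((\<xi> v* A) \<bullet> y))))" for y
      by (simp add: dot_lmul_matrix matrix_vector_mult_diff_distrib inner_diff_right right_diff_distrib cis_mult)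
    then have "(LINT y|lborel. k \<xi> * u y * ?w \<xi> y) =
        (k \<xi> * cis (2 * pi * (\<xi> \<bullet> (A *v x)))) * fourier u (\<xi> v* A)"
      by (simp only: fourier_def integral_mult_right_zero)
    then show "(LINT y|lborel. k \<xi> * u y * ?w \<xi> y) = k \<xi> * fourier u (\<xi> v* A) * cis (2 * pi * (\<xi> \<bullet> (A *v x)))"
      by (simp add: mult_ac)
  qed simp
  finally show ?thesis .
qed

lemma conv_inv_fourier:
  assumes "integrable lborel k" "integrable lborel u"
  shows "conv_dist (inv_fourier k) (dist_of u) = inv_fourier (\<lambda>\<xi>. k \<xi> * fourier u \<xi>)"
proof
  fix x
  have "inv_fourier k = (\<lambda>x. inv_fourier k (mat 1 *v x))" by simp
  then show "conv_dist (inv_fourier k) (dist_of u) x = inv_fourier (\<lambda>\<xi>. k \<xi> * fourier u \<xi>) x"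
    using conv_inv_fourier_matrix[OF assms, of "mat 1" x] by (simp add: inv_fourier_def)
qed

text \<open>Used to bound the Fourier support of \<open>base\<close> by that of
  \<open>\<Phi>\<close>.\<close>

lemma fourier_conv:
  fixes u v :: "real^'d \<Rightarrow> complex"
  assumes u: "integrable lborel u" and v: "integrable lborel v"
  shows "fourier (conv_dist u (dist_of v)) \<xi> = fourier u \<xi> * fourier v \<xi>"
proof -
  let ?e = "\<lambda>x. cis (- (2 * pi * (\<xi> \<bullet> x)))"
  have [measurable]: "v \<in> borel_measurable borel" "u \<in> borel_measurable borel" using u v by simp_all
  have tr: "integrable lborel (\<lambda>x. u (x - y))" for y
    using integrable_reflect[OF integrable_reflect[OF u, of 0], of y] by simp
  have trn: "(LINT x|lborel. cmod (u (x - y))) = (LINT x|lborel. cmod (u x))" for y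
    using integral_translate[of "\<lambda>x. cmod (u x)" "- y"] by simp
  have int: "integrable (lborel \<Otimes>\<^sub>M lborel) (\<lambda>(y, x). v y * u (x - y) * ?e x)"
  proof (rule lborel_pair.Fubini_integrable)
    show "(\<lambda>(y, x). v y * u (x - y) * ?e x) \<in> borel_measurable (lborel \<Otimes>\<^sub>M lborel)" by measurable
    show "integrable lborel (\<lambda>y. LINT x|lborel. norm (case (y, x) of (y, x) \<Rightarrow> v y * u (x - y) * ?e x))"
      using v by (simp add: norm_mult trn)
    have "integrable lborel (\<lambda>x. v y * u (x - y) * ?e x)" for y
      by (rule Bochner_Integration.integrable_bound[OF integrable_mult_right[OF tr, of "v y" y]]) (auto simp: norm_mult)
    then show "AE y in lborel. integrable lborel (\<lambda>x. case (y, x) of (y, x) \<Rightarrow> v y * u (x - y) * ?e x)" by simp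
  qed
  have "fourier (conv_dist u (dist_of v)) \<xi> = (LINT x|lborel. LINT y|lborel. v y * u (x - y) * ?e x)"
    by (simp add: fourier_def conv_dist_of)
  also have "\<dots> = (LINT y|lborel. LINT x|lborel. v y * u (x - y) * ?e x)"
    by (rule lborel_pair.Fubini_integral[OF int])
  also have "\<dots> = (LINT y|lborel. v y * ?e y * fourier u \<xi>)"
  proof (rule Bochner_Integration.integral_cong)
    fix y
    have "(LINT x|lborel. v y * u (x - y) * ?e x) = (LINT x|lborel. v y * u (x + y - y) * ?e (x + y))"
      using integral_translate[of "\<lambda>x. v y * u (x - y) * ?e x" y] by simp
    also have "\<dots> = (LINT x|lborel. v y * ?e y * (u x * ?e x))"
      by (intro Bochner_Integration.integral_cong) (simp_all add: inner_add_right distrib_left cis_mult add.commute)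
    finally show "(LINT x|lborel. v y * u (x - y) * ?e x) = v y * ?e y * fourier u \<xi>" by (simp add: fourier_def)
  qed simp
  finally show ?thesis by (simp add: fourier_def)
qed

lemma tilde_inv_fourier: "tilde (inv_fourier k) = inv_fourier (\<lambda>\<xi>. cnj (k \<xi>))"
proof
  fix x
  have "tilde (inv_fourier k) x = (LINT \<xi>|lborel. cnj (k \<xi> * cis (2 * pi * (\<xi> \<bullet> (- x)))))"
    unfolding tilde_def inv_fourier_def by (rule Bochner_Integration.integral_cnj[symmetric])
  then show "tilde (inv_fourier k) x = inv_fourier (\<lambda>\<xi>. cnj (k \<xi>)) x"
    by (simp add: inv_fourier_def cis_cnj)
qed

lemma inv_fourier_diag:
  fixes c :: "'d::finite \<Rightarrow> real"
  assumes c: "\<And>i. c i \<noteq> 0" and [measurable]: "k \<in> borel_measurable borel"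
  shows "inv_fourier k (diag_mat c *v x) =
    inv_fourier (\<lambda>\<xi>. of_real \<bar>det (diag_mat (\<lambda>i. 1 / c i))\<bar> * k (diag_mat (\<lambda>i. 1 / c i) *v \<xi>)) x"
proof -
  have inv: "(diag_mat (\<lambda>i. 1 / c i) *v \<xi>) \<bullet> (diag_mat c *v x) = \<xi> \<bullet> x" for \<xi>
    using c by (simp add: inner_vec_def)
  have "inv_fourier k (diag_mat c *v x) = of_real \<bar>det (diag_mat (\<lambda>i. 1 / c i))\<bar> *
     (LINT \<xi>|lborel. k (diag_mat (\<lambda>i. 1 / c i) *v \<xi>) * cis (2 * pi * ((diag_mat (\<lambda>i. 1 / c i) *v \<xi>) \<bullet> (diag_mat c *v x))))"
    unfolding inv_fourier_def by (rule integral_diag_substitution) (use c in auto)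
  then show ?thesis by (simp add: inv inv_fourier_def mult.assoc)
qed

lemma fourier_diag:
  fixes c :: "'d::finite \<Rightarrow> real"
  assumes c: "\<And>i. c i \<noteq> 0" and u: "u \<in> borel_measurable borel"
  shows "fourier (\<lambda>x. u (diag_mat c *v x)) \<xi> =
    of_real \<bar>det (diag_mat (\<lambda>i. 1 / c i))\<bar> * fourier u (diag_mat (\<lambda>i. 1 / c i) *v \<xi>)"
proof -
  have [measurable]: "u \<in> borel_measurable borel" by fact
  have inv: "diag_mat c *v (diag_mat (\<lambda>i. 1 / c i) *v x) = x" for x :: "real^'d"
    using c by (simp add: vec_eq_iff)
  have sym: "\<xi> \<bullet> (diag_mat e *v x) = (diag_mat e *v \<xi>) \<bullet> x" for e x
    by (simp add: inner_vec_def mult_ac)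
  have "fourier (\<lambda>x. u (diag_mat c *v x)) \<xi> = of_real \<bar>det (diag_mat (\<lambda>i. 1 / c i))\<bar> *
     (LINT x|lborel. u (diag_mat c *v (diag_mat (\<lambda>i. 1 / c i) *v x)) * cis (- (2 * pi * (\<xi> \<bullet> (diag_mat (\<lambda>i. 1 / c i) *v x)))))"
    unfolding fourier_def by (rule integral_diag_substitution) (use c in auto)
  then show ?thesis by (simp add: inv sym fourier_def)
qed

lemma integrable_continuous_bounded_support:
  fixes k :: "'a::euclidean_space \<Rightarrow> complex"
  assumes k: "continuous_on UNIV k" and R: "\<And>x. R < norm x \<Longrightarrow> k x = 0"
  shows "integrable lborel k"
proof -
  have "integrable lborel (\<lambda>x. indicator (cball 0 R) x *\<^sub>R k x)"
    using k by (intro borel_integrable_compact) (auto intro: continuous_on_subset)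
  moreover have "(\<lambda>x. indicator (cball 0 R) x *\<^sub>R k x) = k"
    using R by (auto simp: fun_eq_iff indicator_def)
  ultimately show ?thesis by simp
qed

text \<open>A nonempty open set is not negligible.\<close>

lemma continuous_AE_eq_0:
  fixes k :: "'a::euclidean_space \<Rightarrow> complex"
  assumes k: "continuous_on UNIV k" and ae: "AE x in lborel. k x = 0"
  shows "k x = 0"
proof (rule ccontr)
  assume nz: "k x \<noteq> 0"
  have op: "open (k -` (- {0}))" using k by (intro open_vimage) auto
  have "{x. k x \<noteq> 0} \<in> sets lborel" using borel_open[OF op] by (simp add: vimage_def Compl_eq)
  then have "{x. k x \<noteq> 0} \<in> null_sets lborel"
    by (rule AE_iff_null_sets[THEN iffD2]) (use ae in simp)
  then have "{x. k x \<noteq> 0} \<in> null_sets lebesgue" by (rule null_sets_completionI)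
  then have "negligible (k -` (- {0}))" by (simp add: negligible_iff_null_sets vimage_def Compl_eq)
  with op nz show False using open_not_negligible by blast
qed

section \<open>Trigonometric polynomials and injectivity of the inverse Fourier transform\<close>

inductive_set trig_poly :: "(real^'d \<Rightarrow> complex) set" where
  char: "(\<lambda>\<xi>. cis (2 * pi * (\<xi> \<bullet> x))) \<in> trig_poly"
| add: "f \<in> trig_poly \<Longrightarrow> g \<in> trig_poly \<Longrightarrow> (\<lambda>\<xi>. f \<xi> + g \<xi>) \<in> trig_poly"
| cmult: "f \<in> trig_poly \<Longrightarrow> (\<lambda>\<xi>. a * f \<xi>) \<in> trig_poly"

text \<open>Products of characters are characters. The rules give only linear closure; this supplies
  the algebra that Stone-Weierstrass needs.\<close>

lemma trig_poly_mult:
  assumes f: "f \<in> trig_poly" and g: "g \<in> trig_poly"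
  shows "(\<lambda>\<xi>. f \<xi> * g \<xi>) \<in> trig_poly"
  using f
proof induction
  case (char x)
  from g show ?case
  proof induction
    case (char y)
    have "(\<lambda>\<xi>. cis (2 * pi * (\<xi> \<bullet> (x + y)))) \<in> trig_poly" by (rule trig_poly.char)
    then show ?case by (simp add: cis_mult inner_add_right distrib_left)
  next
    case (add f g)
    then show ?case using trig_poly.add[OF add.IH] by (simp add: distrib_left)
  next
    case (cmult f a)
    then show ?case using trig_poly.cmult[OF cmult.IH, of a] by (simp add: mult.left_commute)
  qed
next
  case (add f h)
  then show ?case using trig_poly.add[OF add.IH] by (simp add: distrib_right)
next
  case (cmult f a)
  then show ?case using trig_poly.cmult[OF cmult.IH, of a] by (simp add: mult.assoc)
qed

lemma trig_poly_const: "(\<lambda>_. c) \<in> trig_poly"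
  using trig_poly.cmult[OF trig_poly.char[of 0], of c] by simp

lemma trig_poly_continuous: "f \<in> trig_poly \<Longrightarrow> continuous_on S f"
  by (induction rule: trig_poly.induct) (auto intro!: continuous_intros)

text \<open>The integral of \<open>k\<close> against a character is a value of
  \<open>inv_fourier k\<close>.\<close>

lemma trig_poly_orthogonal:
  assumes f: "f \<in> trig_poly" and k: "integrable lborel k" and 0: "\<And>x. inv_fourier k x = 0"
  shows "integrable lborel (\<lambda>\<xi>. k \<xi> * f \<xi>) \<and> (LINT \<xi>|lborel. k \<xi> * f \<xi>) = 0"
  using f
proof induction
  case (char x)
  have [measurable]: "k \<in> borel_measurable borel" using k by simp
  have "integrable lborel (\<lambda>\<xi>. k \<xi> * cis (2 * pi * (\<xi> \<bullet> x)))"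
    by (rule Bochner_Integration.integrable_bound[OF k]) (auto simp: norm_mult)
  then show ?case using 0[of x] by (simp add: inv_fourier_def)
next
  case (add f g)
  then show ?case by (simp add: distrib_left)
next
  case (cmult f a)
  then show ?case by (simp add: mult.left_commute[of _ a])
qed

text \<open>A sine wave in the direction \<open>x - y\<close>, slow enough that both points fall
  into the interval [-pi/2, pi/2] where sine is injective.\<close>

lemma trig_poly_separates:
  fixes x y :: "real^'d"
  assumes "x \<noteq> y"
  shows "\<exists>g. (\<lambda>\<xi>. complex_of_real (g \<xi>)) \<in> trig_poly \<and> g x \<noteq> g y"
proof -
  \<comment> \<open>\<open>m\<close> bounds both inner products with \<open>x - y\<close>, and the 1
    keeps it positive. The factor 1/(4 m) in \<open>v\<close> turns 2 pi into at most pi/2.\<close>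
  define m where "m = \<bar>x \<bullet> (x - y)\<bar> + \<bar>y \<bullet> (x - y)\<bar> + 1"
  define v where "v = (1 / (4 * m)) *\<^sub>R (x - y)"
  have m: "m > 0" unfolding m_def by (simp add: add_nonneg_pos)
  define g where "g \<xi> = sin (2 * pi * (\<xi> \<bullet> v))" for \<xi> :: "real^'d"
  have "(\<lambda>\<xi>. (1 / (2 * \<i>)) * cis (2 * pi * (\<xi> \<bullet> v)) + (- 1 / (2 * \<i>)) * cis (2 * pi * (\<xi> \<bullet> (- v)))) \<in> trig_poly"
    by (intro trig_poly.add trig_poly.cmult trig_poly.char)
  moreover have "(\<lambda>\<xi>. (1 / (2 * \<i>)) * cis (2 * pi * (\<xi> \<bullet> v)) + (- 1 / (2 * \<i>)) * cis (2 * pi * (\<xi> \<bullet> (- v)))) =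
      (\<lambda>\<xi>. complex_of_real (g \<xi>))"
    by (rule ext) (simp add: g_def complex_eq_iff)
  ultimately have 1: "(\<lambda>\<xi>. complex_of_real (g \<xi>)) \<in> trig_poly" by simp
  have bnd: "\<bar>2 * pi * (z \<bullet> v)\<bar> \<le> pi / 2" if "\<bar>z \<bullet> (x - y)\<bar> \<le> m" for z
  proof -
    have "\<bar>2 * pi * (z \<bullet> v)\<bar> = pi / 2 * (\<bar>z \<bullet> (x - y)\<bar> / m)"
    proof -
      have "z \<bullet> v = (z \<bullet> (x - y)) / (4 * m)" by (simp only: v_def inner_scaleR_right) simp
      then show ?thesis using m by (simp only: abs_mult abs_divide) simp
    qed
    also have "\<dots> \<le> pi / 2 * 1"
      using that m by (intro mult_left_mono) auto
    finally show ?thesis by simp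
  qed
  have "g x \<noteq> g y"
  proof
    assume "g x = g y"
    moreover have "\<bar>2 * pi * (x \<bullet> v)\<bar> \<le> pi / 2" "\<bar>2 * pi * (y \<bullet> v)\<bar> \<le> pi / 2"
      by (rule bnd, simp add: m_def)+
    ultimately have "2 * pi * (x \<bullet> v) = 2 * pi * (y \<bullet> v)"
      unfolding g_def abs_le_iff by (metis sin_inj_pi minus_le_iff)
    then have "(x - y) \<bullet> v = 0" by (simp add: inner_diff_left)
    then have "(x - y) \<bullet> (x - y) = 0" using m by (simp add: v_def)
    with assms show False by simp
  qed
  with 1 show ?thesis by blast
qed

text \<open>\<open>k\<close> annihilates every trigonometric polynomial, hence by Stone-Weierstrass
  on the ball every continuous function. Testing against the conjugate of \<open>k\<close> gives a
  vanishing L^2 norm, and continuity does the rest.\<close>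

lemma inv_fourier_injective:
  fixes k :: "real^'d \<Rightarrow> complex"
  assumes k: "continuous_on UNIV k" and R: "\<And>\<xi>. R < norm \<xi> \<Longrightarrow> k \<xi> = 0"
    and 0: "\<And>x. inv_fourier k x = 0"
  shows "k \<xi> = 0"
proof -
  note int = integrable_continuous_bounded_support[OF k R]
  \<comment> \<open>Stone-Weierstrass is applied to real functions, hence to those whose complex
    embedding is a trigonometric polynomial.\<close>
  let ?T = "{g. (\<lambda>\<xi>. complex_of_real (g \<xi>)) \<in> (trig_poly :: (real^'d \<Rightarrow> complex) set)}"
  interpret function_ring_on ?T "cball 0 R"
  proof
    fix f :: "real^'d \<Rightarrow> real" assume "f \<in> ?T"
    then have "continuous_on (cball 0 R) (\<lambda>\<xi>. Re (complex_of_real (f \<xi>)))"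
      by (intro continuous_on_Re trig_poly_continuous) simp
    then show "continuous_on (cball 0 R) f" by simp
  next
    fix x y :: "real^'d" assume "x \<noteq> y"
    then show "\<exists>f\<in>?T. f x \<noteq> f y" using trig_poly_separates by blast
  qed (use trig_poly_mult in \<open>auto intro: trig_poly.add trig_poly_const\<close>)
  have orth: "(LINT \<xi>|lborel. k \<xi> * of_real (h \<xi>)) = 0" if h: "continuous_on UNIV h" for h
  proof -
    let ?I = "LINT \<xi>|lborel. k \<xi> * of_real (h \<xi>)"
    have inth: "integrable lborel (\<lambda>\<xi>. k \<xi> * of_real (h \<xi>))"
      by (rule integrable_continuous_bounded_support[where R = R])
        (use k h R in \<open>auto intro!: continuous_intros\<close>)
    have le: "cmod ?I \<le> e * (LINT \<xi>|lborel. cmod (k \<xi>))" if e: "e > 0" for e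
    proof -
      have "continuous_on (cball 0 R) h" using h continuous_on_subset by blast
      from Stone_Weierstrass_basic[OF this e] obtain g where g: "g \<in> ?T" "\<And>\<xi>. \<xi> \<in> cball 0 R \<Longrightarrow> \<bar>h \<xi> - g \<xi>\<bar> < e"
        by auto
      from g(1) have g': "integrable lborel (\<lambda>\<xi>. k \<xi> * of_real (g \<xi>))" "(LINT \<xi>|lborel. k \<xi> * of_real (g \<xi>)) = 0"
        using trig_poly_orthogonal[OF _ int 0] by auto
      have "?I = (LINT \<xi>|lborel. k \<xi> * of_real (h \<xi>) - k \<xi> * of_real (g \<xi>))"
        using inth g' by simp
      then have "cmod ?I \<le> (LINT \<xi>|lborel. cmod (k \<xi> * of_real (h \<xi>) - k \<xi> * of_real (g \<xi>)))"
        by (simp only: integral_norm_bound)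
      also have "\<dots> \<le> (LINT \<xi>|lborel. e * cmod (k \<xi>))"
      proof (rule integral_mono)
        show "integrable lborel (\<lambda>\<xi>. cmod (k \<xi> * of_real (h \<xi>) - k \<xi> * of_real (g \<xi>)))"
          using inth g' by (intro integrable_norm Bochner_Integration.integrable_diff)
        show "integrable lborel (\<lambda>\<xi>. e * cmod (k \<xi>))" using int by simp
        fix \<xi>
        show "cmod (k \<xi> * of_real (h \<xi>) - k \<xi> * of_real (g \<xi>)) \<le> e * cmod (k \<xi>)"
        proof (cases "R < norm \<xi>")
          case True
          then show ?thesis using R by simp
        next
          case False
          have "cmod (k \<xi> * of_real (h \<xi>) - k \<xi> * of_real (g \<xi>)) = \<bar>h \<xi> - g \<xi>\<bar> * cmod (k \<xi>)"
            by (simp add: right_diff_distrib[symmetric] norm_mult of_real_diff[symmetric] del: of_real_diff)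
          then show ?thesis using g(2)[of \<xi>] False by (simp add: mult_right_mono)
        qed
      qed
      finally show ?thesis by simp
    qed
    have "cmod ?I \<le> 0"
    proof (rule field_le_epsilon)
      fix e :: real assume e: "e > 0"
      let ?J = "LINT \<xi>|lborel. cmod (k \<xi>)"
      have J: "?J \<ge> 0" by simp
      \<comment> \<open>Dividing by \<open>?J + 1\<close> instead of \<open>?J\<close> avoids a
        separate case for \<open>?J = 0\<close>.\<close>
      have "cmod ?I \<le> e / (?J + 1) * ?J" using e J by (intro le) (simp add: add_nonneg_pos)
      also have "\<dots> = e * (?J / (?J + 1))" by simp
      also have "\<dots> \<le> e * 1"
      proof (rule mult_left_mono)
        have "0 < ?J + 1" by (rule add_nonneg_pos[OF J zero_less_one])
        then show "?J / (?J + 1) \<le> 1" by (rule divide_le_eq_1_pos[THEN iffD2]) (rule less_imp_le, rule less_add_one)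
        show "0 \<le> e" using e by (rule less_imp_le)
      qed
      finally show "cmod ?I \<le> 0 + e" by simp
    qed
    then show ?thesis by simp
  qed
  have i1: "integrable lborel (\<lambda>\<xi>. k \<xi> * of_real (Re (k \<xi>)))" "integrable lborel (\<lambda>\<xi>. k \<xi> * of_real (Im (k \<xi>)))"
    by (rule integrable_continuous_bounded_support[where R = R], use k R in \<open>auto intro!: continuous_intros\<close>)+
  \<comment> \<open>The real tests Re k and Im k combine to the conjugate of
    \<open>k\<close>.\<close>
  have "(LINT \<xi>|lborel. k \<xi> * of_real (Re (k \<xi>)) - \<i> * (k \<xi> * of_real (Im (k \<xi>)))) = 0"
    using i1 orth[of "\<lambda>\<xi>. Re (k \<xi>)"] orth[of "\<lambda>\<xi>. Im (k \<xi>)"] k by (simp add: continuous_on_Re continuous_on_Im)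
  moreover have "k \<xi> * of_real (Re (k \<xi>)) - \<i> * (k \<xi> * of_real (Im (k \<xi>))) = of_real ((cmod (k \<xi>))\<^sup>2)" for \<xi>
    by (simp add: complex_eq_iff cmod_def power2_eq_square)
  ultimately have z: "(LINT \<xi>|lborel. (cmod (k \<xi>))\<^sup>2) = 0" by (simp del: of_real_power)
  have "integrable lborel (\<lambda>\<xi>. complex_of_real ((cmod (k \<xi>))\<^sup>2))"
    by (rule integrable_continuous_bounded_support[where R = R]) (use k R in \<open>auto intro!: continuous_intros\<close>)
  then have "integrable lborel (\<lambda>\<xi>. (cmod (k \<xi>))\<^sup>2)" by (simp only: complex_of_real_integrable_eq)
  with z have "AE \<xi> in lborel. (cmod (k \<xi>))\<^sup>2 = 0" by (subst (asm) integral_nonneg_eq_0_iff_AE) auto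
  then have "AE \<xi> in lborel. k \<xi> = 0" by simp
  then show ?thesis by (rule continuous_AE_eq_0[OF k])
qed

section \<open>Smooth compactly supported functions\<close>

text \<open>\<open>smooth\<close> speaks of lists of directions on the whole space. Recursion on the
  order turns product and chain rule into inductions, and the set \<open>S\<close> allows a proof of
  smoothness on the pieces of an open cover, as \<open>psi_hat\<close> requires.\<close>

primrec Ck :: "nat \<Rightarrow> 'a::euclidean_space set \<Rightarrow> ('a \<Rightarrow> complex) \<Rightarrow> bool" where
  "Ck 0 S g \<longleftrightarrow> continuous_on S g"
| "Ck (Suc n) S g \<longleftrightarrow> (\<forall>x\<in>S. g differentiable at x) \<and>
     (\<forall>b\<in>Basis. Ck n S (\<lambda>x. frechet_derivative g (at x) b))"

text \<open>Since \<open>S\<close> is open, derivatives at its points depend only on values in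
  \<open>S\<close>.\<close>

lemma Ck_cong:
  assumes S: "open S" and eq: "\<And>x. x \<in> S \<Longrightarrow> f x = g x" and f: "Ck n S f"
  shows "Ck n S g"
  using eq f
proof (induction n arbitrary: f g)
  case 0
  then show ?case using continuous_on_cong[of S S f g] by simp
next
  case (Suc n)
  have d: "(g has_derivative frechet_derivative f (at x)) (at x)" if "x \<in> S" for x
  proof (rule has_derivative_transform_within_open[OF _ S that])
    show "(f has_derivative frechet_derivative f (at x)) (at x)"
      using Suc.prems(2) that by (intro frechet_derivative_works[THEN iffD1]) simp
  qed (rule Suc.prems(1))
  have "Ck n S (\<lambda>x. frechet_derivative g (at x) b)" if b: "b \<in> Basis" for b
  proof (rule Suc.IH)
    show "Ck n S (\<lambda>x. frechet_derivative f (at x) b)" using Suc.prems b by simp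
    show "frechet_derivative f (at x) b = frechet_derivative g (at x) b" if "x \<in> S" for x
      using frechet_derivative_at[OF d[OF that]] by simp
  qed
  then show ?case using d by (auto simp: differentiable_def)
qed

lemma Ck_SucI:
  assumes S: "open S" and d: "\<And>x. x \<in> S \<Longrightarrow> (g has_derivative g' x) (at x)"
    and "\<And>b. b \<in> Basis \<Longrightarrow> Ck n S (\<lambda>x. g' x b)"
  shows "Ck (Suc n) S g"
proof -
  have "Ck n S (\<lambda>x. frechet_derivative g (at x) b)" if "b \<in> Basis" for b
    by (rule Ck_cong[OF S _ assms(3)[OF that]]) (simp add: frechet_derivative_at[OF d, symmetric])
  then show ?thesis using d by (auto simp: differentiable_def)
qed

lemma Ck_SucD:
  assumes "Ck (Suc n) S g"
  shows "x \<in> S \<Longrightarrow> (g has_derivative frechet_derivative g (at x)) (at x)"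
    "b \<in> Basis \<Longrightarrow> Ck n S (\<lambda>x. frechet_derivative g (at x) b)"
  using assms by (auto intro: frechet_derivative_works[THEN iffD1])

lemma Ck_Suc_imp: "Ck (Suc n) S g \<Longrightarrow> Ck n S g"
proof (induction n arbitrary: g)
  case 0
  then show ?case
    by (auto intro!: differentiable_imp_continuous_on simp: differentiable_on_def differentiable_at_withinI)
next
  case (Suc n)
  show ?case
    unfolding Ck.simps(2)[of n]
  proof (intro conjI ballI)
    show "g differentiable at x" if "x \<in> S" for x
      using Ck_SucD(1)[OF Suc.prems that] by (auto simp: differentiable_def)
    show "Ck n S (\<lambda>x. frechet_derivative g (at x) b)" if "b \<in> Basis" for b
      by (rule Suc.IH[OF Ck_SucD(2)[OF Suc.prems that]])
  qed
qed

lemma Ck_continuous: "Ck n S g \<Longrightarrow> continuous_on S g"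
proof (induction n)
  case (Suc n)
  then show ?case using Ck_Suc_imp by blast
qed simp

lemma Ck_Un:
  assumes "open S" "open T" "Ck n S g" "Ck n T g"
  shows "Ck n (S \<union> T) g"
  using assms(3,4)
proof (induction n arbitrary: g)
  case 0
  then show ?case using assms(1,2) by (simp add: continuous_on_open_Un)
next
  case (Suc n)
  then show ?case by (simp add: ball_Un)
qed

lemma Ck_const: "open S \<Longrightarrow> Ck n S (\<lambda>_. c)"
proof (induction n arbitrary: c)
  case (Suc n)
  show ?case by (rule Ck_SucI[where g' = "\<lambda>_ _. 0"]) (use Suc in auto)
qed simp

lemma Ck_add:
  assumes S: "open S" shows "Ck n S f \<Longrightarrow> Ck n S g \<Longrightarrow> Ck n S (\<lambda>x. f x + g x)"
proof (induction n arbitrary: f g)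
  case 0
  then show ?case by (auto intro: continuous_on_add)
next
  case (Suc n)
  show ?case
  proof (rule Ck_SucI[OF S])
    show "((\<lambda>x. f x + g x) has_derivative (\<lambda>h. frechet_derivative f (at x) h + frechet_derivative g (at x) h)) (at x)" if "x \<in> S" for x
      using Suc.prems that by (intro has_derivative_add Ck_SucD(1))
  qed (use Suc in auto)
qed

lemma Ck_mult:
  assumes S: "open S" shows "Ck n S f \<Longrightarrow> Ck n S g \<Longrightarrow> Ck n S (\<lambda>x. f x * g x)"
proof (induction n arbitrary: f g)
  case 0
  then show ?case by (auto intro: continuous_on_mult)
next
  case (Suc n)
  show ?case
  proof (rule Ck_SucI[OF S])
    show "((\<lambda>x. f x * g x) has_derivative (\<lambda>h. f x * frechet_derivative g (at x) h + frechet_derivative f (at x) h * g x)) (at x)" if "x \<in> S" for x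
      using Suc.prems that by (intro has_derivative_mult Ck_SucD(1))
    fix b :: 'a assume b: "b \<in> Basis"
    show "Ck n S (\<lambda>x. f x * frechet_derivative g (at x) b + frechet_derivative f (at x) b * g x)"
      using Suc.prems b by (intro Ck_add[OF S] Suc.IH) (auto intro: Ck_SucD(2) Ck_Suc_imp simp del: Ck.simps)
  qed
qed

lemma Ck_prod:
  assumes S: "open S" and "finite I" "\<And>i. i \<in> I \<Longrightarrow> Ck n S (f i)"
  shows "Ck n S (\<lambda>x. \<Prod>i\<in>I. f i x)"
  using assms(2,3) by (induction I rule: finite_induct) (auto intro: Ck_const Ck_mult S)

lemma Ck_linear:
  assumes "open S" and L: "bounded_linear L"
  shows "Ck n S L"
proof (cases n)
  case 0
  then show ?thesis using L by (simp add: linear_continuous_on)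
next
  case (Suc m)
  show ?thesis unfolding Suc
    by (rule Ck_SucI[where g' = "\<lambda>_. L"])
      (use assms in \<open>auto intro: Ck_const bounded_linear_imp_has_derivative\<close>)
qed

text \<open>The chain rule writes a partial derivative as a product of a derivative of
  \<open>u\<close> and \<open>g'\<close> composed with \<open>u\<close>, to which
  \<open>Ck_mult\<close> and the induction hypothesis apply. \<open>u\<close> is embedded into the
  complex numbers because \<open>Ck\<close> is about complex values.\<close>

lemma Ck_compose:
  fixes g :: "real \<Rightarrow> complex" and u :: "'a::euclidean_space \<Rightarrow> real"
  assumes S: "open S"
  shows "Ck n UNIV g \<Longrightarrow> Ck n S (\<lambda>x. complex_of_real (u x)) \<Longrightarrow> Ck n S (\<lambda>x. g (u x))"
proof (induction n arbitrary: g)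
  case 0
  have "continuous_on S (\<lambda>x. Re (complex_of_real (u x)))"
    using 0 by (intro continuous_on_Re) simp
  then have "continuous_on S u" by simp
  moreover have "continuous_on UNIV g" using 0 by simp
  ultimately have "continuous_on S (\<lambda>x. g (u x))" using continuous_on_compose2[of UNIV g S u] by simp
  then show ?case by simp
next
  case (Suc n)
  let ?U = "\<lambda>x. complex_of_real (u x)"
  show ?case
  proof (rule Ck_SucI[OF S])
    fix x assume x: "x \<in> S"
    have "(?U has_derivative frechet_derivative ?U (at x)) (at x)" using Suc.prems(2) x by (rule Ck_SucD(1))
    from bounded_linear.has_derivative[OF bounded_linear_Re this]
    have u: "(u has_derivative (\<lambda>h. Re (frechet_derivative ?U (at x) h))) (at x)"
      by (simp only: Re_complex_of_real)
    then have "(?U has_derivative (\<lambda>h. of_real (Re (frechet_derivative ?U (at x) h)))) (at x)"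
      by (rule has_derivative_of_real)
    \<comment> \<open>The derivative of the embedded function has real values, so it can be fed to
      the derivative of \<open>g\<close>, whose argument is real.\<close>
    then have re: "frechet_derivative ?U (at x) = (\<lambda>h. of_real (Re (frechet_derivative ?U (at x) h)))"
      by (rule frechet_derivative_at[symmetric])
    have g: "(g has_derivative frechet_derivative g (at (u x))) (at (u x))"
      using Suc.prems(1) by (rule Ck_SucD(1)) simp
    have lin: "frechet_derivative g (at (u x)) r = of_real r * frechet_derivative g (at (u x)) 1" for r
      using linear_scale[OF has_derivative_linear[OF g], of r 1] by (simp add: scaleR_conv_of_real)
    have eq: "(\<lambda>h. frechet_derivative g (at (u x)) (Re (frechet_derivative ?U (at x) h))) =
        (\<lambda>h. frechet_derivative ?U (at x) h * frechet_derivative g (at (u x)) 1)"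
    proof
      fix h
      show "frechet_derivative g (at (u x)) (Re (frechet_derivative ?U (at x) h)) =
          frechet_derivative ?U (at x) h * frechet_derivative g (at (u x)) 1"
        by (rule trans[OF lin arg_cong[OF fun_cong[OF re, symmetric], of "\<lambda>z. z * frechet_derivative g (at (u x)) 1"]])
    qed
    show "((\<lambda>x. g (u x)) has_derivative (\<lambda>h. frechet_derivative ?U (at x) h * frechet_derivative g (at (u x)) 1)) (at x)"
      by (rule has_derivative_eq_rhs[OF has_derivative_compose[OF u g] eq])
  next
    fix b :: 'a assume b: "b \<in> Basis"
    have "Ck n UNIV (\<lambda>y. frechet_derivative g (at y) 1)"
      by (rule Ck_SucD(2)[OF Suc.prems(1)]) simp
    from Suc.IH[OF this Ck_Suc_imp[OF Suc.prems(2)]]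
    have "Ck n S (\<lambda>x. frechet_derivative g (at (u x)) 1)" .
    with Ck_SucD(2)[OF Suc.prems(2) b]
    show "Ck n S (\<lambda>x. frechet_derivative ?U (at x) b * frechet_derivative g (at (u x)) 1)"
      by (rule Ck_mult[OF S])
  qed
qed

lemma smooth_Ck: "smooth f \<Longrightarrow> Ck n UNIV f"
proof (induction n arbitrary: f)
  case 0
  then show ?case by (simp add: smooth_continuous)
next
  case (Suc n)
  have "smooth (\<lambda>x. frechet_derivative f (at x) b)" if b: "b \<in> Basis" for b
  proof -
    \<comment> \<open>\<open>iter_partial\<close> applies the last list entry first, so
      differentiating beforehand appends \<open>b\<close>.\<close>
    have "iter_partial bs (\<lambda>x. frechet_derivative f (at x) b) = iter_partial (bs @ [b]) f" for bs
      by (induction bs) auto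
    moreover have "bs @ [b] \<in> lists Basis" if "bs \<in> lists Basis" for bs using that b by simp
    ultimately show ?thesis using Suc.prems unfolding smooth_def by metis
  qed
  moreover have "\<forall>x. iter_partial [] f differentiable at x"
    using Suc.prems unfolding smooth_def by (rule bspec) simp
  ultimately show ?case using Suc.IH by simp
qed

text \<open>The difference quotients have integral 0 by translation invariance. They are uniformly
  bounded by the Lipschitz constant \<open>B\<close> and vanish off a common ball, so the limit may
  be taken under the integral.\<close>

lemma integral_derivative_eq_0:
  fixes h :: "'a::euclidean_space \<Rightarrow> complex"
  assumes d: "\<And>x. (h has_derivative h' x) (at x)" and c: "continuous_on UNIV (\<lambda>x. h' x b)"
    and R: "\<And>x. R < norm x \<Longrightarrow> h x = 0" and b: "norm b \<le> 1"
  shows "(LINT x|lborel. h' x b) = 0"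
proof -
  have ch: "continuous_on UNIV h"
    using d by (auto simp: continuous_on_eq_continuous_at intro: has_derivative_continuous)
  have ih: "integrable lborel h" by (rule integrable_continuous_bounded_support[OF ch R])
  have z: "h' x b = 0" if "R < norm x" for x
  proof -
    have "open {x::'a. R < norm x}" by (intro open_Collect_less continuous_intros)
    then have "(h has_derivative (\<lambda>_. 0)) (at x)"
      using that R by (intro has_derivative_transform_within_open[OF has_derivative_const[of 0]]) auto
    from has_derivative_unique[OF d this] show ?thesis by simp
  qed
  have "bounded ((\<lambda>x. h' x b) ` cball 0 R)"
    by (intro compact_imp_bounded compact_continuous_image continuous_on_subset[OF c]) auto
  then obtain B0 where B0: "\<And>x. norm x \<le> R \<Longrightarrow> cmod (h' x b) \<le> B0"
    unfolding bounded_iff by (metis imageI mem_cball_0)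
  define B where "B = max B0 0"
  have B: "cmod (h' x b) \<le> B" for x using B0[of x] z[of x] by (cases "R < norm x") (auto simp: B_def)
  have lip: "cmod (h (x + t *\<^sub>R b) - h x) \<le> B * t" if t: "t \<ge> 0" for x t
  proof -
    have "cmod (h (x + t *\<^sub>R b) - h (x + 0 *\<^sub>R b)) \<le> B * norm (t - 0)"
    proof (rule differentiable_bound[of UNIV "\<lambda>s. h (x + s *\<^sub>R b)" "\<lambda>s r. h' (x + s *\<^sub>R b) (r *\<^sub>R b)"])
      show "((\<lambda>s. h (x + s *\<^sub>R b)) has_derivative (\<lambda>r. h' (x + s *\<^sub>R b) (r *\<^sub>R b))) (at s within UNIV)" for s
        by (rule has_derivative_compose[OF _ d]) (auto intro!: derivative_eq_intros)
      show "onorm (\<lambda>r. h' (x + s *\<^sub>R b) (r *\<^sub>R b)) \<le> B" for s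
      proof (rule onorm_le)
        fix r :: real
        have "h' (x + s *\<^sub>R b) (r *\<^sub>R b) = r *\<^sub>R h' (x + s *\<^sub>R b) b"
          by (rule linear_scale[OF has_derivative_linear[OF d]])
        then show "cmod (h' (x + s *\<^sub>R b) (r *\<^sub>R b)) \<le> B * norm r"
          using B[of "x + s *\<^sub>R b"] by (simp add: mult.commute[of B] mult_left_mono)
      qed
    qed auto
    then show ?thesis using t by simp
  qed
  define t where "t n = 1 / real (Suc n)" for n
  have t: "0 < t n" "t n \<le> 1" for n by (auto simp: t_def)
  define q where "q n x = (h (x + t n *\<^sub>R b) - h x) / of_real (t n)" for n x
  have q0: "(LINT x|lborel. q n x) = 0" for n
  proof -
    have "integrable lborel (\<lambda>x. h (x + t n *\<^sub>R b))"
      using integrable_reflect[OF integrable_reflect[OF ih, of "t n *\<^sub>R b"], of 0] by (simp add: add.commute)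
    then show ?thesis using ih by (simp add: q_def integral_translate)
  qed
  have "(\<lambda>n. LINT x|lborel. q n x) \<longlonglongrightarrow> (LINT x|lborel. h' x b)"
  \<comment> \<open>Radius \<open>R + 1\<close>: a step \<open>t n *\<^sub>R b\<close> has norm at
    most 1, so both values in the quotient vanish farther out.\<close>
  proof (rule integral_dominated_convergence[where w = "\<lambda>x. B * indicator (cball 0 (R + 1)) x"])
    show "(\<lambda>x. h' x b) \<in> borel_measurable lborel" using borel_measurable_continuous_onI[OF c] by simp
    show "q n \<in> borel_measurable lborel" for n
      using borel_measurable_continuous_onI[OF ch] unfolding q_def by measurable
    show "integrable lborel (\<lambda>x. B * indicator (cball 0 (R + 1)) (x::'a))"
      by (intro integrable_mult_right integrable_real_indicator) (use emeasure_lborel_cball_finite[of "0::'a" "R + 1"] in auto)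
    show "AE x in lborel. norm (q n x) \<le> B * indicator (cball 0 (R + 1)) x" for n
    proof (rule AE_I2)
      fix x
      show "norm (q n x) \<le> B * indicator (cball 0 (R + 1)) x"
      proof (cases "norm x \<le> R + 1")
        case True
        have "norm (q n x) \<le> B"
          using lip[of "t n" x] t[of n] by (simp add: q_def norm_divide divide_le_eq)
        then show ?thesis using True by simp
      next
        case False
        have "norm (t n *\<^sub>R b) \<le> 1" using t[of n] b by (simp add: mult_le_one)
        then have "norm (x + t n *\<^sub>R b) > R" using norm_diff_ineq[of x "t n *\<^sub>R b"] False by linarith
        then show ?thesis using False R by (simp add: q_def)
      qed
    qed
    show "AE x in lborel. (\<lambda>n. q n x) \<longlonglongrightarrow> h' x b"
    proof (rule AE_I2)
      fix x
      have "((\<lambda>s. h (x + s *\<^sub>R b)) has_derivative (\<lambda>r. h' (x + 0 *\<^sub>R b) (r *\<^sub>R b))) (at 0)"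
        by (rule has_derivative_compose[OF _ d]) (auto intro!: derivative_eq_intros)
      moreover have "h' (x + 0 *\<^sub>R b) (r *\<^sub>R b) = r *\<^sub>R h' x b" for r
        using linear_scale[OF has_derivative_linear[OF d]] by simp
      ultimately have "((\<lambda>s. h (x + s *\<^sub>R b)) has_derivative (\<lambda>r. r *\<^sub>R h' x b)) (at 0)"
        by simp
      then have lim: "((\<lambda>r. norm (h (x + (0 + r) *\<^sub>R b) - h (x + 0 *\<^sub>R b) - r *\<^sub>R h' x b) / norm r) \<longlongrightarrow> 0) (at 0)"
        unfolding has_derivative_at by (rule conjunct2)
      have "t \<longlonglongrightarrow> 0"
        using LIMSEQ_inverse_real_of_nat unfolding t_def inverse_eq_divide .
      then have "filterlim t (at 0) sequentially"
        by (intro filterlim_atI) (use t(1) in \<open>auto intro!: always_eventually simp: less_imp_neq[THEN not_sym]\<close>)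
      from filterlim_compose[OF lim this]
      have lim': "(\<lambda>n. norm (h (x + (0 + t n) *\<^sub>R b) - h (x + 0 *\<^sub>R b) - t n *\<^sub>R h' x b) / norm (t n)) \<longlonglongrightarrow> 0" .
      have "norm (h (x + (0 + t n) *\<^sub>R b) - h (x + 0 *\<^sub>R b) - t n *\<^sub>R h' x b) / norm (t n) = norm (q n x - h' x b)" for n
      proof -
        have "q n x - h' x b = (h (x + (0 + t n) *\<^sub>R b) - h (x + 0 *\<^sub>R b) - t n *\<^sub>R h' x b) / of_real (t n)"
          using t(1)[of n] by (simp add: q_def diff_divide_distrib scaleR_conv_of_real)
        then show ?thesis by (simp add: norm_divide)
      qed
      with lim' have "(\<lambda>n. norm (q n x - h' x b)) \<longlonglongrightarrow> 0" by simp
      then have "(\<lambda>n. q n x - h' x b) \<longlonglongrightarrow> 0" by (rule tendsto_norm_zero_cancel)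
      then show "(\<lambda>n. q n x) \<longlonglongrightarrow> h' x b" by (rule LIM_zero_cancel)
    qed
  qed
  then show ?thesis by (simp add: q0 LIMSEQ_const_iff)
qed

text \<open>Integration by parts: the derivative of \<open>k\<close> times the character has
  integral 0, because \<open>k\<close> vanishes off a ball.\<close>

lemma inv_fourier_derivative:
  fixes k :: "real^'d \<Rightarrow> complex"
  assumes k: "Ck (Suc 0) UNIV k" and R: "\<And>\<xi>. R < norm \<xi> \<Longrightarrow> k \<xi> = 0" and b: "b \<in> Basis"
  shows "inv_fourier (\<lambda>\<xi>. frechet_derivative k (at \<xi>) b) x = - (2 * pi * \<i> * (b \<bullet> x)) * inv_fourier k x"
proof -
  let ?k' = "\<lambda>\<xi>. frechet_derivative k (at \<xi>)"
  let ?e = "\<lambda>\<xi>. cis (2 * pi * (\<xi> \<bullet> x))"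
  have ck: "continuous_on UNIV k" using Ck_continuous[OF k] .
  have ck': "continuous_on UNIV (\<lambda>\<xi>. ?k' \<xi> b)" using Ck_continuous[OF Ck_SucD(2)[OF k b]] .
  have z: "?k' \<xi> b = 0" if "R < norm \<xi>" for \<xi>
  proof -
    have "open {x::real^'d. R < norm x}" by (intro open_Collect_less continuous_intros)
    then have "(k has_derivative (\<lambda>_. 0)) (at \<xi>)"
      using that R by (intro has_derivative_transform_within_open[OF has_derivative_const[of 0]]) auto
    from fun_cong[OF frechet_derivative_at[OF this], of b] show ?thesis by simp
  qed
  have de: "(?e has_derivative (\<lambda>h. of_real (2 * pi * (h \<bullet> x)) * (\<i> * ?e \<xi>))) (at \<xi>)" for \<xi>
  proof -
    have "((\<lambda>\<xi>. \<i> * of_real (2 * pi * (\<xi> \<bullet> x))) has_derivative (\<lambda>h. \<i> * of_real (2 * pi * (h \<bullet> x)))) (at \<xi>)"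
      by (auto intro!: derivative_eq_intros)
    moreover have "(exp has_derivative (*) (exp z)) (at z)" for z :: complex
      using DERIV_exp[of z] by (simp add: has_field_derivative_def)
    ultimately have "((\<lambda>\<xi>. exp (\<i> * of_real (2 * pi * (\<xi> \<bullet> x)))) has_derivative
        (\<lambda>h. exp (\<i> * of_real (2 * pi * (\<xi> \<bullet> x))) * (\<i> * of_real (2 * pi * (h \<bullet> x))))) (at \<xi>)"
      by (rule has_derivative_compose)
    then show ?thesis by (simp add: cis_conv_exp mult_ac)
  qed
  define P where "P \<xi> h = k \<xi> * (of_real (2 * pi * (h \<bullet> x)) * (\<i> * ?e \<xi>))" for \<xi> h
  define Q where "Q \<xi> h = ?k' \<xi> h * ?e \<xi>" for \<xi> h
  have cP: "continuous_on UNIV (\<lambda>\<xi>. P \<xi> b)" unfolding P_def by (intro continuous_intros ck)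
  have cQ: "continuous_on UNIV (\<lambda>\<xi>. Q \<xi> b)" unfolding Q_def by (intro continuous_intros ck')
  have "(LINT \<xi>|lborel. P \<xi> b + Q \<xi> b) = 0"
  proof (rule integral_derivative_eq_0)
    show "((\<lambda>\<xi>. k \<xi> * ?e \<xi>) has_derivative (\<lambda>h. P \<xi> h + Q \<xi> h)) (at \<xi>)" for \<xi>
      unfolding P_def Q_def by (rule has_derivative_mult[OF Ck_SucD(1)[OF k UNIV_I] de])
    show "continuous_on UNIV (\<lambda>\<xi>. P \<xi> b + Q \<xi> b)" by (rule continuous_on_add[OF cP cQ])
    show "k \<xi> * ?e \<xi> = 0" if "R < norm \<xi>" for \<xi> using R[OF that] by simp
    show "norm b \<le> 1" using b by simp
  qed
  moreover have "integrable lborel (\<lambda>\<xi>. P \<xi> b)"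
    by (rule integrable_continuous_bounded_support[OF cP, of R]) (simp add: P_def R)
  moreover have "integrable lborel (\<lambda>\<xi>. Q \<xi> b)"
    by (rule integrable_continuous_bounded_support[OF cQ, of R]) (simp add: Q_def z)
  ultimately have "(LINT \<xi>|lborel. P \<xi> b) + (LINT \<xi>|lborel. Q \<xi> b) = 0"
    by simp
  moreover have "P \<xi> b = (2 * pi * \<i> * (b \<bullet> x)) * (k \<xi> * ?e \<xi>)" for \<xi>
    by (simp add: P_def)
  then have "(LINT \<xi>|lborel. P \<xi> b) = (2 * pi * \<i> * (b \<bullet> x)) * inv_fourier k x"
    unfolding inv_fourier_def by (simp only: integral_mult_right_zero)
  moreover have "(LINT \<xi>|lborel. Q \<xi> b) = inv_fourier (\<lambda>\<xi>. ?k' \<xi> b) x"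
    by (simp add: Q_def inv_fourier_def)
  ultimately show ?thesis by (simp add: eq_neg_iff_add_eq_0 add.commute)
qed

text \<open>Each derivative of \<open>k\<close> buys one power of the coordinate; the induction
  replaces \<open>k\<close> by its partial derivative, which has the same support bound.\<close>

lemma inv_fourier_power_bounded:
  fixes k :: "real^'d \<Rightarrow> complex"
  assumes "\<And>n. Ck n UNIV k" and "\<And>\<xi>. R < norm \<xi> \<Longrightarrow> k \<xi> = 0" and b: "b \<in> Basis"
  shows "\<exists>C. \<forall>x. \<bar>b \<bullet> x\<bar> ^ n * cmod (inv_fourier k x) \<le> C"
  using assms(1,2)
proof (induction n arbitrary: k)
  case 0
  have "integrable lborel k"
    by (rule integrable_continuous_bounded_support[OF Ck_continuous[OF 0(1)] 0(2)])
  then show ?case using cmod_inv_fourier_le by auto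
next
  case (Suc n)
  let ?k' = "\<lambda>\<xi>. frechet_derivative k (at \<xi>) b"
  have "?k' \<xi> = 0" if "R < norm \<xi>" for \<xi>
  proof -
    have "open {x::real^'d. R < norm x}" by (intro open_Collect_less continuous_intros)
    then have "(k has_derivative (\<lambda>_. 0)) (at \<xi>)"
      using that Suc.prems(2) by (intro has_derivative_transform_within_open[OF has_derivative_const[of 0]]) auto
    from fun_cong[OF frechet_derivative_at[OF this], of b] show ?thesis by simp
  qed
  moreover have "Ck m UNIV ?k'" for m by (rule Ck_SucD(2)[OF Suc.prems(1) b])
  ultimately obtain C where C: "\<And>x. \<bar>b \<bullet> x\<bar> ^ n * cmod (inv_fourier ?k' x) \<le> C"
    using Suc.IH[of ?k'] by metis
  have "\<bar>b \<bullet> x\<bar> ^ Suc n * cmod (inv_fourier k x) \<le> C / (2 * pi)" for x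
  proof -
    have "inv_fourier ?k' x = - (2 * pi * \<i> * (b \<bullet> x)) * inv_fourier k x"
      by (rule inv_fourier_derivative[OF Suc.prems b])
    then have "cmod (inv_fourier ?k' x) = 2 * pi * \<bar>b \<bullet> x\<bar> * cmod (inv_fourier k x)"
      by (simp add: norm_mult)
    with C[of x] show ?thesis by (simp add: field_simps)
  qed
  then show ?case by blast
qed

text \<open>Reduces the radial weight to powers of single coordinates. With \<open>M\<close> the
  largest of 1 and the absolute coordinates, \<open>1 + norm x\<close> is at most (1 + DIM)
  \<open>M\<close>, and \<open>M ^ N\<close> is one of the summands.\<close>

lemma one_plus_norm_power_le:
  fixes x :: "'a::euclidean_space"
  shows "(1 + norm x) ^ N \<le> (1 + real DIM('a)) ^ N * (1 + (\<Sum>b\<in>Basis. \<bar>b \<bullet> x\<bar> ^ N))"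
proof -
  let ?A = "insert 1 ((\<lambda>b. \<bar>b \<bullet> x\<bar>) ` Basis)"
  define M where "M = Max ?A"
  have M: "1 \<le> M" "\<And>b. b \<in> Basis \<Longrightarrow> \<bar>b \<bullet> x\<bar> \<le> M" unfolding M_def by (rule Max_ge; simp)+
  have "norm x \<le> (\<Sum>b\<in>Basis. \<bar>x \<bullet> b\<bar>)" by (rule norm_le_l1)
  also have "\<dots> \<le> (\<Sum>b\<in>(Basis::'a set). M)" by (intro sum_mono) (simp add: M inner_commute[of x])
  finally have "1 + norm x \<le> (1 + real DIM('a)) * M" using M(1) by (simp add: distrib_right)
  then have "(1 + norm x) ^ N \<le> (1 + real DIM('a)) ^ N * M ^ N"
    by (metis power_mult_distrib power_mono add_nonneg_nonneg norm_ge_zero zero_le_one)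
  also have "M ^ N \<le> 1 + (\<Sum>b\<in>Basis. \<bar>b \<bullet> x\<bar> ^ N)"
  proof -
    have "M \<in> ?A" unfolding M_def by (rule Max_in) auto
    then consider "M = 1" | b where "b \<in> Basis" "M = \<bar>b \<bullet> x\<bar>" by auto
    then show ?thesis
    proof cases
      case 1
      then show ?thesis by (simp add: sum_nonneg)
    next
      case 2
      have "\<bar>b \<bullet> x\<bar> ^ N \<le> (\<Sum>b\<in>Basis. \<bar>b \<bullet> x\<bar> ^ N)"
        using 2(1) by (intro member_le_sum) auto
      then show ?thesis using 2 by simp
    qed
  qed
  finally show ?thesis by (simp add: mult_left_mono)
qed

lemma rapid_inv_fourier:
  fixes k :: "real^'d \<Rightarrow> complex"
  assumes k: "\<And>n. Ck n UNIV k" and R: "\<And>\<xi>. R < norm \<xi> \<Longrightarrow> k \<xi> = 0"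
  shows "rapid (inv_fourier k)"
  unfolding rapid_def
proof (intro conjI allI)
  have int: "integrable lborel k"
    by (rule integrable_continuous_bounded_support[OF Ck_continuous[OF k] R])
  show "inv_fourier k \<in> borel_measurable borel"
    by (rule borel_measurable_continuous_onI[OF continuous_inv_fourier[OF int]])
  fix N
  let ?F = "\<lambda>x. cmod (inv_fourier k x)"
  have "\<forall>b\<in>Basis. \<exists>C. \<forall>x. \<bar>b \<bullet> x\<bar> ^ N * ?F x \<le> C"
    using inv_fourier_power_bounded[OF k R] by blast
  then obtain C where C: "\<And>b x. b \<in> Basis \<Longrightarrow> \<bar>b \<bullet> x\<bar> ^ N * ?F x \<le> C b" by metis
  have "(1 + norm x) ^ N * ?F x \<le> (1 + real DIM(real^'d)) ^ N * ((LINT \<xi>|lborel. cmod (k \<xi>)) + (\<Sum>b\<in>Basis. C b))" for x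
  proof -
    have "(1 + norm x) ^ N * ?F x \<le> (1 + real DIM(real^'d)) ^ N * (1 + (\<Sum>b\<in>Basis. \<bar>b \<bullet> x\<bar> ^ N)) * ?F x"
      by (intro mult_right_mono one_plus_norm_power_le) simp
    also have "\<dots> = (1 + real DIM(real^'d)) ^ N * (?F x + (\<Sum>b\<in>Basis. \<bar>b \<bullet> x\<bar> ^ N * ?F x))"
      by (simp add: sum_distrib_right distrib_right)
    also have "\<dots> \<le> (1 + real DIM(real^'d)) ^ N * ((LINT \<xi>|lborel. cmod (k \<xi>)) + (\<Sum>b\<in>Basis. C b))"
      by (intro mult_left_mono add_mono sum_mono C cmod_inv_fourier_le int) auto
    finally show ?thesis .
  qed
  then show "\<exists>C. \<forall>x. (1 + norm x) ^ N * ?F x \<le> C" by blast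
qed

section \<open>Support and smoothness of the shearlet generators\<close>

lemma not_in_supp: "x \<notin> supp f \<Longrightarrow> f x = 0"
  using closure_subset[of "{x. f x \<noteq> 0}"] by (auto simp: supp_def)

text \<open>The support of \<open>h1\<close> confines the component \<delta>; the support of
  \<open>h2\<close> makes the other components no larger than it.\<close>

lemma psi_hat_nonzeroD:
  assumes "shear_generators h1 h2" and nz: "psi_hat h1 h2 \<delta> \<xi> \<noteq> 0"
  shows "1 / 16 \<le> \<bar>\<xi> $ \<delta>\<bar>" "\<bar>\<xi> $ i\<bar> \<le> 1 / 2"
proof -
  have s1: "supp h1 \<subseteq> {-1/2..-1/16} \<union> {1/16..1/2}" and s2: "supp h2 \<subseteq> {-1..1}"
    using assms(1) by (auto simp: shear_generators_def)
  have "h1 (\<xi> $ \<delta>) \<noteq> 0" using nz by (auto simp: psi_hat_def)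
  then have 1: "\<xi> $ \<delta> \<in> {-1/2..-1/16} \<union> {1/16..1/2}" using not_in_supp s1 by blast
  then show d: "1 / 16 \<le> \<bar>\<xi> $ \<delta>\<bar>" by auto
  have d2: "\<bar>\<xi> $ \<delta>\<bar> \<le> 1 / 2" using 1 by auto
  show "\<bar>\<xi> $ i\<bar> \<le> 1 / 2"
  proof (cases "i = \<delta>")
    case False
    then have "h2 (\<xi> $ i / \<xi> $ \<delta>) \<noteq> 0" using nz by (auto simp: psi_hat_def)
    then have "\<xi> $ i / \<xi> $ \<delta> \<in> {-1..1}" using not_in_supp s2 by blast
    then have "\<bar>\<xi> $ i\<bar> / \<bar>\<xi> $ \<delta>\<bar> \<le> 1" by (simp add: abs_divide[symmetric] abs_le_iff del: abs_divide)
    moreover have "0 < \<bar>\<xi> $ \<delta>\<bar>" using d by linarith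
    ultimately have "\<bar>\<xi> $ i\<bar> \<le> \<bar>\<xi> $ \<delta>\<bar>" by (simp only: pos_divide_le_eq mult_1)
    then show ?thesis using d2 by simp
  qed (use d2 in simp)
qed

text \<open>The sum of the components gives half this radius; the rounder value also serves for
  \<open>H\<close>.\<close>

lemma psi_hat_eq_0:
  fixes \<xi> :: "real^'d"
  assumes "shear_generators h1 h2" "real CARD('d) < norm \<xi>"
  shows "psi_hat h1 h2 \<delta> \<xi> = 0"
proof (rule ccontr)
  assume nz: "psi_hat h1 h2 \<delta> \<xi> \<noteq> 0"
  have "norm \<xi> \<le> (\<Sum>i\<in>UNIV. \<bar>\<xi> $ i\<bar>)" by (rule norm_le_l1_cart)
  also have "\<dots> \<le> (\<Sum>i\<in>(UNIV::'d set). 1 / 2)" by (intro sum_mono psi_hat_nonzeroD(2)[OF assms(1) nz])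
  also have "\<dots> \<le> real CARD('d)" by simp
  finally show False using assms(2) by simp
qed

text \<open>The derivative of a reciprocal is a product of reciprocals and constants, so the claim
  reproduces itself at each order.\<close>

lemma Ck_inverse_component:
  fixes \<delta> :: "'d::finite"
  shows "Ck n {\<xi>::real^'d. \<xi> $ \<delta> \<noteq> 0} (\<lambda>\<xi>. complex_of_real (1 / \<xi> $ \<delta>))"
proof (induction n)
  case 0
  show ?case by (auto intro!: continuous_intros)
next
  case (Suc n)
  have op: "open {\<xi>::real^'d. \<xi> $ \<delta> \<noteq> 0}" by (intro open_Collect_neq continuous_intros)
  show ?case
  proof (rule Ck_SucI[OF op])
    fix \<xi> :: "real^'d" assume "\<xi> \<in> {\<xi>. \<xi> $ \<delta> \<noteq> 0}"
    then have d: "((\<lambda>\<xi>. 1 / \<xi> $ \<delta>) has_derivative (\<lambda>h. - (h $ \<delta>) * (1 / \<xi> $ \<delta>) * (1 / \<xi> $ \<delta>))) (at \<xi>)"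
      by (auto intro!: derivative_eq_intros bounded_linear.has_derivative[OF bounded_linear_vec_nth]
          simp: fun_eq_iff field_simps power2_eq_square)
    show "((\<lambda>\<xi>. complex_of_real (1 / \<xi> $ \<delta>)) has_derivative
       (\<lambda>h. of_real (- (h $ \<delta>)) * of_real (1 / \<xi> $ \<delta>) * of_real (1 / \<xi> $ \<delta>))) (at \<xi>)"
      by (rule has_derivative_eq_rhs[OF has_derivative_of_real[OF d]]) (simp only: of_real_mult)
  next
    show "Ck n {\<xi>::real^'d. \<xi> $ \<delta> \<noteq> 0} (\<lambda>\<xi>. of_real (- (b $ \<delta>)) * of_real (1 / \<xi> $ \<delta>) * of_real (1 / \<xi> $ \<delta>))" for b
      by (intro Ck_mult op Suc.IH Ck_const)
  qed
qed

lemma Ck_component: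
  assumes "open S" shows "Ck n S (\<lambda>\<xi>::real^'d. complex_of_real (\<xi> $ i))"
  by (intro Ck_linear assms bounded_linear_compose[OF bounded_linear_of_real bounded_linear_vec_nth])

text \<open>The quotients are smooth only off the hyperplane where component \<delta> vanishes. Near
  it the support of \<open>h1\<close> makes the function 0, and the two open sets cover the
  space.\<close>

lemma Ck_psi_hat:
  fixes \<delta> :: "'d::finite"
  assumes g: "shear_generators h1 h2"
  shows "Ck n (UNIV :: (real^'d) set) (psi_hat h1 h2 \<delta>)"
proof -
  let ?S = "{\<xi>::real^'d. \<xi> $ \<delta> \<noteq> 0}" and ?T = "{\<xi>::real^'d. \<bar>\<xi> $ \<delta>\<bar> < 1 / 16}"
  have S: "open ?S" by (intro open_Collect_neq continuous_intros)
  have T: "open ?T" by (intro open_Collect_less continuous_intros)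
  have h: "Ck n UNIV h1" "Ck n UNIV h2" using g by (auto simp: shear_generators_def intro: smooth_Ck)
  have q: "Ck n ?S (\<lambda>\<xi>. complex_of_real (\<xi> $ i / \<xi> $ \<delta>))" for i
    using Ck_mult[OF S Ck_component[OF S, of n i] Ck_inverse_component[of n \<delta>]] by simp
  have "Ck n ?S (\<lambda>\<xi>. h2 (\<xi> $ i / \<xi> $ \<delta>))" for i by (rule Ck_compose[OF S h(2) q])
  then have "Ck n ?S (\<lambda>\<xi>. \<Prod>i\<in>UNIV - {\<delta>}. h2 (\<xi> $ i / \<xi> $ \<delta>))" by (intro Ck_prod[OF S]) simp_all
  then have 1: "Ck n ?S (psi_hat h1 h2 \<delta>)"
    unfolding psi_hat_def[abs_def] by (rule Ck_mult[OF S Ck_compose[OF S h(1) Ck_component[OF S]]])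
  have "0 = psi_hat h1 h2 \<delta> \<xi>" if "\<xi> \<in> ?T" for \<xi>
  proof (rule ccontr)
    assume "0 \<noteq> psi_hat h1 h2 \<delta> \<xi>"
    then have "1 / 16 \<le> \<bar>\<xi> $ \<delta>\<bar>" using psi_hat_nonzeroD(1)[OF g, of \<delta> \<xi>] by simp
    with that show False by simp
  qed
  then have 2: "Ck n ?T (psi_hat h1 h2 \<delta>)"
    by (rule Ck_cong[OF T _ Ck_const[OF T, of n 0]])
  have "?S \<union> ?T = UNIV" by auto
  then show ?thesis using Ck_Un[OF S T 1 2] by simp
qed

section \<open>Quasi-norms\<close>

lemma epow_ennreal: "x \<ge> 0 \<Longrightarrow> epow (ennreal x) r = ennreal (x powr r)"
  by (simp add: epow_def)

lemma epow_mono: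
  assumes "a \<le> b" "r \<ge> 0"
  shows "epow a r \<le> epow b r"
proof (cases "b = \<infinity>")
  case True
  then show ?thesis by (simp add: epow_def)
next
  case False
  then have "b < top" by (simp add: less_top)
  then have "a < top" "enn2real a \<le> enn2real b"
    using assms(1) by (auto intro: le_less_trans enn2real_mono)
  then have "a \<noteq> \<infinity>" "enn2real a \<le> enn2real b" by auto
  then show ?thesis using False assms(2) by (auto simp: epow_def intro!: ennreal_leI powr_mono2)
qed

lemma epow_mult:
  assumes "c > 0"
  shows "epow (ennreal c * a) r = ennreal (c powr r) * epow a r"
proof (cases "a = \<infinity>")
  case True
  then show ?thesis using assms by (simp add: epow_def ennreal_mult_top)
next
  case False
  then obtain x where x: "a = ennreal x" "x \<ge> 0" by (cases a) auto
  have "epow (ennreal c * a) r = epow (ennreal (c * x)) r"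
    using assms x by (simp add: ennreal_mult)
  also have "\<dots> = ennreal ((c * x) powr r)" using assms x by (intro epow_ennreal) simp
  also have "\<dots> = ennreal (c powr r) * epow a r"
    using assms x by (simp add: powr_mult ennreal_mult epow_ennreal)
  finally show ?thesis .
qed

lemma epow_epow_inverse:
  assumes "r > 0"
  shows "epow (epow a r) (1 / r) = a"
proof (cases "a = \<infinity>")
  case True
  then show ?thesis by (simp add: epow_def)
next
  case False
  then obtain x where "a = ennreal x" "x \<ge> 0" by (cases a) auto
  then show ?thesis using assms by (simp add: epow_ennreal powr_powr)
qed

lemma infsum_ennreal_ge:
  fixes f :: "'i \<Rightarrow> ennreal"
  assumes "i \<in> I"
  shows "f i \<le> infsum f I"
proof -
  have "f i = sum f {i}" by simp
  also have "\<dots> \<le> (SUP F\<in>{F. finite F \<and> F \<subseteq> I}. sum f F)"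
    using assms by (intro SUP_upper) auto
  also have "\<dots> = infsum f I" by (rule nonneg_infsum_complete[symmetric]) simp
  finally show ?thesis .
qed

lemma infsum_cmult_ennreal:
  fixes f :: "'i \<Rightarrow> ennreal"
  shows "infsum (\<lambda>i. c * f i) I = c * infsum f I"
  by (simp add: nonneg_infsum_complete SUP_mult_left_ennreal sum_distrib_left)

lemma enn2real_exponent_pos: "0 < q \<Longrightarrow> q \<noteq> \<infinity> \<Longrightarrow> 0 < enn2real q"
  by (simp add: enn2real_positive_iff less_top[symmetric])

lemma lq_norm_ge:
  assumes "i \<in> I" "0 < q"
  shows "a i \<le> lq_norm q I a"
proof (cases "q = \<infinity>")
  case True
  then show ?thesis using assms(1) by (simp add: lq_norm_def SUP_upper)
next
  case False
  let ?r = "enn2real q"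
  have r: "?r > 0" using enn2real_exponent_pos[OF assms(2) False] .
  have "a i = epow (epow (a i) ?r) (1 / ?r)" by (rule epow_epow_inverse[OF r, symmetric])
  also have "\<dots> \<le> epow (infsum (\<lambda>i. epow (a i) ?r) I) (1 / ?r)"
    using r by (intro epow_mono infsum_ennreal_ge[OF assms(1)]) simp
  finally show ?thesis using False by (simp add: lq_norm_def)
qed

text \<open>The factor by which the l^q quasi-norm of at most \<open>n\<close> nonzero terms can
  exceed their supremum.\<close>

definition lq_const :: "ennreal \<Rightarrow> nat \<Rightarrow> real" where
  "lq_const q n = (if q = \<infinity> then 1 else real n powr (1 / enn2real q))"

lemma lq_const_nonneg: "lq_const q n \<ge> 0"
  by (simp add: lq_const_def)

text \<open>Counting nonzero terms replaces the triangle inequality, which fails for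
  \<open>q < 1\<close>.\<close>

lemma lq_norm_le:
  assumes q: "0 < q" and F: "finite F" "card F \<le> n"
    and z: "\<And>i. i \<in> I \<Longrightarrow> i \<notin> F \<Longrightarrow> a i = 0"
    and le: "\<And>i. i \<in> I \<Longrightarrow> a i \<le> ennreal g" and g: "g \<ge> 0"
  shows "lq_norm q I a \<le> ennreal (lq_const q n * g)"
proof (cases "q = \<infinity>")
  case True
  then show ?thesis using le by (auto simp: lq_norm_def lq_const_def intro!: SUP_least)
next
  case False
  let ?r = "enn2real q"
  have r: "?r > 0" using enn2real_exponent_pos[OF q False] .
  have "infsum (\<lambda>i. epow (a i) ?r) I = infsum (\<lambda>i. epow (a i) ?r) (I \<inter> F)"
    using r by (intro infsum_cong_neutral) (auto simp: z epow_ennreal[of 0, simplified])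
  also have "\<dots> = (\<Sum>i\<in>I \<inter> F. epow (a i) ?r)" using F by simp
  also have "\<dots> \<le> (\<Sum>i\<in>I \<inter> F. ennreal (g powr ?r))"
  proof (rule sum_mono)
    fix i assume "i \<in> I \<inter> F"
    then have "epow (a i) ?r \<le> epow (ennreal g) ?r" using le r by (intro epow_mono) auto
    then show "epow (a i) ?r \<le> ennreal (g powr ?r)" using g by (simp add: epow_ennreal)
  qed
  also have "\<dots> = ennreal (real (card (I \<inter> F)) * g powr ?r)"
    by (simp add: ennreal_mult ennreal_of_nat_eq_real_of_nat)
  also have "\<dots> \<le> ennreal (real n * g powr ?r)"
    using F card_mono[OF F(1), of "I \<inter> F"] by (intro ennreal_leI mult_right_mono) auto
  finally have "epow (infsum (\<lambda>i. epow (a i) ?r) I) (1 / ?r) \<le> epow (ennreal (real n * g powr ?r)) (1 / ?r)"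
    using r by (intro epow_mono) auto
  also have "\<dots> = ennreal (lq_const q n * g)"
    using r g False by (simp add: epow_ennreal powr_mult powr_powr lq_const_def)
  finally show ?thesis using False by (simp add: lq_norm_def)
qed

lemma lq_norm_cmult:
  assumes "c > 0" "0 < q"
  shows "lq_norm q I (\<lambda>i. ennreal c * a i) = ennreal c * lq_norm q I a"
proof (cases "q = \<infinity>")
  case True
  then show ?thesis by (simp add: lq_norm_def SUP_mult_left_ennreal)
next
  case False
  have "0 < enn2real q" using enn2real_exponent_pos[OF assms(2) False] .
  then show ?thesis
    using False assms(1) by (simp add: lq_norm_def epow_mult infsum_cmult_ennreal powr_powr)
qed

section \<open>Scaling and decay estimates for L^p quasi-norms\<close>

lemma Lp_norm_mono:
  assumes "p > 0" "\<And>x. F x \<le> G x"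
  shows "Lp_norm p F \<le> Lp_norm p G"
  unfolding Lp_norm_def using assms by (intro epow_mono nn_integral_mono) auto

text \<open>If a simple function lies below \<open>f\<close>, its multiple by \<open>c\<close> lies
  below \<open>c * f\<close>; the supremum over simple functions defines the integral even for
  non-measurable \<open>f\<close>.\<close>

lemma nn_integral_cmult_le:
  "c * (\<integral>\<^sup>+x. f x \<partial>M) \<le> (\<integral>\<^sup>+x. c * f x \<partial>M)"
proof -
  have "c * (\<integral>\<^sup>+x. f x \<partial>M) = (SUP g\<in>{g. simple_function M g \<and> g \<le> f}. c * integral\<^sup>S M g)"
    by (simp add: nn_integral_def SUP_mult_left_ennreal)
  also have "\<dots> \<le> (\<integral>\<^sup>+x. c * f x \<partial>M)"
  proof (rule SUP_least)
    fix g assume "g \<in> {g. simple_function M g \<and> g \<le> f}"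
    then have g: "simple_function M g" "g \<le> f" by auto
    have "c * integral\<^sup>S M g = integral\<^sup>S M (\<lambda>x. c * g x)" using g(1) by simp
    also have "\<dots> = (\<integral>\<^sup>+x. c * g x \<partial>M)"
      using g(1) by (intro nn_integral_eq_simple_integral[symmetric]) (rule simple_function_mult, auto)
    also have "\<dots> \<le> (\<integral>\<^sup>+x. c * f x \<partial>M)"
      using g(2) by (intro nn_integral_mono mult_left_mono) (auto simp: le_fun_def)
    finally show "c * integral\<^sup>S M g \<le> (\<integral>\<^sup>+x. c * f x \<partial>M)" .
  qed
  finally show ?thesis .
qed

text \<open>Used in place of \<open>nn_integral_cmult\<close> so that the \<open>l\<^sup>q\<close> norm of a family of functions
  can be scaled without proving that it is measurable.\<close>

lemma nn_integral_cmult_pos: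
  assumes "c > 0"
  shows "(\<integral>\<^sup>+x. ennreal c * f x \<partial>M) = ennreal c * (\<integral>\<^sup>+x. f x \<partial>M)"
proof (rule antisym)
  have inv: "ennreal c * ennreal (1 / c) = 1" using assms by (simp add: ennreal_mult[symmetric])
  have "(\<integral>\<^sup>+x. ennreal c * f x \<partial>M) = ennreal c * (ennreal (1 / c) * (\<integral>\<^sup>+x. ennreal c * f x \<partial>M))"
    by (simp add: mult.assoc[symmetric] inv)
  also have "\<dots> \<le> ennreal c * (\<integral>\<^sup>+x. ennreal (1 / c) * (ennreal c * f x) \<partial>M)"
    by (intro mult_left_mono nn_integral_cmult_le) simp
  also have "\<dots> = ennreal c * (\<integral>\<^sup>+x. f x \<partial>M)"
    by (simp add: mult.assoc[symmetric] mult.commute[of "ennreal (1 / c)"] inv)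
  finally show "(\<integral>\<^sup>+x. ennreal c * f x \<partial>M) \<le> ennreal c * (\<integral>\<^sup>+x. f x \<partial>M)" .
qed (rule nn_integral_cmult_le)

lemma Lp_norm_cmult:
  assumes "c > 0" "p > 0"
  shows "Lp_norm p (\<lambda>x. ennreal c * F x) = ennreal c * Lp_norm p F"
  using assms by (simp add: Lp_norm_def epow_mult nn_integral_cmult_pos powr_powr)

lemma epow_measurable [measurable]: "(\<lambda>a. epow a r) \<in> borel_measurable borel"
  unfolding epow_def by measurable

lemma Lp_norm_diag:
  fixes c :: "'d::finite \<Rightarrow> real"
  assumes c: "\<And>i. c i \<noteq> 0" and p: "p > 0" and [measurable]: "G \<in> borel_measurable borel"
  shows "Lp_norm p (\<lambda>x. G (diag_mat c *v x)) = ennreal (\<bar>det (diag_mat c)\<bar> powr (- 1 / p)) * Lp_norm p G"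
proof -
  let ?d = "\<bar>det (diag_mat c)\<bar>"
  have d: "?d > 0" using c by (simp add: det_diag_mat)
  let ?I = "\<integral>\<^sup>+x. epow (G (diag_mat c *v x)) p \<partial>lborel"
  have "(\<integral>\<^sup>+x. epow (G x) p \<partial>lborel) = ennreal ?d * ?I"
    by (rule nn_integral_diag_substitution) (use c in auto)
  then have "Lp_norm p G = ennreal (?d powr (1 / p)) * epow ?I (1 / p)"
    using d by (simp add: Lp_norm_def epow_mult)
  then have "ennreal (?d powr (- 1 / p)) * Lp_norm p G =
      (ennreal (?d powr (- 1 / p)) * ennreal (?d powr (1 / p))) * epow ?I (1 / p)"
    by (simp add: mult.assoc)
  also have "ennreal (?d powr (- 1 / p)) * ennreal (?d powr (1 / p)) = 1"
    using d by (simp add: ennreal_mult[symmetric] powr_add[symmetric])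
  finally show ?thesis by (simp add: Lp_norm_def)
qed

text \<open>The L^p quasi-norm of (1 + |x|)^(-N) as a real number, meaningful where it is finite;
  the condition on \<open>N\<close> in \<open>Lp_norm_decay\<close> ensures that.\<close>

definition decay_const :: "'a::euclidean_space itself \<Rightarrow> real \<Rightarrow> nat \<Rightarrow> real" where
  "decay_const _ p N = enn2real (\<integral>\<^sup>+x. ennreal ((1 / (1 + norm (x::'a)) ^ N) powr p) \<partial>lborel) powr (1 / p)"

text \<open>Substituting \<open>c *\<^sub>R x\<close> yields the power of \<open>c\<close>; with
  \<open>c\<close> = 2^J this is the term - d/p of the isotropic exponent. \<open>F\<close> enters
  only through monotonicity, so no measurability of l^q norms has to be shown.\<close>

lemma Lp_norm_decay:
  fixes F :: "'a::euclidean_space \<Rightarrow> ennreal"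
  assumes p: "p > 0" and N: "real N * p \<ge> real (DIM('a) + 2)" and c: "c > 0" and C: "C \<ge> 0"
    and F: "\<And>x. F x \<le> ennreal (C / (1 + c * norm x) ^ N)"
  shows "Lp_norm p F \<le> ennreal (C * c powr (- real DIM('a) / p) * decay_const TYPE('a) p N)"
proof -
  let ?g = "\<lambda>x::'a. (1 / (1 + norm x) ^ N) powr p"
  let ?J = "\<integral>\<^sup>+x. ennreal (?g x) \<partial>lborel"
  have pos: "0 < 1 + norm x" for x :: 'a by (simp add: add_pos_nonneg)
  have "ennreal (?g x) \<le> ennreal (1 / (1 + norm x) ^ (DIM('a) + 2))" for x :: 'a
  proof (rule ennreal_leI)
    have "?g x = (1 + norm x) powr (- (real N * p))"
      using pos[of x] by (simp add: powr_realpow[symmetric] powr_divide powr_powr powr_minus_divide)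
    also have "\<dots> \<le> (1 + norm x) powr (- real (DIM('a) + 2))"
      using N by (intro powr_mono) auto
    also have "\<dots> = 1 / (1 + norm x) ^ (DIM('a) + 2)"
      by (simp only: powr_minus_divide powr_realpow[OF pos])
    finally show "?g x \<le> 1 / (1 + norm x) ^ (DIM('a) + 2)" .
  qed
  then have "?J \<le> (\<integral>\<^sup>+x. ennreal (1 / (1 + norm (x::'a)) ^ (DIM('a) + 2)) \<partial>lborel)"
    by (intro nn_integral_mono)
  then have J: "?J < \<infinity>" using nn_integral_decay_finite[where 'a='a] by (rule le_less_trans)
  have "(\<integral>\<^sup>+x. epow (F x) p \<partial>lborel) \<le> (\<integral>\<^sup>+x. ennreal (C powr p) * ennreal (?g (c *\<^sub>R x)) \<partial>lborel)"
  proof (rule nn_integral_mono)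
    fix x
    have "epow (F x) p \<le> epow (ennreal (C / (1 + c * norm x) ^ N)) p"
      using F p by (intro epow_mono) auto
    also have "\<dots> = ennreal ((C / (1 + c * norm x) ^ N) powr p)"
      using C c by (intro epow_ennreal) auto
    also have "(C / (1 + c * norm x) ^ N) powr p = C powr p * ?g (c *\<^sub>R x)"
      using C c by (simp add: powr_mult[symmetric])
    finally show "epow (F x) p \<le> ennreal (C powr p) * ennreal (?g (c *\<^sub>R x))"
      by (simp add: ennreal_mult)
  qed
  also have "\<dots> = ennreal (C powr p) * (ennreal (1 / c ^ DIM('a)) * ?J)"
    using nn_integral_scale[OF c, of "\<lambda>x::'a. ennreal (?g x)"] by (subst nn_integral_cmult) simp_all
  also have "\<dots> = ennreal (C powr p * (1 / c ^ DIM('a) * enn2real ?J))"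
  proof -
    have "?J = ennreal (enn2real ?J)" using J by simp
    then have "ennreal (C powr p) * (ennreal (1 / c ^ DIM('a)) * ?J) =
        ennreal (C powr p) * (ennreal (1 / c ^ DIM('a)) * ennreal (enn2real ?J))" by (rule arg_cong)
    also have "\<dots> = ennreal (C powr p * (1 / c ^ DIM('a) * enn2real ?J))"
      using c by (simp only: ennreal_mult powr_ge_zero enn2real_nonneg mult_nonneg_nonneg zero_le_divide_1_iff zero_le_power less_imp_le)
    finally show ?thesis .
  qed
  finally have "Lp_norm p F \<le> epow (ennreal (C powr p * (1 / c ^ DIM('a) * enn2real ?J))) (1 / p)"
    unfolding Lp_norm_def using p by (intro epow_mono) auto
  also have "\<dots> = ennreal ((C powr p * (1 / c ^ DIM('a) * enn2real ?J)) powr (1 / p))"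
    using c by (intro epow_ennreal) auto
  also have "(C powr p * (1 / c ^ DIM('a) * enn2real ?J)) powr (1 / p) =
      C * c powr (- real DIM('a) / p) * decay_const TYPE('a) p N"
  proof -
    have "(1 / c ^ DIM('a)) powr (1 / p) = c powr (- real DIM('a) / p)"
      using c by (simp add: powr_realpow[symmetric] powr_minus_divide[symmetric] powr_powr)
    moreover have "(C powr p * (1 / c ^ DIM('a) * enn2real ?J)) powr (1 / p) =
        (C powr p) powr (1 / p) * ((1 / c ^ DIM('a)) powr (1 / p) * enn2real ?J powr (1 / p))"
      using c by (subst powr_mult | simp)+
    moreover have "(C powr p) powr (1 / p) = C" using C p by (simp add: powr_powr)
    ultimately show ?thesis by (simp only: decay_const_def mult.assoc)
  qed
  finally show ?thesis .
qed

lemma decay_const_nonneg: "decay_const TYPE('a::euclidean_space) p N \<ge> 0"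
  by (simp add: decay_const_def)

section \<open>The dilation and shear matrices\<close>

lemma matrix_inv_eqI:
  fixes A B :: "real^'d^'d"
  assumes "A ** B = mat 1"
  shows "matrix_inv A = B"
proof -
  have "invertible A" using assms matrix_left_right_inverse[of A B] by (auto simp: invertible_def)
  then have "matrix_inv A ** (A ** B) = B" by (simp add: matrix_mul_assoc matrix_inv_mult)
  then show ?thesis using assms by simp
qed

text \<open>The diagonal of the power \<open>j\<close> of \<open>dil \<delta>\<close>.\<close>

definition dscale :: "'d::finite \<Rightarrow> nat \<Rightarrow> 'd \<Rightarrow> real" where
  "dscale \<delta> j i = (if i = \<delta> then 4 ^ j else 2 ^ j)"

lemma dscale_pos: "dscale \<delta> j i > 0"
  by (simp add: dscale_def)

lemma dscale_bounds: "2 ^ j \<le> dscale \<delta> j i" "dscale \<delta> j i \<le> 4 ^ j"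
  by (auto simp: dscale_def intro: power_mono)

lemma matrix_pow_diag_mat: "matrix_pow (diag_mat c) j = diag_mat (\<lambda>i. c i ^ j)"
  unfolding matrix_pow_def
proof (induction j)
  case 0
  then show ?case by (simp add: diag_mat_1)
next
  case (Suc j)
  then show ?case by (simp add: diag_mat_mult)
qed

lemma matrix_pow_inv_dil: "matrix_pow (matrix_inv (dil \<delta>)) j = diag_mat (\<lambda>i. 1 / dscale \<delta> j i)"
proof -
  have "dil \<delta> = diag_mat (dscale \<delta> 1)"
    by (simp add: dil_def diag_mat_def dscale_def vec_eq_iff)
  moreover have "diag_mat (dscale \<delta> 1) ** diag_mat (\<lambda>i. 1 / dscale \<delta> 1 i) = mat 1"
    using dscale_pos[of \<delta> 1] by (simp add: diag_mat_mult diag_mat_1[symmetric] less_imp_neq[THEN not_sym])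
  ultimately have "matrix_inv (dil \<delta>) = diag_mat (\<lambda>i. 1 / dscale \<delta> 1 i)" by (simp add: matrix_inv_eqI)
  then show ?thesis
    by (simp add: matrix_pow_diag_mat power_divide dscale_def if_distrib[of "\<lambda>x. 1 / x ^ j"] if_distrib[of "\<lambda>x. (1 / x) ^ j"] cong: if_cong)
      (rule arg_cong[of _ _ diag_mat], auto simp: dscale_def power_divide)
qed

lemma shear_mult_vector:
  assumes "l $ \<delta> = 0"
  shows "(shear \<delta> l *v x) $ i = x $ i + (if i = \<delta> then (\<Sum>k\<in>UNIV. real_of_int (l $ k) * x $ k) else 0)"
proof (cases "i = \<delta>")
  case True
  have "(shear \<delta> l *v x) $ \<delta> = (\<Sum>k\<in>UNIV. (if \<delta> = k then x $ k else 0) + real_of_int (l $ k) * x $ k)"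
    unfolding matrix_vector_mult_def shear_def by (auto simp: assms intro!: sum.cong)
  then show ?thesis using True by (simp add: sum.distrib)
next
  case False
  have "(shear \<delta> l *v x) $ i = (\<Sum>k\<in>UNIV. if i = k then x $ k else 0)"
    unfolding matrix_vector_mult_def shear_def vec_lambda_beta using False by (intro sum.cong) auto
  then show ?thesis using False by simp
qed

text \<open>A shear shifts component \<delta> by a combination of the others, which the second shear
  leaves fixed; so the two shifts cancel.\<close>

lemma shear_mult_neg:
  fixes \<delta> :: "'d::finite"
  assumes "l $ \<delta> = 0"
  shows "shear \<delta> l ** shear \<delta> (- l) = mat 1"
proof -
  have n: "(- l) $ \<delta> = 0" using assms by simp
  have "(shear \<delta> l ** shear \<delta> (- l)) *v x = mat 1 *v x" for x
  proof -
    have "(\<Sum>k\<in>UNIV. real_of_int (l $ k) * (x $ k + (if k = \<delta> then s else 0))) = (\<Sum>k\<in>UNIV. real_of_int (l $ k) * x $ k)" for s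
      using assms by (intro sum.cong) auto
    then show ?thesis
      by (simp add: matrix_vector_mul_assoc[symmetric] vec_eq_iff shear_mult_vector[OF assms] shear_mult_vector[OF n] sum_negf)
  qed
  then show ?thesis by (simp add: matrix_eq)
qed

text \<open>Column \<delta> of a shear is a unit vector. This frequency component therefore feels
  only the dilation, which makes the cut-off in \<open>j\<close> uniform in
  \<open>l\<close>.\<close>

lemma vector_mult_shear: "(y v* shear \<delta> l) $ \<delta> = y $ \<delta>"
  by (simp add: vector_matrix_mult_def shear_def if_distrib[of "\<lambda>x. _ * x"] cong: if_cong)

lemma invertible_dil_shear:
  assumes "l \<in> shear_params \<delta> j"
  shows "invertible (dil_shear \<delta> j l)"
proof -
  have l: "l $ \<delta> = 0" using assms by (simp add: shear_params_def)
  then have "shear \<delta> l ** shear \<delta> (- l) = mat 1" "shear \<delta> (- l) ** shear \<delta> (- (- l)) = mat 1"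
    by (intro shear_mult_neg; simp)+
  then have "invertible (shear \<delta> (- l))" by (auto simp: invertible_def)
  moreover have "invertible (diag_mat (\<lambda>i. 1 / dscale \<delta> j i))"
    using dscale_pos[of \<delta> j] by (simp add: invertible_det_nz det_diag_mat less_imp_neq[THEN not_sym])
  ultimately show ?thesis by (simp add: dil_shear_def matrix_pow_inv_dil invertible_mult)
qed

lemma vector_mult_dil_shear: "(y v* dil_shear \<delta> j l) $ \<delta> = y $ \<delta> / 4 ^ j"
  by (simp add: dil_shear_def matrix_pow_inv_dil vector_matrix_mul_assoc[symmetric] vector_mult_shear
      vector_mult_diag_mat dscale_def)

lemma dil_shear_0: "dil_shear \<delta> j 0 = diag_mat (\<lambda>i. 1 / dscale \<delta> j i)"
proof -
  have "shear \<delta> (0 :: int^'a) = mat 1" by (simp add: shear_def mat_def vec_eq_iff)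
  then show ?thesis by (simp add: dil_shear_def matrix_pow_inv_dil)
qed

lemma zero_in_shear_params: "0 \<in> shear_params \<delta> j"
  by (simp add: shear_params_def)

lemma finite_shear_params: "finite (shear_params (\<delta> :: 'd::finite) j)"
proof -
  have "finite (vec_nth ` shear_params \<delta> j)"
  proof (rule finite_subset)
    show "vec_nth ` shear_params \<delta> j \<subseteq> PiE UNIV (\<lambda>_. {- (2 ^ j)..2 ^ j})"
      by (auto simp: shear_params_def abs_le_iff) (metis minus_le_iff)
    show "finite (PiE (UNIV :: 'd set) (\<lambda>_. {- (2 ^ j)..2 ^ j} :: int set))"
      by (intro finite_PiE) auto
  qed
  then show ?thesis by (rule finite_imageD) (auto simp: inj_on_def vec_eq_iff)
qed

text \<open>One direction contributes 4^j, the d - 1 others 2^j each; the result is the reciprocal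
  of \<open>vol_Q\<close>.\<close>

lemma det_dscale: "det (diag_mat (dscale (\<delta>::'d::finite) j)) = 2 ^ ((CARD('d) + 1) * j)"
proof -
  have "det (diag_mat (dscale \<delta> j)) = dscale \<delta> j \<delta> * (\<Prod>i\<in>UNIV - {\<delta>}. dscale \<delta> j i)"
    unfolding det_diag_mat by (rule prod.remove) auto
  also have "(\<Prod>i\<in>UNIV - {\<delta>}. dscale \<delta> j i) = (2 ^ j) ^ (CARD('d) - 1)"
    by (simp add: dscale_def card_Diff_singleton)
  also have "dscale \<delta> j \<delta> = (2 ^ j) ^ 2"
    by (simp add: dscale_def power2_eq_square power_mult_distrib[symmetric])
  also have "(2 ^ j) ^ 2 * (2 ^ j) ^ (CARD('d) - 1) = ((2::real) ^ j) ^ (2 + (CARD('d) - 1))"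
    by (rule power_add[symmetric])
  also have "2 + (CARD('d) - 1) = CARD('d) + 1" using zero_less_card_finite[where 'a='d] by simp
  finally show ?thesis by (simp only: power_mult[symmetric] mult.commute)
qed

lemma norm_dscale_ge: "2 ^ j * norm x \<le> norm (diag_mat (dscale \<delta> j) *v x)"
proof -
  have "norm ((2::real) ^ j *\<^sub>R x) \<le> norm (diag_mat (dscale \<delta> j) *v x)"
  proof (rule norm_le_componentwise_cart)
    fix i
    have "2 ^ j * \<bar>x $ i\<bar> \<le> dscale \<delta> j i * \<bar>x $ i\<bar>"
      by (intro mult_right_mono dscale_bounds) simp
    then show "norm (((2::real) ^ j *\<^sub>R x) $ i) \<le> norm ((diag_mat (dscale \<delta> j) *v x) $ i)"
      using dscale_pos[of \<delta> j i] by (simp add: abs_mult)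
  qed
  then show ?thesis by simp
qed

section \<open>Homogeneity\<close>

lemma conv_dist_cmult:
  "conv_dist g (dist_of (\<lambda>x. c * f x)) x = c * conv_dist g (dist_of f) x"
  by (simp add: conv_dist_of mult.assoc)

lemma TL_norm_cmult:
  assumes c: "c > 0" and q: "0 < q" and p: "0 < p"
  shows "TL_norm \<phi> \<Phi> \<alpha> q p (dist_of (\<lambda>x. of_real c * f x)) = ennreal c * TL_norm \<phi> \<Phi> \<alpha> q p (dist_of f)"
proof -
  have "ennreal (cmod (conv_dist g (dist_of (\<lambda>x. of_real c * f x)) x)) =
      ennreal c * ennreal (cmod (conv_dist g (dist_of f) x))" for g x
    using c by (simp add: conv_dist_cmult norm_mult ennreal_mult)
  moreover have "ennreal (a * cmod (conv_dist g (dist_of (\<lambda>x. of_real c * f x)) x)) =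
      ennreal c * ennreal (a * cmod (conv_dist g (dist_of f) x))" if "a \<ge> 0" for a g x
    using c that by (simp add: conv_dist_cmult norm_mult ennreal_mult mult.left_commute)
  ultimately show ?thesis
    using c q p by (simp add: TL_norm_def lq_norm_cmult Lp_norm_cmult distrib_left)
qed

lemma shear_TL_norm_cmult:
  assumes c: "c > 0" and q: "0 < q" and p: "0 < p"
  shows "shear_TL_norm h1 h2 H \<alpha> q p (dist_of (\<lambda>x. of_real c * f x)) =
    ennreal c * shear_TL_norm h1 h2 H \<alpha> q p (dist_of f)"
proof -
  have "ennreal (cmod (conv_dist g (dist_of (\<lambda>x. of_real c * f x)) x)) =
      ennreal c * ennreal (cmod (conv_dist g (dist_of f) x))" for g x
    using c by (simp add: conv_dist_cmult norm_mult ennreal_mult)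
  moreover have "ennreal (a * cmod (conv_dist g (dist_of (\<lambda>x. of_real c * f x)) x)) =
      ennreal c * ennreal (a * cmod (conv_dist g (dist_of f) x))" if "a \<ge> 0" for a g x
    using c that by (simp add: conv_dist_cmult norm_mult ennreal_mult mult.left_commute)
  ultimately show ?thesis
    using c q p by (simp add: shear_TL_norm_def case_prod_unfold lq_norm_cmult Lp_norm_cmult distrib_left)
qed

section \<open>The base function and its dilates\<close>

locale shear_setting =
  fixes \<phi> \<Phi> H :: "real^'d \<Rightarrow> complex" and h1 h2 :: "real \<Rightarrow> complex" and \<delta> :: 'd
  assumes iso: "isotropic_system \<phi> \<Phi>" and gen: "shear_generators h1 h2" and low: "shear_low_pass h1 h2 H"
begin

abbreviation psi :: "'d \<Rightarrow> real^'d \<Rightarrow> complex" where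
  "psi \<delta>' \<equiv> inv_fourier (psi_hat h1 h2 \<delta>')"

text \<open>Fourier inversion is avoided: \<open>kern\<close> and \<open>base\<close> are convolutions with \<open>\<Phi>\<close>, so that
  both a representation by \<^const>\<open>inv_fourier\<close> and the support of its Fourier transform are
  available.\<close>

definition kern :: "real^'d \<Rightarrow> complex" where
  "kern = conv_dist (tilde (psi \<delta>)) (dist_of \<Phi>)"

definition base :: "real^'d \<Rightarrow> complex" where
  "base = conv_dist (tilde kern) (dist_of \<Phi>)"

text \<open>The symbol of which \<open>base\<close> is the inverse transform, by
  \<open>base_eq\<close>; it is not claimed to equal \<open>fourier base\<close>.\<close>

definition base_hat :: "real^'d \<Rightarrow> complex" where
  "base_hat \<xi> = psi_hat h1 h2 \<delta> \<xi> * cnj (fourier \<Phi> \<xi>) * fourier \<Phi> \<xi>"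

definition response :: "real^'d \<Rightarrow> complex" where
  "response = conv_dist (tilde (psi \<delta>)) (dist_of base)"

definition dilate :: "nat \<Rightarrow> real^'d \<Rightarrow> complex" where
  "dilate J x = base (diag_mat (dscale \<delta> J) *v x)"

lemma rapid_Phi: "rapid \<Phi>" and rapid_phi: "rapid \<phi>"
  using iso by (auto simp: isotropic_system_def intro: schwartz_rapid)

lemma rapid_psi: "rapid (psi \<delta>')"
  by (rule rapid_inv_fourier[OF Ck_psi_hat[OF gen] psi_hat_eq_0[OF gen]])

lemma rapid_low_pass: "rapid (inv_fourier H)"
proof (rule rapid_inv_fourier)
  show "Ck n UNIV H" for n using low by (auto simp: shear_low_pass_def intro: smooth_Ck)
  fix \<xi> :: "real^'d" assume n: "real CARD('d) < norm \<xi>"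
  show "H \<xi> = 0"
  proof (rule ccontr)
    assume "H \<xi> \<noteq> 0"
    then have "\<xi> \<in> supp H" using not_in_supp by metis
    then have b: "\<bar>\<xi> $ i\<bar> \<le> 1 / 4" for i using low by (auto simp: shear_low_pass_def)
    have "norm \<xi> \<le> (\<Sum>i\<in>UNIV. \<bar>\<xi> $ i\<bar>)" by (rule norm_le_l1_cart)
    also have "\<dots> \<le> (\<Sum>i\<in>(UNIV::'d set). 1 / 4)" by (intro sum_mono b)
    also have "\<dots> \<le> real CARD('d)" by simp
    finally show False using n by simp
  qed
qed

lemma fourier_Phi_eq_0: "2 < norm \<xi> \<Longrightarrow> fourier \<Phi> \<xi> = 0"
  using iso by (intro not_in_supp) (auto simp: isotropic_system_def)

lemma fourier_phi_nonzeroD: "fourier \<phi> \<xi> \<noteq> 0 \<Longrightarrow> 1 / 2 \<le> norm \<xi> \<and> norm \<xi> \<le> 2"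
  using iso not_in_supp[of \<xi> "fourier \<phi>"] by (auto simp: isotropic_system_def)

lemma continuous_fourier_Phi: "continuous_on UNIV (fourier \<Phi>)"
  by (rule continuous_fourier[OF rapid_integrable[OF rapid_Phi]])

lemma continuous_psi_hat: "continuous_on UNIV (psi_hat h1 h2 \<delta>')"
  using Ck_continuous[OF Ck_psi_hat[OF gen, of 0]] .

lemma tilde_psi: "tilde (psi \<delta>') = inv_fourier (\<lambda>\<xi>. cnj (psi_hat h1 h2 \<delta>' \<xi>))"
  by (rule tilde_inv_fourier)

lemma integrable_cnj_psi_hat:
  fixes \<delta>' :: 'd
  shows "integrable lborel (\<lambda>\<xi>. cnj (psi_hat h1 h2 \<delta>' \<xi>))"
  by (rule integrable_continuous_bounded_support[where R = "real CARD('d)"])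
    (auto intro!: continuous_on_cnj continuous_psi_hat simp: psi_hat_eq_0[OF gen])

lemma kern_eq: "kern = inv_fourier (\<lambda>\<xi>. cnj (psi_hat h1 h2 \<delta> \<xi>) * fourier \<Phi> \<xi>)"
  unfolding kern_def tilde_psi by (rule conv_inv_fourier[OF integrable_cnj_psi_hat rapid_integrable[OF rapid_Phi]])

lemma continuous_kern_hat: "continuous_on UNIV (\<lambda>\<xi>. cnj (psi_hat h1 h2 \<delta> \<xi>) * fourier \<Phi> \<xi>)"
  by (intro continuous_on_mult continuous_on_cnj continuous_psi_hat continuous_fourier_Phi)

lemma integrable_kern_hat: "integrable lborel (\<lambda>\<xi>. cnj (psi_hat h1 h2 \<delta> \<xi>) * fourier \<Phi> \<xi>)"
  by (rule integrable_continuous_bounded_support[OF continuous_kern_hat, of "real CARD('d)"])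
    (simp add: psi_hat_eq_0[OF gen])

lemma continuous_base_hat: "continuous_on UNIV base_hat"
  unfolding base_hat_def[abs_def]
  by (intro continuous_on_mult continuous_on_cnj continuous_psi_hat continuous_fourier_Phi)

lemma base_eq: "base = inv_fourier base_hat"
proof -
  have t: "tilde kern = inv_fourier (\<lambda>\<xi>. cnj (cnj (psi_hat h1 h2 \<delta> \<xi>) * fourier \<Phi> \<xi>))"
    unfolding kern_eq by (rule tilde_inv_fourier)
  have "base = inv_fourier (\<lambda>\<xi>. cnj (cnj (psi_hat h1 h2 \<delta> \<xi>) * fourier \<Phi> \<xi>) * fourier \<Phi> \<xi>)"
    unfolding base_def t
    by (rule conv_inv_fourier[OF integrable_cnj[OF integrable_kern_hat] rapid_integrable[OF rapid_Phi]])
  also have "(\<lambda>\<xi>. cnj (cnj (psi_hat h1 h2 \<delta> \<xi>) * fourier \<Phi> \<xi>) * fourier \<Phi> \<xi>) = base_hat"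
    by (simp add: base_hat_def fun_eq_iff)
  finally show ?thesis .
qed

lemma base_hat_nonzeroD:
  assumes "base_hat \<xi> \<noteq> 0"
  shows "1 / 16 \<le> \<bar>\<xi> $ \<delta>\<bar>" "\<bar>\<xi> $ i\<bar> \<le> 1 / 2"
  using psi_hat_nonzeroD[OF gen, of \<delta> \<xi>] assms by (auto simp: base_hat_def)

lemma rapid_kern: "rapid kern"
  unfolding kern_def by (intro rapid_conv rapid_tilde rapid_psi rapid_Phi)

lemma rapid_base: "rapid base"
  unfolding base_def by (intro rapid_conv rapid_tilde rapid_kern rapid_Phi)

lemma rapid_response: "rapid response"
  unfolding response_def by (intro rapid_conv rapid_tilde rapid_psi rapid_base)

lemma fourier_base: "fourier base \<xi> = fourier (tilde kern) \<xi> * fourier \<Phi> \<xi>"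
  unfolding base_def by (intro fourier_conv rapid_integrable rapid_tilde rapid_kern rapid_Phi)

text \<open>By \<open>fourier_base\<close> the factor \<open>fourier \<Phi>\<close> can be moved
  from the transform of \<open>base\<close> to the symbol of \<open>psi\<close>, which becomes that
  of \<open>kern\<close>. The response is thus an autocorrelation.\<close>

lemma response_eq: "response = conv_dist kern (dist_of (tilde kern))"
proof -
  have "response = inv_fourier (\<lambda>\<xi>. cnj (psi_hat h1 h2 \<delta> \<xi>) * fourier base \<xi>)"
    unfolding response_def tilde_psi
    by (rule conv_inv_fourier[OF integrable_cnj_psi_hat rapid_integrable[OF rapid_base]])
  also have "\<dots> = inv_fourier (\<lambda>\<xi>. cnj (psi_hat h1 h2 \<delta> \<xi>) * fourier \<Phi> \<xi> * fourier (tilde kern) \<xi>)"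
    by (simp add: fourier_base mult_ac)
  also have "\<dots> = conv_dist kern (dist_of (tilde kern))"
    unfolding kern_eq[symmetric]
    by (subst (2) kern_eq, rule conv_inv_fourier[symmetric, OF integrable_kern_hat rapid_integrable[OF rapid_tilde[OF rapid_kern]]])
  finally show ?thesis .
qed

lemma continuous_kern: "continuous_on UNIV kern"
  unfolding kern_eq by (rule continuous_inv_fourier[OF integrable_kern_hat])

lemma continuous_response: "continuous_on UNIV response"
proof -
  have "response = inv_fourier (\<lambda>\<xi>. cnj (psi_hat h1 h2 \<delta> \<xi>) * fourier base \<xi>)"
    unfolding response_def tilde_psi
    by (rule conv_inv_fourier[OF integrable_cnj_psi_hat rapid_integrable[OF rapid_base]])
  moreover have "integrable lborel (\<lambda>\<xi>. cnj (psi_hat h1 h2 \<delta> \<xi>) * fourier base \<xi>)"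
    by (rule integrable_continuous_bounded_support[where R = "real CARD('d)"])
      (auto intro!: continuous_on_mult continuous_on_cnj continuous_psi_hat continuous_fourier rapid_integrable rapid_base
        simp: psi_hat_eq_0[OF gen])
  ultimately show ?thesis by (simp add: continuous_inv_fourier)
qed

text \<open>A witness on the axis \<delta>, where all quotients are 0. Continuity and support force
  \<open>h2\<close> to vanish at 1 and -1, so its partition identity at 0 gives \<open>h2 0\<close>
  \<noteq> 0. The identity for \<open>h1\<close> at 1/8 provides a point below 1/8, well inside the
  ball where \<open>fourier \<Phi>\<close> has no zero.\<close>

lemma kern_hat_nonzero: "\<exists>\<xi>. cnj (psi_hat h1 h2 \<delta> \<xi>) * fourier \<Phi> \<xi> \<noteq> 0"
proof -
  have c2: "continuous_on UNIV h2" and s2: "supp h2 \<subseteq> {-1..1}"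
    using gen by (auto simp: shear_generators_def intro: smooth_continuous)
  have out: "h2 \<omega> = 0" if "\<omega> \<in> {..< -1} \<union> {1<..}" for \<omega>
    using that s2 by (intro not_in_supp) auto
  have "h2 1 = 0"
    using continuous_constant_on_closure[of "{1<..}" h2 0 1] c2 out
    by (auto simp: closure_greaterThan intro: continuous_on_subset)
  moreover have "h2 (- 1) = 0"
    using continuous_constant_on_closure[of "{..< -1}" h2 0 "- 1"] c2 out
    by (auto simp: closure_lessThan intro: continuous_on_subset)
  moreover have "(cmod (h2 (0 - 1)))\<^sup>2 + (cmod (h2 0))\<^sup>2 + (cmod (h2 (0 + 1)))\<^sup>2 = 1"
    using gen unfolding shear_generators_def by (metis abs_zero zero_le_one)
  ultimately have h20: "h2 0 \<noteq> 0" by auto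
  have "(\<lambda>j. (cmod (h1 (1/8 / 2 ^ (2 * j))))\<^sup>2) sums 1"
    using gen unfolding shear_generators_def by (metis abs_of_pos order_refl zero_less_divide_1_iff zero_less_numeral)
  then obtain j where j: "h1 (1/8 / 2 ^ (2 * j)) \<noteq> 0"
    by (metis (mono_tags, lifting) norm_zero power_zero_numeral sums_0 sums_unique2 zero_neq_one)
  define \<omega> :: real where "\<omega> = 1/8 / 2 ^ (2 * j)"
  have "\<omega> \<le> 1/8 / 1" unfolding \<omega>_def by (rule divide_left_mono) auto
  then have "\<omega> \<le> 1" by linarith
  moreover have "0 < \<omega>" unfolding \<omega>_def by simp
  ultimately have w: "0 < \<omega>" "\<omega> \<le> 1" by auto
  define \<xi> :: "real^'d" where "\<xi> = axis \<delta> \<omega>"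
  have "psi_hat h1 h2 \<delta> \<xi> = h1 \<omega> * (\<Prod>i\<in>UNIV - {\<delta>}. h2 0)"
    unfolding psi_hat_def \<xi>_def by (auto simp: axis_def intro!: prod.cong)
  then have "psi_hat h1 h2 \<delta> \<xi> \<noteq> 0" using j h20 by (simp add: \<omega>_def)
  moreover have "norm \<xi> \<le> (\<Sum>i\<in>UNIV. \<bar>\<xi> $ i\<bar>)" by (rule norm_le_l1_cart)
  then have "norm \<xi> \<le> \<omega>" using w by (simp add: \<xi>_def axis_def if_distrib[of abs] cong: if_cong)
  then have "norm \<xi> \<le> 5 / 3" using w by simp
  then have "fourier \<Phi> \<xi> \<noteq> 0" using iso by (force simp: isotropic_system_def)
  ultimately show ?thesis by auto
qed

text \<open>As an autocorrelation at 0, this is the squared L^2 norm of \<open>kern\<close>. If it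
  vanished, so would \<open>kern\<close>, and by injectivity also its symbol.\<close>

lemma response_0_nonzero: "response 0 \<noteq> 0"
proof
  assume "response 0 = 0"
  then have 0: "(LINT y|lborel. cnj (kern (- y)) * kern (- y)) = 0"
    by (simp add: response_eq conv_dist_of tilde_def)
  have "cnj z * z = of_real ((cmod z)\<^sup>2)" for z
    by (rule trans[OF mult.commute complex_norm_square[symmetric]])
  with 0 have "(LINT y|lborel. complex_of_real ((cmod (kern (- y)))\<^sup>2)) = 0" by (simp only:)
  then have "complex_of_real (LINT y|lborel. (cmod (kern (- y)))\<^sup>2) = 0"
    by (simp only: integral_complex_of_real)
  then have "(LINT y|lborel. (cmod (kern (- y)))\<^sup>2) = 0"
    by (rule of_real_eq_0_iff[THEN iffD1])
  then have z: "(LINT y|lborel. (cmod (kern y))\<^sup>2) = 0"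
    using integral_reflect[of "\<lambda>y. (cmod (kern y))\<^sup>2" 0] by simp
  obtain C where C: "C > 0" "\<And>x. (1 + norm x) ^ 0 * cmod (kern x) \<le> C" using rapidE[OF rapid_kern] by metis
  have "integrable lborel (\<lambda>y. (cmod (kern y))\<^sup>2)"
  proof (rule Bochner_Integration.integrable_bound)
    show "integrable lborel (\<lambda>y. C * cmod (kern y))"
      using rapid_integrable[OF rapid_kern] by simp
    show "(\<lambda>y. (cmod (kern y))\<^sup>2) \<in> borel_measurable lborel"
      using rapid_measurable[OF rapid_kern] by simp
    show "AE y in lborel. norm ((cmod (kern y))\<^sup>2) \<le> norm (C * cmod (kern y))"
    proof (rule AE_I2)
      fix y
      have "cmod (kern y) * cmod (kern y) \<le> C * cmod (kern y)"
        using C(2)[of y] by (intro mult_right_mono) simp_all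
      then show "norm ((cmod (kern y))\<^sup>2) \<le> norm (C * cmod (kern y))"
        using C(1) by (simp add: power2_eq_square)
    qed
  qed
  with z have "AE y in lborel. (cmod (kern y))\<^sup>2 = 0" by (subst (asm) integral_nonneg_eq_0_iff_AE) auto
  then have "AE y in lborel. kern y = 0" by simp
  then have "kern y = 0" for y by (rule continuous_AE_eq_0[OF continuous_kern])
  then have 0: "inv_fourier (\<lambda>\<xi>. cnj (psi_hat h1 h2 \<delta> \<xi>) * fourier \<Phi> \<xi>) y = 0" for y
    unfolding kern_eq .
  have "cnj (psi_hat h1 h2 \<delta> \<xi>) * fourier \<Phi> \<xi> = 0" for \<xi>
  proof (rule inv_fourier_injective[OF continuous_kern_hat _ 0])
    show "cnj (psi_hat h1 h2 \<delta> \<xi>) * fourier \<Phi> \<xi> = 0" if "real CARD('d) < norm \<xi>" for \<xi>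
      using psi_hat_eq_0[OF gen that, of \<delta>] by simp
  qed
  with kern_hat_nonzero show False by blast
qed

section \<open>Frequency localization of the dilates\<close>

lemma rapid_dilate: "rapid (dilate J)"
proof -
  have "invertible (diag_mat (dscale \<delta> J))"
    using dscale_pos[of \<delta> J] by (simp add: invertible_det_nz det_diag_mat less_imp_neq[THEN not_sym])
  from rapid_matrix[OF rapid_base this, of 1] show ?thesis by (simp add: dilate_def[abs_def])
qed

lemma dscale_nz: "dscale \<delta> J i \<noteq> 0"
  using dscale_pos[of \<delta> J i] by simp

text \<open>The constant 2 is the support radius of \<open>fourier \<Phi>\<close>, a factor of
  \<open>fourier base\<close>; the dilation stretches it by at most 4^J.\<close>

lemma fourier_dilate_nonzeroD:
  assumes "fourier (dilate J) \<xi> \<noteq> 0"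
  shows "\<bar>\<xi> $ i\<bar> \<le> 2 * 4 ^ J"
proof -
  let ?\<eta> = "diag_mat (\<lambda>i. 1 / dscale \<delta> J i) *v \<xi>"
  have "fourier base ?\<eta> \<noteq> 0"
    using assms fourier_diag[of "dscale \<delta> J", OF dscale_nz rapid_measurable[OF rapid_base]]
    by (auto simp: dilate_def[abs_def])
  then have "norm ?\<eta> \<le> 2" using fourier_Phi_eq_0[of ?\<eta>] by (auto simp: fourier_base not_less[symmetric])
  then have "\<bar>?\<eta> $ i\<bar> \<le> 2" using component_le_norm_cart order_trans by blast
  then have "\<bar>\<xi> $ i\<bar> \<le> 2 * dscale \<delta> J i"
    using dscale_pos[of \<delta> J i] by (simp add: abs_mult abs_divide divide_le_eq)
  also have "\<dots> \<le> 2 * 4 ^ J" using dscale_bounds(2)[of \<delta> J i] by simp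
  finally show ?thesis .
qed

lemma dilate_eq: "dilate J = inv_fourier (\<lambda>\<xi>. of_real \<bar>det (diag_mat (\<lambda>i. 1 / dscale \<delta> J i))\<bar> *
    base_hat (diag_mat (\<lambda>i. 1 / dscale \<delta> J i) *v \<xi>))"
  unfolding dilate_def[abs_def] base_eq
  by (rule ext, rule inv_fourier_diag) (simp_all add: dscale_nz borel_measurable_continuous_onI continuous_base_hat)

lemma integrable_dilate_hat:
  "integrable lborel (\<lambda>\<xi>. of_real \<bar>det (diag_mat (\<lambda>i. 1 / dscale \<delta> J i))\<bar> *
    base_hat (diag_mat (\<lambda>i. 1 / dscale \<delta> J i) *v \<xi>))"
proof (intro integrable_mult_right integrable_diag_substitution)
  show "integrable lborel base_hat"
    by (rule integrable_continuous_bounded_support[OF continuous_base_hat, of "real CARD('d)"])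
      (simp add: base_hat_def psi_hat_eq_0[OF gen])
qed (simp add: dscale_nz)

text \<open>A common linear substitution in both factors passes through the convolution; the
  determinant in \<open>mat_dilate\<close> is the Jacobian.\<close>

lemma shear_coefficient_main:
  "conv_dist (mat_dilate (dil_shear \<delta> J 0) (tilde (psi \<delta>))) (dist_of (dilate J)) x =
    response (diag_mat (dscale \<delta> J) *v x)"
proof -
  let ?E = "diag_mat (dscale \<delta> J)" and ?M = "diag_mat (\<lambda>i. 1 / dscale \<delta> J i)"
  let ?g = "tilde (psi \<delta>)"
  have [measurable]: "?g \<in> borel_measurable borel" "base \<in> borel_measurable borel"
    by (intro rapid_measurable rapid_tilde rapid_psi rapid_base)+
  have ME: "?M ** ?E = mat 1" by (simp add: diag_mat_mult diag_mat_1[symmetric] dscale_nz)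
  then have inv: "matrix_inv ?M = ?E" by (rule matrix_inv_eqI)
  have "det ?M * det ?E = 1" using ME by (metis det_I det_mul)
  then have dt: "inverse \<bar>det ?M\<bar> = \<bar>det ?E\<bar>" by (metis abs_mult abs_one inverse_unique)
  have "response (?E *v x) = (LINT z|lborel. base z * ?g (?E *v x - z))"
    by (simp add: response_def conv_dist_of)
  also have "\<dots> = of_real \<bar>det ?E\<bar> * (LINT y|lborel. base (?E *v y) * ?g (?E *v x - ?E *v y))"
    by (rule integral_diag_substitution) (simp_all add: dscale_nz)
  also have "\<dots> = (LINT y|lborel. dilate J y * (of_real \<bar>det ?E\<bar> * ?g (?E *v (x - y))))"
    by (simp add: dilate_def matrix_vector_mult_diff_distrib mult.left_commute[of _ "of_real \<bar>det ?E\<bar>"])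
  also have "\<dots> = conv_dist (mat_dilate (dil_shear \<delta> J 0) ?g) (dist_of (dilate J)) x"
    by (simp add: conv_dist_of mat_dilate_def dil_shear_0 inv dt)
  finally show ?thesis by simp
qed

text \<open>In component \<open>\<delta>'\<close>, the shearlet needs frequencies of at least
  4^j/16, whereas \<open>dilate J\<close> reaches only 2 * 4^J. As 32 < 64 = 4^3, the offset 3
  separates them, for every direction and every shear.\<close>

lemma shear_coefficient_eq_0:
  assumes j: "j \<ge> J + 3" and l: "l \<in> shear_params \<delta>' j"
  shows "conv_dist (mat_dilate (dil_shear \<delta>' j l) (tilde (psi \<delta>'))) (dist_of (dilate J)) x = 0"
proof -
  let ?M = "dil_shear \<delta>' j l"
  let ?k = "\<lambda>\<xi>. cnj (psi_hat h1 h2 \<delta>' \<xi>)"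
  define a where "a = complex_of_real (inverse \<bar>det ?M\<bar>)"
  have "conv_dist (mat_dilate ?M (tilde (psi \<delta>'))) (dist_of (dilate J)) x =
      a * conv_dist (\<lambda>x. inv_fourier ?k (matrix_inv ?M *v x)) (dist_of (dilate J)) x"
    unfolding conv_dist_of mat_dilate_def a_def[symmetric] tilde_psi
    by (simp only: mult.left_commute[of _ a] integral_mult_right_zero)
  also have "conv_dist (\<lambda>x. inv_fourier ?k (matrix_inv ?M *v x)) (dist_of (dilate J)) x =
      (LINT \<xi>|lborel. ?k \<xi> * fourier (dilate J) (\<xi> v* matrix_inv ?M) * cis (2 * pi * (\<xi> \<bullet> (matrix_inv ?M *v x))))"
    by (rule conv_inv_fourier_matrix[OF integrable_cnj_psi_hat rapid_integrable[OF rapid_dilate]])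
  also have "\<dots> = (LINT \<xi>|(lborel :: (real^'d) measure). 0)"
  proof (intro Bochner_Integration.integral_cong refl)
    fix \<xi> :: "real^'d"
    have "fourier (dilate J) (\<xi> v* matrix_inv ?M) = 0" if nz: "psi_hat h1 h2 \<delta>' \<xi> \<noteq> 0"
    proof (rule ccontr)
      let ?\<eta> = "\<xi> v* matrix_inv ?M"
      assume "fourier (dilate J) ?\<eta> \<noteq> 0"
      then have "\<bar>?\<eta> $ \<delta>'\<bar> \<le> 2 * 4 ^ J" by (rule fourier_dilate_nonzeroD)
      moreover have "?\<eta> v* ?M = \<xi>" by (rule invertible_inverse_mult(2)[OF invertible_dil_shear[OF l]])
      then have "\<xi> $ \<delta>' = ?\<eta> $ \<delta>' / 4 ^ j" by (metis vector_mult_dil_shear)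
      then have "\<bar>\<xi> $ \<delta>'\<bar> * 4 ^ j = \<bar>?\<eta> $ \<delta>'\<bar>" by (simp add: abs_divide)
      moreover have "1 / 16 * 4 ^ j \<le> \<bar>\<xi> $ \<delta>'\<bar> * 4 ^ j"
        by (intro mult_right_mono psi_hat_nonzeroD(1)[OF gen nz]) simp
      ultimately have "(4::real) ^ j \<le> 32 * 4 ^ J" by simp
      moreover have "(4::real) ^ (J + 3) \<le> 4 ^ j" using j by (intro power_increasing) auto
      moreover have "(0::real) < 4 ^ J" by simp
      ultimately show False unfolding power_add by simp
    qed
    then show "?k \<xi> * fourier (dilate J) (\<xi> v* matrix_inv ?M) * cis (2 * pi * (\<xi> \<bullet> (matrix_inv ?M *v x))) = 0"
      by (cases "psi_hat h1 h2 \<delta>' \<xi> = 0") auto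
  qed
  finally show ?thesis by simp
qed

text \<open>Here \<open>dilate J\<close> is the factor written as \<open>inv_fourier\<close>: its
  symbol inherits from \<open>psi_hat\<close> the lower frequency bound that the factor
  \<open>fourier \<Phi>\<close> cannot give.\<close>

lemma conv_dilate_eq_0:
  assumes g: "rapid g" and 0: "\<And>\<xi>. base_hat (diag_mat (\<lambda>i. 1 / dscale \<delta> J i) *v \<xi>) \<noteq> 0 \<Longrightarrow> fourier g \<xi> = 0"
  shows "conv_dist g (dist_of (dilate J)) x = 0"
proof -
  have "conv_dist g (dist_of (dilate J)) x = conv_dist (dilate J) (dist_of g) x"
    by (rule trans[OF conv_commute conv_dist_of[symmetric]])
  also have "\<dots> = inv_fourier (\<lambda>\<xi>. of_real \<bar>det (diag_mat (\<lambda>i. 1 / dscale \<delta> J i))\<bar> *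
    base_hat (diag_mat (\<lambda>i. 1 / dscale \<delta> J i) *v \<xi>) * fourier g \<xi>) x"
    by (subst dilate_eq, subst conv_inv_fourier[OF integrable_dilate_hat rapid_integrable[OF g]]) (rule refl)
  also have "(\<lambda>\<xi>. of_real \<bar>det (diag_mat (\<lambda>i. 1 / dscale \<delta> J i))\<bar> *
    base_hat (diag_mat (\<lambda>i. 1 / dscale \<delta> J i) *v \<xi>) * fourier g \<xi>) = (\<lambda>_. 0)"
    using 0 by (intro ext) (metis mult_zero_left mult_zero_right)
  finally show ?thesis by (simp add: inv_fourier_def)
qed

text \<open>Component \<delta> stays away from 0 and receives the full stretch 4^J, which no
  component exceeds; so the isotropic frequency is comparable to 4^J.\<close>

lemma dilate_hat_support:
  assumes "base_hat (diag_mat (\<lambda>i. 1 / dscale \<delta> J i) *v \<xi>) \<noteq> 0"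
  shows "4 ^ J / 16 \<le> norm \<xi>" "norm \<xi> \<le> real CARD('d) * 4 ^ J / 2"
proof -
  let ?\<eta> = "diag_mat (\<lambda>i. 1 / dscale \<delta> J i) *v \<xi>"
  have "1 / 16 \<le> \<bar>?\<eta> $ \<delta>\<bar>" by (rule base_hat_nonzeroD(1)[OF assms])
  then have "1 / 16 \<le> \<bar>\<xi> $ \<delta>\<bar> / 4 ^ J" by (simp add: dscale_def abs_divide abs_mult)
  then have "4 ^ J / 16 \<le> \<bar>\<xi> $ \<delta>\<bar>" by (simp add: field_simps)
  then show "4 ^ J / 16 \<le> norm \<xi>" using component_le_norm_cart order_trans by blast
  have c: "\<bar>\<xi> $ i\<bar> \<le> 4 ^ J / 2" for i
  proof -
    have "\<bar>?\<eta> $ i\<bar> \<le> 1 / 2" by (rule base_hat_nonzeroD(2)[OF assms])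
    then have "\<bar>\<xi> $ i\<bar> \<le> 1 / 2 * dscale \<delta> J i"
      using dscale_pos[of \<delta> J i] by (simp add: abs_mult abs_divide divide_le_eq)
    also have "\<dots> \<le> 4 ^ J / 2" using dscale_bounds(2)[of \<delta> J i] by simp
    finally show ?thesis .
  qed
  have "norm \<xi> \<le> (\<Sum>i\<in>UNIV. \<bar>\<xi> $ i\<bar>)" by (rule norm_le_l1_cart)
  also have "\<dots> \<le> (\<Sum>i\<in>(UNIV::'d set). 4 ^ J / 2)" by (intro sum_mono c)
  finally show "norm \<xi> \<le> real CARD('d) * 4 ^ J / 2" by simp
qed

end

section \<open>Norm estimates\<close>

lemma exists_decay_exponent:
  assumes "p > 0"
  obtains N :: nat where "real N * p \<ge> D"
proof -
  obtain N :: nat where "D / p \<le> real N" using real_arch_simple by blast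
  then show ?thesis using that assms by (simp add: divide_le_eq)
qed

text \<open>Purely qualitative: the decay constants of the finitely many nonzero members are added
  up.\<close>

lemma Lp_lq_norm_finite:
  fixes g :: "'i \<Rightarrow> 'a::euclidean_space \<Rightarrow> complex"
  assumes p: "p > 0" and q: "q > 0" and F: "finite F"
    and g: "\<And>i. i \<in> F \<Longrightarrow> rapid (g i)" and z: "\<And>i x. i \<in> I \<Longrightarrow> i \<notin> F \<Longrightarrow> g i x = 0"
  shows "Lp_norm p (\<lambda>x. lq_norm q I (\<lambda>i. ennreal (cmod (g i x)))) < \<infinity>"
proof -
  obtain N where N: "real N * p \<ge> real (DIM('a) + 2)" by (rule exists_decay_exponent[OF p])
  have "\<exists>C>0. \<forall>x. (1 + norm x) ^ N * cmod (g i x) \<le> C" if "i \<in> F" for i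
    using rapidE[OF g[OF that], of N] by metis
  then obtain C where C: "\<And>i. i \<in> F \<Longrightarrow> C i > 0" "\<And>i x. i \<in> F \<Longrightarrow> (1 + norm x) ^ N * cmod (g i x) \<le> C i"
    by metis
  define T where "T = (\<Sum>i\<in>F. C i)"
  have T: "T \<ge> 0" unfolding T_def by (intro sum_nonneg) (simp add: C(1) less_imp_le)
  have bound: "cmod (g i x) \<le> T / (1 + 1 * norm x) ^ N" if "i \<in> I" for i x
  proof (cases "i \<in> F")
    case True
    have "(1 + norm x) ^ N * cmod (g i x) \<le> C i" by (rule C(2)[OF True])
    also have "C i \<le> T" unfolding T_def using True F C(1) by (intro member_le_sum) (auto simp: less_imp_le)
    finally have "cmod (g i x) * (1 + norm x) ^ N \<le> T" by (simp add: mult.commute)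
    moreover have "0 < (1 + norm x) ^ N" by (simp add: add_pos_nonneg)
    ultimately show ?thesis by (simp add: pos_le_divide_eq)
  next
    case False
    then show ?thesis using z[OF that False] T by simp
  qed
  have "lq_norm q I (\<lambda>i. ennreal (cmod (g i x))) \<le> ennreal (lq_const q (card F) * T / (1 + 1 * norm x) ^ N)" for x
  proof -
    have "lq_norm q I (\<lambda>i. ennreal (cmod (g i x))) \<le> ennreal (lq_const q (card F) * (T / (1 + 1 * norm x) ^ N))"
      using T by (intro lq_norm_le[OF q F order_refl]) (auto simp: z intro!: ennreal_leI bound[simplified])
    then show ?thesis by simp
  qed
  then have "Lp_norm p (\<lambda>x. lq_norm q I (\<lambda>i. ennreal (cmod (g i x)))) \<le>
      ennreal (lq_const q (card F) * T * 1 powr (- real DIM('a) / p) * decay_const TYPE('a) p N)"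
    using T by (intro Lp_norm_decay[OF p N]) (auto simp: lq_const_nonneg)
  then show ?thesis by (rule le_less_trans) simp
qed

lemma rapid_Lp_norm_finite:
  assumes "p > 0" "rapid g"
  shows "Lp_norm p (\<lambda>x. ennreal (cmod (g x))) < \<infinity>"
proof -
  have "Lp_norm p (\<lambda>x. ennreal (cmod (g x))) \<le> Lp_norm p (\<lambda>x. lq_norm 1 {()} (\<lambda>_. ennreal (cmod (g x))))"
    by (intro Lp_norm_mono lq_norm_ge assms) auto
  also have "\<dots> < \<infinity>" using assms by (intro Lp_lq_norm_finite[where F = "{()}"]) auto
  finally show ?thesis .
qed

lemma iso_dilate_diag: "iso_dilate \<nu> \<phi> x = of_real (2 ^ (CARD('d) * \<nu>)) * \<phi> (diag_mat (\<lambda>_. 2 ^ \<nu>) *v (x :: real^'d))"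
proof -
  have "diag_mat (\<lambda>_. 2 ^ \<nu>) *v x = 2 ^ \<nu> *\<^sub>R x" by (simp add: vec_eq_iff)
  then show ?thesis by (simp add: iso_dilate_def)
qed

lemma det_diag_const: "det (diag_mat (\<lambda>_::'d::finite. 2 ^ \<nu>)) = 2 ^ (CARD('d) * \<nu>)"
  by (simp add: det_diag_mat power_mult[symmetric] mult.commute)

lemma rapid_iso_dilate:
  fixes \<phi> :: "real^'d \<Rightarrow> complex"
  assumes "rapid \<phi>"
  shows "rapid (iso_dilate \<nu> \<phi>)"
proof -
  have "invertible (diag_mat (\<lambda>_::'d. 2 ^ \<nu>))" by (simp add: invertible_det_nz det_diag_const)
  from rapid_matrix[OF assms this] show ?thesis by (simp add: iso_dilate_diag[abs_def])
qed

text \<open>The dilation preserves L^1 norms, and the weight is rescaled with it, so the integral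
  does not depend on \<nu>.\<close>

lemma iso_dilate_weighted:
  fixes \<phi> :: "real^'d \<Rightarrow> complex"
  assumes \<phi>: "rapid \<phi>"
  shows "integrable lborel (\<lambda>z. (1 + 2 ^ \<nu> * norm z) ^ N * cmod (iso_dilate \<nu> \<phi> z))"
    and "(LINT z|lborel. (1 + 2 ^ \<nu> * norm z) ^ N * cmod (iso_dilate \<nu> \<phi> z)) =
      (LINT w|lborel. (1 + norm w) ^ N * cmod (\<phi> w))"
proof -
  let ?D = "diag_mat (\<lambda>_::'d. 2 ^ \<nu>)"
  let ?a = "2 ^ (CARD('d) * \<nu>) :: real"
  have [measurable]: "\<phi> \<in> borel_measurable borel" using \<phi> by (rule rapid_measurable)
  have D: "?D *v z = 2 ^ \<nu> *\<^sub>R z" for z by (simp add: vec_eq_iff)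
  \<comment> \<open>Complex-valued, to match the substitution lemmas.\<close>
  define G where "G w = complex_of_real ((1 + norm w) ^ N * cmod (\<phi> w))" for w
  have eq: "complex_of_real ((1 + 2 ^ \<nu> * norm z) ^ N * cmod (iso_dilate \<nu> \<phi> z)) = of_real ?a * G (?D *v z)" for z
    by (simp add: G_def iso_dilate_def D norm_mult norm_power)
  have iG: "integrable lborel G"
    unfolding G_def by (intro integrable_of_real rapid_integrable_weighted \<phi>)
  then have "integrable lborel (\<lambda>z. of_real ?a * G (?D *v z))"
    by (intro integrable_mult_right integrable_diag_substitution) simp_all
  then show "integrable lborel (\<lambda>z. (1 + 2 ^ \<nu> * norm z) ^ N * cmod (iso_dilate \<nu> \<phi> z))"
    unfolding eq[symmetric] by (simp only: complex_of_real_integrable_eq)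
  have "(LINT z|lborel. of_real ?a * G (?D *v z)) = of_real ?a * (LINT z|lborel. G (?D *v z))"
    by (rule integral_mult_right_zero)
  also have "\<dots> = (LINT w|lborel. G w)"
    using integral_diag_substitution[of "\<lambda>_::'d. 2 ^ \<nu>" G] iG by (simp add: det_diag_const)
  finally have "(LINT z|lborel. complex_of_real ((1 + 2 ^ \<nu> * norm z) ^ N * cmod (iso_dilate \<nu> \<phi> z))) =
      (LINT w|lborel. complex_of_real ((1 + norm w) ^ N * cmod (\<phi> w)))"
    unfolding eq G_def .
  then show "(LINT z|lborel. (1 + 2 ^ \<nu> * norm z) ^ N * cmod (iso_dilate \<nu> \<phi> z)) =
      (LINT w|lborel. (1 + norm w) ^ N * cmod (\<phi> w))"
    by (simp only: integral_complex_of_real of_real_eq_iff)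
qed

lemma fourier_iso_dilate_nonzeroD:
  fixes \<phi> :: "real^'d \<Rightarrow> complex"
  assumes "rapid \<phi>" and nz: "fourier (iso_dilate \<nu> \<phi>) \<xi> \<noteq> 0"
  shows "fourier \<phi> ((1 / 2 ^ \<nu>) *\<^sub>R \<xi>) \<noteq> 0"
proof -
  define a where "a = complex_of_real (2 ^ (CARD('d) * \<nu>))"
  have "fourier (iso_dilate \<nu> \<phi>) \<xi> = a * fourier (\<lambda>x. \<phi> (diag_mat (\<lambda>_. 2 ^ \<nu>) *v x)) \<xi>"
    unfolding fourier_def iso_dilate_diag a_def[symmetric] by (simp only: mult.assoc integral_mult_right_zero)
  moreover have "fourier (\<lambda>x. \<phi> (diag_mat (\<lambda>_. 2 ^ \<nu>) *v x)) \<xi> =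
      of_real \<bar>det (diag_mat (\<lambda>i::'d. 1 / 2 ^ \<nu>))\<bar> * fourier \<phi> (diag_mat (\<lambda>i. 1 / 2 ^ \<nu>) *v \<xi>)"
    by (rule fourier_diag) (use assms(1) in \<open>auto intro: rapid_measurable\<close>)
  moreover have "diag_mat (\<lambda>i. 1 / 2 ^ \<nu>) *v \<xi> = (1 / 2 ^ \<nu>) *\<^sub>R \<xi>" by (simp add: vec_eq_iff)
  ultimately show ?thesis using nz by auto
qed

context shear_setting
begin

lemma shear_TL_norm_dilate_finite:
  assumes p: "p > 0" and q: "q > 0"
  shows "shear_TL_norm h1 h2 H \<alpha> q p (dist_of (dilate J)) < \<infinity>"
proof -
  let ?I = "SIGMA \<delta>':(UNIV::'d set). SIGMA j:UNIV. shear_params \<delta>' j"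
  let ?F = "SIGMA \<delta>':(UNIV::'d set). SIGMA j:{..<J + 3}. shear_params \<delta>' j"
  define g where "g = (\<lambda>(\<delta>', j, l) x. of_real (vol_Q TYPE('d) j powr (- \<alpha>)) *
      conv_dist (mat_dilate (dil_shear \<delta>' j l) (tilde (psi \<delta>'))) (dist_of (dilate J)) x)"
  have eq: "(\<lambda>(\<delta>', j, l). ennreal (vol_Q TYPE('d) j powr (- \<alpha>) *
      cmod (conv_dist (mat_dilate (dil_shear \<delta>' j l) (tilde (psi \<delta>'))) (dist_of (dilate J)) x))) =
      (\<lambda>i. ennreal (cmod (g i x)))" for x
    by (auto simp: g_def fun_eq_iff norm_mult)
  have "Lp_norm p (\<lambda>x. lq_norm q ?I (\<lambda>i. ennreal (cmod (g i x)))) < \<infinity>"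
  proof (rule Lp_lq_norm_finite[OF p q])
    show "finite ?F" by (intro finite_SigmaI finite_shear_params) auto
    show "rapid (g i)" if "i \<in> ?F" for i
    proof -
      obtain \<delta>' j l where i: "i = (\<delta>', j, l)" by (cases i)
      with that have l: "l \<in> shear_params \<delta>' j" by simp
      show ?thesis unfolding i g_def split_conv
        by (intro rapid_cmult rapid_conv rapid_mat_dilate rapid_tilde rapid_psi rapid_dilate invertible_dil_shear[OF l])
    qed
    show "g i x = 0" if "i \<in> ?I" "i \<notin> ?F" for i x
      using that by (cases i) (auto simp: g_def intro: shear_coefficient_eq_0)
  qed
  moreover have "Lp_norm p (\<lambda>x. ennreal (cmod (conv_dist (inv_fourier H) (dist_of (dilate J)) x))) < \<infinity>"
    by (intro rapid_Lp_norm_finite p rapid_conv rapid_low_pass rapid_dilate)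
  ultimately show ?thesis by (simp add: shear_TL_norm_def eq)
qed

definition response_norm :: "real \<Rightarrow> real" where
  "response_norm p = enn2real (Lp_norm p (\<lambda>x. ennreal (cmod (response x))))"

lemma response_norm_pos:
  assumes p: "p > 0"
  shows "response_norm p > 0"
    and "Lp_norm p (\<lambda>x. ennreal (cmod (response x))) = ennreal (response_norm p)"
proof -
  let ?L = "Lp_norm p (\<lambda>x. ennreal (cmod (response x)))"
  have fin: "?L < \<infinity>" by (rule rapid_Lp_norm_finite[OF p rapid_response])
  have "?L \<noteq> 0"
  proof
    assume "?L = 0"
    then have "epow ?L p = 0" by (simp add: epow_ennreal[of 0, simplified])
    moreover have "epow ?L p = (\<integral>\<^sup>+x. epow (ennreal (cmod (response x))) p \<partial>lborel)"
      unfolding Lp_norm_def using epow_epow_inverse[of "1 / p"] p by simp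
    ultimately have "(\<integral>\<^sup>+x. ennreal (cmod (response x) powr p) \<partial>lborel) = 0"
      by (simp add: epow_ennreal)
    then have "AE x in lborel. ennreal (cmod (response x) powr p) = 0"
      using rapid_measurable[OF rapid_response] by (subst (asm) nn_integral_0_iff_AE) auto
    then have "AE x in lborel. response x = 0" by eventually_elim (simp add: ennreal_eq_0_iff)
    then have "response 0 = 0" by (rule continuous_AE_eq_0[OF continuous_response])
    with response_0_nonzero show False ..
  qed
  with fin show "response_norm p > 0" "?L = ennreal (response_norm p)"
    by (auto simp: response_norm_def enn2real_positive_iff zero_less_iff_neq_zero)
qed

text \<open>An l^q quasi-norm dominates each entry. The weight of the entry
  \<open>(\<delta>, J, 0)\<close> gives the exponent (d + 1) J \<alpha>, the Jacobian in the L^p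
  norm gives - (d + 1) J / p.\<close>

lemma shear_TL_norm_dilate_ge:
  assumes p: "p > 0" and q: "q > 0"
  shows "ennreal (response_norm p * 2 powr (real J * ((real CARD('d) + 1) * (\<alpha> - 1 / p)))) \<le>
    shear_TL_norm h1 h2 H \<alpha> q p (dist_of (dilate J))"
proof -
  let ?E = "diag_mat (dscale \<delta> J)"
  let ?D = "real (CARD('d) + 1) * real J"
  let ?v = "vol_Q TYPE('d) J powr (- \<alpha>)"
  have v: "?v = 2 powr (?D * \<alpha>)" "?v > 0" by (simp_all add: vol_Q_def powr_powr)
  have dt: "\<bar>det ?E\<bar> powr (- 1 / p) = 2 powr (?D * (- 1 / p))"
  proof -
    have "\<bar>det ?E\<bar> = 2 powr ?D" unfolding det_dscale by (simp add: powr_realpow[symmetric] algebra_simps)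
    then show ?thesis by (simp only: powr_powr)
  qed
  have [measurable]: "response \<in> borel_measurable borel" by (rule rapid_measurable[OF rapid_response])
  have "ennreal (response_norm p * 2 powr (real J * ((real CARD('d) + 1) * (\<alpha> - 1 / p)))) =
      ennreal ?v * (ennreal (\<bar>det ?E\<bar> powr (- 1 / p)) * ennreal (response_norm p))"
  proof -
    have "2 powr (real J * ((real CARD('d) + 1) * (\<alpha> - 1 / p))) = ?v * 2 powr (?D * (- 1 / p))"
      unfolding v(1) powr_add[symmetric] by (rule arg_cong[of _ _ "\<lambda>x. 2 powr x"]) (simp add: algebra_simps)
    then have "response_norm p * 2 powr (real J * ((real CARD('d) + 1) * (\<alpha> - 1 / p))) =
        ?v * (\<bar>det ?E\<bar> powr (- 1 / p) * response_norm p)" by (simp only: dt mult_ac)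
    then show ?thesis
      using response_norm_pos(1)[OF p] by (simp add: ennreal_mult mult_ac)
  qed
  also have "\<dots> = ennreal ?v * Lp_norm p (\<lambda>x. ennreal (cmod (response (?E *v x))))"
    using Lp_norm_diag[of "dscale \<delta> J" p "\<lambda>x. ennreal (cmod (response x))"] p
    by (simp add: dscale_nz response_norm_pos(2)[OF p, symmetric])
  also have "\<dots> = Lp_norm p (\<lambda>x. ennreal ?v * ennreal (cmod (response (?E *v x))))"
    by (rule Lp_norm_cmult[symmetric]) (use v p in auto)
  also have "\<dots> \<le> Lp_norm p (\<lambda>x. lq_norm q (SIGMA \<delta>':UNIV. SIGMA j:UNIV. shear_params \<delta>' j)
       (\<lambda>(\<delta>', j, l). ennreal (vol_Q TYPE('d) j powr (- \<alpha>) *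
          cmod (conv_dist (mat_dilate (dil_shear \<delta>' j l) (tilde (psi \<delta>'))) (dist_of (dilate J)) x))))"
    (is "_ \<le> Lp_norm p (\<lambda>x. lq_norm q ?I (?a x))")
  proof (rule Lp_norm_mono[OF p])
    fix x
    have "?a x (\<delta>, J, 0) \<le> lq_norm q ?I (?a x)"
      by (rule lq_norm_ge) (use q in \<open>auto simp: zero_in_shear_params\<close>)
    then show "ennreal ?v * ennreal (cmod (response (?E *v x))) \<le> lq_norm q ?I (?a x)"
      by (simp add: shear_coefficient_main ennreal_mult)
  qed
  also have "\<dots> \<le> shear_TL_norm h1 h2 H \<alpha> q p (dist_of (dilate J))"
    unfolding shear_TL_norm_def by simp
  finally show ?thesis .
qed

lemma conv_Phi_dilate_eq_0:
  assumes "J \<ge> 5"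
  shows "conv_dist \<Phi> (dist_of (dilate J)) x = 0"
proof (rule conv_dilate_eq_0[OF rapid_Phi])
  fix \<xi> assume "base_hat (diag_mat (\<lambda>i. 1 / dscale \<delta> J i) *v \<xi>) \<noteq> 0"
  then have "4 ^ J / 16 \<le> norm \<xi>" by (rule dilate_hat_support)
  moreover have "(4::real) ^ 5 \<le> 4 ^ J" using assms by (intro power_increasing) auto
  ultimately show "fourier \<Phi> \<xi> = 0" by (intro fourier_Phi_eq_0) simp
qed

text \<open>Intersecting the annuli gives 4^J/16 \<le> 2 * 2^\<nu> and 2^\<nu>/2 \<le> d 4^J/2. The
  first means 2 J \<le> \<nu> + 5; the second, with d \<le> 2^d, means \<nu> \<le> 2 J + d.\<close>

lemma conv_phi_dilate_eq_0:
  assumes \<nu>: "\<nu> \<notin> {2 * J - 5..2 * J + CARD('d)}"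
  shows "conv_dist (iso_dilate \<nu> \<phi>) (dist_of (dilate J)) x = 0"
proof (rule conv_dilate_eq_0[OF rapid_iso_dilate[OF rapid_phi]], rule ccontr)
  fix \<xi> assume "base_hat (diag_mat (\<lambda>i. 1 / dscale \<delta> J i) *v \<xi>) \<noteq> 0"
  note supp = dilate_hat_support[OF this]
  assume "fourier (iso_dilate \<nu> \<phi>) \<xi> \<noteq> 0"
  then have "fourier \<phi> ((1 / 2 ^ \<nu>) *\<^sub>R \<xi>) \<noteq> 0" by (rule fourier_iso_dilate_nonzeroD[OF rapid_phi])
  from fourier_phi_nonzeroD[OF this] have n: "2 ^ \<nu> / 2 \<le> norm \<xi>" "norm \<xi> \<le> 2 * 2 ^ \<nu>"
    by (auto simp: field_simps)
  have four: "(4::real) ^ J = 2 ^ (2 * J)" by (simp add: power_mult)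
  have "(4::real) ^ J \<le> 32 * 2 ^ \<nu>" using supp(1) n(2) by simp
  then have "(2::real) ^ (2 * J) \<le> 2 ^ (\<nu> + 5)" by (simp add: four power_add)
  then have 1: "2 * J \<le> \<nu> + 5" by (simp only: power_increasing_iff one_less_numeral_iff semiring_norm)
  have "(2::real) ^ \<nu> \<le> real CARD('d) * 4 ^ J" using supp(2) n(1) by simp
  also have "\<dots> \<le> 2 ^ CARD('d) * 4 ^ J"
    by (intro mult_right_mono) (simp_all add: less_imp_le)
  also have "\<dots> = 2 ^ (2 * J + CARD('d))" by (simp add: four power_add)
  finally have "\<nu> \<le> 2 * J + CARD('d)" by (simp only: power_increasing_iff one_less_numeral_iff semiring_norm)
  with 1 \<nu> show False by auto
qed

text \<open>\<open>dilate J\<close> decays at scale 2^J in every direction by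
  \<open>norm_dscale_ge\<close>. For J \<le> \<nu> the finer kernel is integrable against that
  weight with a bound free of J and \<nu>.\<close>

lemma conv_phi_dilate_bound:
  obtains A where "A \<ge> 0" "\<And>J \<nu> x. J \<le> \<nu> \<Longrightarrow>
    cmod (conv_dist (iso_dilate \<nu> \<phi>) (dist_of (dilate J)) x) \<le> A / (1 + 2 ^ J * norm x) ^ N"
proof -
  obtain A0 where A0: "A0 > 0" "\<And>x. (1 + norm x) ^ N * cmod (base x) \<le> A0"
    using rapidE[OF rapid_base] by metis
  define B where "B = (LINT w|lborel. (1 + norm w) ^ N * cmod (\<phi> w))"
  have B: "B \<ge> 0" unfolding B_def by (intro Bochner_Integration.integral_nonneg) simp
  show ?thesis
  proof (rule that)
    show "A0 * B \<ge> 0" using A0 B by simp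
    fix J \<nu> :: nat and x :: "real^'d" assume J: "J \<le> \<nu>"
    have le: "(1 + 2 ^ J * norm z) ^ N \<le> (1 + 2 ^ \<nu> * norm z) ^ N" for z :: "real^'d"
      using J by (intro power_mono add_left_mono mult_right_mono power_increasing) auto
    have int: "integrable lborel (\<lambda>z. (1 + 2 ^ J * norm z) ^ N * cmod (iso_dilate \<nu> \<phi> z))"
    proof (rule Bochner_Integration.integrable_bound[OF iso_dilate_weighted(1)[OF rapid_phi]])
      show "(\<lambda>z. (1 + 2 ^ J * norm z) ^ N * cmod (iso_dilate \<nu> \<phi> z)) \<in> borel_measurable lborel"
        using rapid_measurable[OF rapid_iso_dilate[OF rapid_phi]] by simp
      show "AE z in lborel. norm ((1 + 2 ^ J * norm z) ^ N * cmod (iso_dilate \<nu> \<phi> z)) \<le>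
          norm ((1 + 2 ^ \<nu> * norm z) ^ N * cmod (iso_dilate \<nu> \<phi> z))"
        using le by (intro AE_I2) (simp add: abs_mult mult_right_mono)
    qed
    have "(1 + 2 ^ J * norm x) ^ N * cmod (conv_dist (iso_dilate \<nu> \<phi>) (dist_of (dilate J)) x) \<le> A0 * B"
    proof (rule conv_decay[OF _ _ int])
      fix y :: "real^'d"
      have "(1 + 2 ^ J * norm y) ^ N * cmod (dilate J y) \<le> (1 + norm (diag_mat (dscale \<delta> J) *v y)) ^ N * cmod (dilate J y)"
        by (intro mult_right_mono power_mono add_left_mono norm_dscale_ge) auto
      also have "\<dots> \<le> A0" unfolding dilate_def by (rule A0(2))
      finally show "(1 + 2 ^ J * norm y) ^ N * cmod (dilate J y) \<le> A0" .
    next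
      have "(LINT z|lborel. (1 + 2 ^ J * norm z) ^ N * cmod (iso_dilate \<nu> \<phi> z)) \<le>
          (LINT z|lborel. (1 + 2 ^ \<nu> * norm z) ^ N * cmod (iso_dilate \<nu> \<phi> z))"
        by (intro integral_mono int iso_dilate_weighted(1)[OF rapid_phi] mult_right_mono le) simp
      also have "\<dots> = B" unfolding B_def by (rule iso_dilate_weighted(2)[OF rapid_phi])
      finally show "(LINT z|lborel. (1 + 2 ^ J * norm z) ^ N * cmod (iso_dilate \<nu> \<phi> z)) \<le> B" .
    qed simp
    moreover have "0 < (1 + 2 ^ J * norm x) ^ N" by (simp add: add_pos_nonneg)
    ultimately show "cmod (conv_dist (iso_dilate \<nu> \<phi>) (dist_of (dilate J)) x) \<le> A0 * B / (1 + 2 ^ J * norm x) ^ N"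
      by (simp add: pos_le_divide_eq mult.commute)
  qed
qed

lemma TL_norm_dilate_le:
  assumes p: "p > 0" and q: "q > 0"
  obtains C where "C \<ge> 0" "\<And>J. J \<ge> 5 \<Longrightarrow> TL_norm \<phi> \<Phi> \<alpha> q p (dist_of (dilate J)) \<le>
    ennreal (C * 2 powr (real J * (2 * \<alpha> - real CARD('d) / p)))"
proof -
  let ?d = "CARD('d)"
  obtain N where N: "real N * p \<ge> real (DIM(real^'d) + 2)" by (rule exists_decay_exponent[OF p])
  obtain A where A: "A \<ge> 0" "\<And>J \<nu> x. J \<le> \<nu> \<Longrightarrow>
    cmod (conv_dist (iso_dilate \<nu> \<phi>) (dist_of (dilate J)) x) \<le> A / (1 + 2 ^ J * norm x) ^ N"
    using conv_phi_dilate_bound[of N] by metis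
  \<comment> \<open>The window of active \<nu> has at most d + 6 elements.\<close>
  define L where "L = lq_const q (?d + 6)"
  \<comment> \<open>Bounds the variation of the weight 2^(\<nu> \<alpha>) over the window, where
    \<nu> differs from 2 J by at most d + 5.\<close>
  define W where "W = 2 powr ((real ?d + 5) * \<bar>\<alpha>\<bar>)"
  have L: "L \<ge> 0" by (simp add: L_def lq_const_nonneg)
  show ?thesis
  proof (rule that)
    show "L * W * A * decay_const TYPE(real^'d) p N \<ge> 0"
      using L A(1) by (simp add: W_def decay_const_nonneg)
    fix J :: nat assume J: "J \<ge> 5"
    let ?F = "{2 * J - 5..2 * J + ?d}"
    let ?a = "\<lambda>x \<nu>. ennreal (2 powr (real \<nu> * \<alpha>) * cmod (conv_dist (iso_dilate \<nu> \<phi>) (dist_of (dilate J)) x))"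
    let ?w = "2 powr (2 * real J * \<alpha>)"
    have "lq_norm q UNIV (?a x) \<le> ennreal (L * (?w * W * A) / (1 + 2 ^ J * norm x) ^ N)" for x
    proof -
      have pos: "0 < (1 + 2 ^ J * norm x) ^ N" by (simp add: add_pos_nonneg)
      have "?a x \<nu> \<le> ennreal (?w * W * (A / (1 + 2 ^ J * norm x) ^ N))" for \<nu>
      proof (cases "\<nu> \<in> ?F")
        case True
        \<comment> \<open>\<open>J \<ge> 5\<close> gives 2 J - 5 \<ge> J, so that every active \<nu>
          satisfies the condition of \<open>A(2)\<close>, and the natural subtraction is
          exact.\<close>
        then have "\<bar>real \<nu> - 2 * real J\<bar> \<le> real ?d + 5" and le: "J \<le> \<nu>" using J by auto
        then have "(real \<nu> - 2 * real J) * \<alpha> \<le> (real ?d + 5) * \<bar>\<alpha>\<bar>"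
          using mult_right_mono[of "\<bar>real \<nu> - 2 * real J\<bar>" "real ?d + 5" "\<bar>\<alpha>\<bar>"]
            abs_ge_self[of "(real \<nu> - 2 * real J) * \<alpha>"] by (simp add: abs_mult)
        then have "2 powr (real \<nu> * \<alpha>) \<le> 2 powr (2 * real J * \<alpha> + (real ?d + 5) * \<bar>\<alpha>\<bar>)"
          by (intro powr_mono) (auto simp: algebra_simps)
        also have "\<dots> = ?w * W" by (simp add: W_def powr_add)
        finally show ?thesis
          using A(2)[OF le, of x] by (intro ennreal_leI mult_mono) (auto simp: W_def)
      next
        case False
        then show ?thesis by (simp add: conv_phi_dilate_eq_0)
      qed
      then have "lq_norm q UNIV (?a x) \<le> ennreal (L * (?w * W * (A / (1 + 2 ^ J * norm x) ^ N)))"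
        unfolding L_def using q A(1) pos J
        by (intro lq_norm_le[where F = ?F]) (auto simp: conv_phi_dilate_eq_0 W_def)
      then show ?thesis by (simp add: mult.assoc)
    qed
    then have "Lp_norm p (\<lambda>x. lq_norm q UNIV (?a x)) \<le>
        ennreal (L * (?w * W * A) * (2 ^ J) powr (- real DIM(real^'d) / p) * decay_const TYPE(real^'d) p N)"
      using L A(1) by (intro Lp_norm_decay[OF p N]) (auto simp: W_def)
    also have "L * (?w * W * A) * (2 ^ J) powr (- real DIM(real^'d) / p) * decay_const TYPE(real^'d) p N =
        L * W * A * decay_const TYPE(real^'d) p N * 2 powr (real J * (2 * \<alpha> - real ?d / p))"
    proof -
      have "((2::real) ^ J) powr (- real DIM(real^'d) / p) = 2 powr (real J * (- real ?d / p))"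
        by (simp add: powr_realpow[symmetric] powr_powr)
      moreover have "?w * 2 powr (real J * (- real ?d / p)) = 2 powr (real J * (2 * \<alpha> - real ?d / p))"
        unfolding powr_add[symmetric] by (rule arg_cong[of _ _ "\<lambda>x. 2 powr x"]) (simp add: algebra_simps)
      moreover have "L * (?w * W * A) * P * K = L * W * A * K * (?w * P)" for P K
        by (simp only: mult_ac)
      ultimately show ?thesis by (simp only:)
    qed
    finally have 2: "Lp_norm p (\<lambda>x. lq_norm q UNIV (?a x)) \<le>
        ennreal (L * W * A * decay_const TYPE(real^'d) p N * 2 powr (real J * (2 * \<alpha> - real ?d / p)))" .
    have 1: "Lp_norm p (\<lambda>x. ennreal (cmod (conv_dist \<Phi> (dist_of (dilate J)) x))) = 0"
      by (simp add: conv_Phi_dilate_eq_0[OF J] Lp_norm_def epow_ennreal[of 0, simplified])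
    show "TL_norm \<phi> \<Phi> \<alpha> q p (dist_of (dilate J)) \<le>
      ennreal (L * W * A * decay_const TYPE(real^'d) p N * 2 powr (real J * (2 * \<alpha> - real ?d / p)))"
      unfolding TL_norm_def 1 using 2 by simp
  qed
qed

end

section \<open>The theorem\<close>

theorem theorem7p8:
  fixes \<phi> \<Phi> \<Psi>_hat :: "real^'d \<Rightarrow> complex"
    and \<psi>1_hat \<psi>2_hat :: "real \<Rightarrow> complex"
    and \<alpha>1 \<alpha>2 p1 p2 :: real
    and q1 q2 :: ennreal
  assumes "CARD('d) \<ge> 2"
    and "isotropic_system \<phi> \<Phi>"
    and "shear_generators \<psi>1_hat \<psi>2_hat"
    and "shear_low_pass \<psi>1_hat \<psi>2_hat \<Psi>_hat"
    and "0 < q1" and "0 < q2"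
    and "0 < p1" and "0 < p2"
    and "2 * (\<alpha>1 + real CARD('d)) <
           (real CARD('d) + 1) * (\<alpha>2 - 1 / p2 + 1) + real CARD('d) / p1"
  shows "\<exists>f :: nat \<Rightarrow> real^'d \<Rightarrow> complex.
    (\<forall>j. tempered_function (f j) \<and>
         dist_of (f j) \<in> shear_TL_space \<psi>1_hat \<psi>2_hat \<Psi>_hat \<alpha>2 q2 p2 \<and>
         dist_of (f j) \<in> TL_space \<phi> \<Phi> \<alpha>1 q1 p1) \<and>
    (\<exists>c C :: real. 0 < c \<and> 0 < C \<and>
       (\<forall>j. ennreal c \<le> shear_TL_norm \<psi>1_hat \<psi>2_hat \<Psi>_hat \<alpha>2 q2 p2 (dist_of (f j)) \<and>
            shear_TL_norm \<psi>1_hat \<psi>2_hat \<Psi>_hat \<alpha>2 q2 p2 (dist_of (f j)) \<le> ennreal C)) \<and>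
    (\<lambda>j. TL_norm \<phi> \<Phi> \<alpha>1 q1 p1 (dist_of (f j))) \<longlonglongrightarrow> 0"
proof -
  \<comment> \<open>The cone directions are interchangeable; any one serves.\<close>
  obtain \<delta> :: 'd where True by blast
  interpret shear_setting \<phi> \<Phi> \<Psi>_hat \<psi>1_hat \<psi>2_hat \<delta>
    by unfold_locales (use assms in auto)
  define d where "d = real CARD('d)"
  define a where "a = (d + 1) * (\<alpha>2 - 1 / p2)"
  define b where "b = 2 * \<alpha>1 - d / p1"
  have "1 \<le> d" using assms(1) by (simp add: d_def)
  have "2 * \<alpha>1 + 2 * d < a + (d + 1) + d / p1"
    using assms(9) unfolding d_def[symmetric] a_def by (simp add: algebra_simps)
  \<comment> \<open>The hypothesis reads b < a + 1 - d, and 1 - d \<le> 0.\<close>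
  then have "b < a" using \<open>1 \<le> d\<close> by (simp add: b_def)
  define s where "s J = shear_TL_norm \<psi>1_hat \<psi>2_hat \<Psi>_hat \<alpha>2 q2 p2 (dist_of (dilate J))" for J
  define \<sigma> where "\<sigma> J = enn2real (s J)" for J
  let ?c0 = "response_norm p2"
  have c0: "?c0 > 0" by (rule response_norm_pos(1)[OF assms(8)])
  have s_fin: "s J < \<infinity>" for J
    unfolding s_def by (rule shear_TL_norm_dilate_finite[OF assms(8,6)])
  have s_eq: "s J = ennreal (\<sigma> J)" for J
    using s_fin[of J] by (simp add: \<sigma>_def)
  have "ennreal (?c0 * 2 powr (real J * a)) \<le> s J" for J
    unfolding s_def a_def d_def by (rule shear_TL_norm_dilate_ge[OF assms(8,6)])
  then have s_ge: "?c0 * 2 powr (real J * a) \<le> \<sigma> J" for J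
    unfolding s_eq by (subst (asm) ennreal_le_iff) (simp_all add: \<sigma>_def)
  have s_pos: "\<sigma> J > 0" for J
    by (rule less_le_trans[OF _ s_ge]) (simp add: c0)
  obtain C where C: "C \<ge> 0" "\<And>J. J \<ge> 5 \<Longrightarrow>
      TL_norm \<phi> \<Phi> \<alpha>1 q1 p1 (dist_of (dilate J)) \<le> ennreal (C * 2 powr (real J * b))"
    using TL_norm_dilate_le[OF assms(7,5), of \<alpha>1] unfolding b_def d_def by metis
  \<comment> \<open>The shift by 5 starts the sequence where the isotropic estimate
    \<open>C(2)\<close> is available.\<close>
  define f where "f j x = of_real (1 / \<sigma> (j + 5)) * dilate (j + 5) x" for j x
  have shear1: "shear_TL_norm \<psi>1_hat \<psi>2_hat \<Psi>_hat \<alpha>2 q2 p2 (dist_of (f j)) = 1" for j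
  proof -
    have "shear_TL_norm \<psi>1_hat \<psi>2_hat \<Psi>_hat \<alpha>2 q2 p2 (dist_of (f j)) = ennreal (1 / \<sigma> (j + 5)) * s (j + 5)"
      unfolding f_def[abs_def] s_def by (rule shear_TL_norm_cmult) (use s_pos assms in auto)
    also have "\<dots> = ennreal (1 / \<sigma> (j + 5) * \<sigma> (j + 5))"
      unfolding s_eq by (rule ennreal_mult[symmetric]) (use s_pos[of "j + 5"] in auto)
    also have "1 / \<sigma> (j + 5) * \<sigma> (j + 5) = 1" using s_pos[of "j + 5"] by simp
    finally show ?thesis by simp
  qed
  define r where "r = 2 powr (b - a)"
  have r: "0 \<le> r" "r < 1" using \<open>b < a\<close> by (auto simp: r_def powr_less_one)
  have TL: "TL_norm \<phi> \<Phi> \<alpha>1 q1 p1 (dist_of (f j)) \<le> ennreal (C / ?c0 * r ^ (j + 5))" for j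
  proof -
    let ?J = "j + 5"
    have "TL_norm \<phi> \<Phi> \<alpha>1 q1 p1 (dist_of (f j)) =
        ennreal (1 / \<sigma> ?J) * TL_norm \<phi> \<Phi> \<alpha>1 q1 p1 (dist_of (dilate ?J))"
      unfolding f_def[abs_def] by (rule TL_norm_cmult) (use s_pos assms in auto)
    also have "\<dots> \<le> ennreal (1 / \<sigma> ?J) * ennreal (C * 2 powr (real ?J * b))"
      by (intro mult_left_mono C(2)) simp_all
    also have "\<dots> = ennreal (1 / \<sigma> ?J * (C * 2 powr (real ?J * b)))"
      by (rule ennreal_mult[symmetric]) (use s_pos[of ?J] C(1) in auto)
    also have "\<dots> \<le> ennreal (1 / (?c0 * 2 powr (real ?J * a)) * (C * 2 powr (real ?J * b)))"
      using s_ge[of ?J] s_pos[of ?J] c0 C(1)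
      by (intro ennreal_leI mult_right_mono divide_left_mono mult_pos_pos) auto
    also have "1 / (?c0 * 2 powr (real ?J * a)) * (C * 2 powr (real ?J * b)) = C / ?c0 * r ^ ?J"
    proof -
      have "r ^ ?J = 2 powr ((b - a) * real ?J)"
        unfolding r_def by (simp only: powr_realpow[symmetric] powr_powr powr_gt_zero zero_less_numeral)
      also have "\<dots> = 2 powr (real ?J * b) / 2 powr (real ?J * a)"
        unfolding powr_diff[symmetric] by (rule arg_cong[of _ _ "\<lambda>x. 2 powr x"]) (simp add: algebra_simps)
      finally show ?thesis by simp
    qed
    finally show ?thesis .
  qed
  have "(\<lambda>j. C / ?c0 * r ^ (j + 5)) \<longlonglongrightarrow> C / ?c0 * 0"
    using r by (intro tendsto_mult_left LIMSEQ_ignore_initial_segment LIMSEQ_realpow_zero)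
  then have "(\<lambda>j. ennreal (C / ?c0 * r ^ (j + 5))) \<longlonglongrightarrow> ennreal 0"
    by (intro tendsto_ennrealI) simp
  then have lim: "(\<lambda>j. ennreal (C / ?c0 * r ^ (j + 5))) \<longlonglongrightarrow> 0" by simp
  have TL_lim: "(\<lambda>j. TL_norm \<phi> \<Phi> \<alpha>1 q1 p1 (dist_of (f j))) \<longlonglongrightarrow> 0"
    by (rule tendsto_sandwich[OF _ _ tendsto_const lim]; intro always_eventually allI TL zero_le)
  have temp: "tempered_function (f j)" for j
    unfolding f_def[abs_def] by (intro rapid_tempered_function rapid_cmult rapid_dilate)
  have "dist_of (f j) \<in> shear_TL_space \<psi>1_hat \<psi>2_hat \<Psi>_hat \<alpha>2 q2 p2" for j
    using temp[of j] shear1[of j] by (simp add: shear_TL_space_def tempered_function_def)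
  moreover have "dist_of (f j) \<in> TL_space \<phi> \<Phi> \<alpha>1 q1 p1" for j
    using temp[of j] le_less_trans[OF TL[of j] ennreal_less_top]
    by (simp add: TL_space_def tempered_function_def)
  moreover have "\<exists>c C :: real. 0 < c \<and> 0 < C \<and>
       (\<forall>j. ennreal c \<le> shear_TL_norm \<psi>1_hat \<psi>2_hat \<Psi>_hat \<alpha>2 q2 p2 (dist_of (f j)) \<and>
            shear_TL_norm \<psi>1_hat \<psi>2_hat \<Psi>_hat \<alpha>2 q2 p2 (dist_of (f j)) \<le> ennreal C)"
    by (rule exI[of _ 1], rule exI[of _ 1]) (simp add: shear1)
  ultimately show ?thesis using temp TL_lim by blast
qed

end
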